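(* There exists a topologically weakly mixing, uniquely ergodic minimal Cantor system $(X,T)$ of finite topological rank whose group of eigenvalues for the unique invariant probability measure contains an isomorphic copy of $\mathbb{Q}$.
   Context: A minimal Cantor system $(X,T)$ is a homeomorphism $T$ of a Cantor set $X$ all of whose orbits are dense. It is uniquely ergodic if it has exactly one $T$-invariant Borel probability measure. For an invariant Borel probability measure $\mu$, a complex number $\lambda$ is an eigenvalue of $(X,T)$ for $\mu$ if there is $f\in L^2(X,\mu)$, $f\ne0$, with $f\circ T=\lambda f$; when $\mu$ is ergodic, all eigenvalues have modulus 1 and they form a group under multiplication, the group of eigenvalues for $\mu$. $(X,T)$ is topologically weakly mixing if there is no non-constant continuous $f:X\to\mathbb{C}$ with $f\circ T=\lambda f$ for some $\lambda\in\mathbb{C}$. Topological rank. A Bratteli diagram $(V,E)$ is an infinite graph with finite pairwise disjoint vertex levels $V_0=\{v_0\},V_1,V_2,\dots$ and finite edge levels $E_1,E_2,\dots$, each $e\in E_n$ going from a source in $V_{n-1}$ to a range in $V_n$, every vertex being the source of some edge and every vertex other than $v_0$ the range of some edge. It is simple if for every $m\ge1$ there is $n>m$ such that every $u\in V_m$ is joined by a path to every $v\in V_n$. An ordered diagram $B=(V,E,\preceq)$ carries a partial order on $E$ in which two edges are comparable iff they have the same range. $X_B$ is the space of infinite paths from $v_0$ with the cylinder topology. $B$ is properly ordered if there is a unique infinite path $x_{\max}$ with all edges maximal and a unique infinite path $x_{\min}$ with all edges minimal. The Vershik map $V_B$ sends $x_{\max}$ to $x_{\min}$ and sends $x\neq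 x_{\max}$ to the path obtained by taking the smallest $n$ with $x_n$ not maximal, replacing $x_n$ by its successor $y_n$, replacing $(x_1,\dots,x_{n-1})$ by the minimal path from $v_0$ to the source of $y_n$, and leaving the rest unchanged. A Bratteli-Vershik representation of $(X,T)$ is a properly ordered simple $B$ with $(X,T)$ topologically conjugate to $(X_B,V_B)$. $(X,T)$ is of finite topological rank if it admits such a representation with $\#V_n$ uniformly bounded by some integer $d$; the minimum possible $d$ is the topological rank. *)

theory Defs
  imports "HOL-Probability.Probability" "HOL-Algebra.Group"
begin

section \<open>Minimal Cantor systems\<close>

definition cantor_space :: "'a topology \<Rightarrow> bool" where
  "cantor_space X \<longleftrightarrow>
     X homeomorphic_space product_topology (\<lambda>_::nat. discrete_topology (UNIV :: bool set)) UNIV"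

definition two_sided_orbit :: "'a topology \<Rightarrow> ('a \<Rightarrow> 'a) \<Rightarrow> 'a \<Rightarrow> 'a set" where
  "two_sided_orbit X T x =
     range (\<lambda>n::nat. (T ^^ n) x) \<union> range (\<lambda>n::nat. (inv_into (topspace X) T ^^ n) x)"

definition minimal_cantor_system :: "'a topology \<Rightarrow> ('a \<Rightarrow> 'a) \<Rightarrow> bool" where
  "minimal_cantor_system X T \<longleftrightarrow>
     cantor_space X \<and> homeomorphic_map X X T \<and>
     (\<forall>x\<in>topspace X. X closure_of two_sided_orbit X T x = topspace X)"

definition topologically_conjugate ::
  "'a topology \<Rightarrow> ('a \<Rightarrow> 'a) \<Rightarrow> 'b topology \<Rightarrow> ('b \<Rightarrow> 'b) \<Rightarrow> bool" where
  "topologically_conjugate X T Y S \<longleftrightarrow>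
     (\<exists>h. homeomorphic_map X Y h \<and> (\<forall>x\<in>topspace X. h (T x) = S (h x)))"

definition topologically_weakly_mixing :: "'a topology \<Rightarrow> ('a \<Rightarrow> 'a) \<Rightarrow> bool" where
  "topologically_weakly_mixing X T \<longleftrightarrow>
     \<not> (\<exists>f :: 'a \<Rightarrow> complex. continuous_map X euclidean f \<and>
          \<not> (\<exists>c. \<forall>x\<in>topspace X. f x = c) \<and>
          (\<exists>z. \<forall>x\<in>topspace X. f (T x) = z * f x))"

section \<open>Invariant measures and eigenvalues\<close>

definition invariant_borel_prob :: "'a topology \<Rightarrow> ('a \<Rightarrow> 'a) \<Rightarrow> 'a measure \<Rightarrow> bool" where
  "invariant_borel_prob X T \<mu> \<longleftrightarrow>
     space \<mu> = topspace X \<and>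
     sets \<mu> = sigma_sets (topspace X) {U. openin X U} \<and>
     prob_space \<mu> \<and> T \<in> measurable \<mu> \<mu> \<and> distr \<mu> \<mu> T = \<mu>"

definition uniquely_ergodic :: "'a topology \<Rightarrow> ('a \<Rightarrow> 'a) \<Rightarrow> bool" where
  "uniquely_ergodic X T \<longleftrightarrow> (\<exists>!\<mu>. invariant_borel_prob X T \<mu>)"

text \<open>Elements of the Hilbert space of square-integrable functions are represented by
  functions, and equality in it is equality almost everywhere.\<close>

definition eigenvalues :: "'a measure \<Rightarrow> ('a \<Rightarrow> 'a) \<Rightarrow> complex set" where
  "eigenvalues \<mu> T =
     {z. \<exists>f \<in> borel_measurable \<mu>.
           integrable \<mu> (\<lambda>x. (cmod (f x))\<^sup>2) \<and>
           \<not> (AE x in \<mu>. f x = 0) \<and>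
           (AE x in \<mu>. f (T x) = z * f x)}"

definition eigenvalue_group :: "'a measure \<Rightarrow> ('a \<Rightarrow> 'a) \<Rightarrow> complex monoid" where
  "eigenvalue_group \<mu> T = \<lparr>carrier = eigenvalues \<mu> T, monoid.mult = (*), one = 1\<rparr>"

definition rat_additive_group :: "rat monoid" where
  "rat_additive_group = \<lparr>carrier = UNIV, monoid.mult = (+), one = 0\<rparr>"

section \<open>Ordered Bratteli diagrams\<close>

text \<open>The field \<open>edges B n\<close> holds the edges from level \<open>n\<close> to level \<open>n + 1\<close>, so it is the
  edge level usually written with index \<open>n + 1\<close>; accordingly an infinite path \<open>x\<close> from the
  top vertex has \<open>x n \<in> edges B n\<close> for all \<open>n \<ge> 0\<close>.\<close>

record ('v, 'e) bratteli =
  verts :: "nat \<Rightarrow> 'v set"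
  edges :: "nat \<Rightarrow> 'e set"
  src :: "'e \<Rightarrow> 'v"
  rng :: "'e \<Rightarrow> 'v"
  edge_le :: "('e \<times> 'e) set"

definition all_edges :: "('v, 'e) bratteli \<Rightarrow> 'e set" where
  "all_edges B = (\<Union>n. edges B n)"

definition bratteli_diagram :: "('v, 'e) bratteli \<Rightarrow> bool" where
  "bratteli_diagram B \<longleftrightarrow>
     (\<exists>v\<^sub>0. verts B 0 = {v\<^sub>0}) \<and>
     (\<forall>n. finite (verts B n)) \<and>
     (\<forall>m n. m \<noteq> n \<longrightarrow> verts B m \<inter> verts B n = {}) \<and>
     (\<forall>n. finite (edges B n)) \<and>
     (\<forall>n. \<forall>e\<in>edges B n. src B e \<in> verts B n \<and> rng B e \<in> verts B (Suc n)) \<and>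
     (\<forall>n. \<forall>v\<in>verts B n. \<exists>e\<in>edges B n. src B e = v) \<and>
     (\<forall>n. \<forall>v\<in>verts B (Suc n). \<exists>e\<in>edges B n. rng B e = v)"

definition ordered_bratteli_diagram :: "('v, 'e) bratteli \<Rightarrow> bool" where
  "ordered_bratteli_diagram B \<longleftrightarrow>
     bratteli_diagram B \<and>
     partial_order_on (all_edges B) (edge_le B) \<and>
     (\<forall>e\<in>all_edges B. \<forall>f\<in>all_edges B.
        (e, f) \<in> edge_le B \<or> (f, e) \<in> edge_le B \<longleftrightarrow> rng B e = rng B f)"

definition joined_by_path :: "('v, 'e) bratteli \<Rightarrow> nat \<Rightarrow> nat \<Rightarrow> 'v \<Rightarrow> 'v \<Rightarrow> bool" where
  "joined_by_path B m n u v \<longleftrightarrow>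
     m < n \<and>
     (\<exists>p. (\<forall>i\<in>{m..<n}. p i \<in> edges B i) \<and>
          (\<forall>i. m \<le> i \<and> Suc i < n \<longrightarrow> rng B (p i) = src B (p (Suc i))) \<and>
          src B (p m) = u \<and> rng B (p (n - 1)) = v)"

definition simple_bratteli :: "('v, 'e) bratteli \<Rightarrow> bool" where
  "simple_bratteli B \<longleftrightarrow>
     (\<forall>m\<ge>1. \<exists>n>m. \<forall>u\<in>verts B m. \<forall>v\<in>verts B n. joined_by_path B m n u v)"

definition paths :: "('v, 'e) bratteli \<Rightarrow> (nat \<Rightarrow> 'e) set" where
  "paths B = {x. \<forall>n. x n \<in> edges B n \<and> rng B (x n) = src B (x (Suc n))}"

definition path_cylinder :: "('v, 'e) bratteli \<Rightarrow> nat \<Rightarrow> (nat \<Rightarrow> 'e) \<Rightarrow> (nat \<Rightarrow> 'e) set" where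
  "path_cylinder B n p = {x \<in> paths B. \<forall>i<n. x i = p i}"

definition path_topology :: "('v, 'e) bratteli \<Rightarrow> (nat \<Rightarrow> 'e) topology" where
  "path_topology B = topology_generated_by {path_cylinder B n p |n p. p \<in> paths B}"

definition max_edge :: "('v, 'e) bratteli \<Rightarrow> 'e \<Rightarrow> bool" where
  "max_edge B e \<longleftrightarrow> e \<in> all_edges B \<and> (\<forall>f\<in>all_edges B. (e, f) \<in> edge_le B \<longrightarrow> f = e)"

definition min_edge :: "('v, 'e) bratteli \<Rightarrow> 'e \<Rightarrow> bool" where
  "min_edge B e \<longleftrightarrow> e \<in> all_edges B \<and> (\<forall>f\<in>all_edges B. (f, e) \<in> edge_le B \<longrightarrow> f = e)"

definition is_max_path :: "('v, 'e) bratteli \<Rightarrow> (nat \<Rightarrow> 'e) \<Rightarrow> bool" where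
  "is_max_path B x \<longleftrightarrow> x \<in> paths B \<and> (\<forall>n. max_edge B (x n))"

definition is_min_path :: "('v, 'e) bratteli \<Rightarrow> (nat \<Rightarrow> 'e) \<Rightarrow> bool" where
  "is_min_path B x \<longleftrightarrow> x \<in> paths B \<and> (\<forall>n. min_edge B (x n))"

definition properly_ordered :: "('v, 'e) bratteli \<Rightarrow> bool" where
  "properly_ordered B \<longleftrightarrow>
     ordered_bratteli_diagram B \<and> (\<exists>!x. is_max_path B x) \<and> (\<exists>!x. is_min_path B x)"

definition is_edge_succ :: "('v, 'e) bratteli \<Rightarrow> 'e \<Rightarrow> 'e \<Rightarrow> bool" where
  "is_edge_succ B e f \<longleftrightarrow>
     (e, f) \<in> edge_le B \<and> f \<noteq> e \<and>
     (\<forall>g. (e, g) \<in> edge_le B \<and> g \<noteq> e \<longrightarrow> (f, g) \<in> edge_le B)"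

text \<open>Requiring \<open>y \<in> paths B\<close> below forces the minimal initial segment of \<open>y\<close> to end at the
  source of \<open>y n\<close>, and there is exactly one such segment.  The values of the map outside
  \<open>paths B\<close> are irrelevant.\<close>

definition vershik_map :: "('v, 'e) bratteli \<Rightarrow> (nat \<Rightarrow> 'e) \<Rightarrow> (nat \<Rightarrow> 'e)" where
  "vershik_map B x =
     (if is_max_path B x then (THE y. is_min_path B y)
      else (let n = (LEAST n. \<not> max_edge B (x n)) in
        (THE y. y \<in> paths B \<and> (\<forall>i<n. min_edge B (y i)) \<and>
                is_edge_succ B (x n) (y n) \<and> (\<forall>i>n. y i = x i))))"

definition bratteli_vershik_representation ::
  "('v, 'e) bratteli \<Rightarrow> 'a topology \<Rightarrow> ('a \<Rightarrow> 'a) \<Rightarrow> bool" where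
  "bratteli_vershik_representation B X T \<longleftrightarrow>
     properly_ordered B \<and> simple_bratteli B \<and>
     topologically_conjugate X T (path_topology B) (vershik_map B)"

text \<open>A Bratteli diagram has countably many vertices and edges, so up to relabelling both
  may be taken to be natural numbers.\<close>

definition finite_topological_rank :: "'a topology \<Rightarrow> ('a \<Rightarrow> 'a) \<Rightarrow> bool" where
  "finite_topological_rank X T \<longleftrightarrow>
     (\<exists>(B :: (nat, nat) bratteli) d.
        bratteli_vershik_representation B X T \<and> (\<forall>n. card (verts B n) \<le> d))"

end

theory Submission
  imports Defs
begin

text \<open>Take two towers of heights \<open>h\<close> and \<open>h + 1\<close> at every level and stack them by the substitution
  \<open>A \<mapsto> A\<^sup>a B\<^sup>k\<close>, \<open>B \<mapsto> A\<^sup>a\<^sup>-\<^sup>1 B\<^sup>k\<^sup>+\<^sup>1\<close>, which again produces heights differing by one.  A continuous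
  eigenvalue \<open>z\<close> satisfies both \<open>z ^ h \<longlonglongrightarrow> 1\<close> and \<open>z ^ (h + 1) \<longlonglongrightarrow> 1\<close>, so it is \<open>1\<close>.  On the other hand, if \<open>k / a\<close>
  is summable, almost every point is eventually in the towers \<open>A\<close> only, and a number \<open>z\<close> with
  \<open>\<Sum> (a + k) \<bar>z ^ h - 1\<bar> < \<infinity>\<close> is a measurable eigenvalue, with eigenfunction the limit of \<open>z\<close> to the power of
  the position in the tower.  The heights satisfy \<open>h\<^sub>n\<^sub>+\<^sub>1 = (a\<^sub>n + k\<^sub>n) h\<^sub>n + k\<^sub>n\<close>; choosing \<open>k\<^sub>n\<close> as a multiple of
  \<open>h\<^sub>n\<^sub>-\<^sub>1\<close> makes them denominators of a generalised continued fraction with an irrational limit \<open>\<beta>\<close>, and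
  suitable divisibility makes the summability hold for \<open>z = exp (2 \<pi> i r \<beta>)\<close> with every rational \<open>r\<close>.\<close>

section \<open>A continued fraction with highly divisible numerators\<close>

text \<open>Write p_n for the numerators \<open>cf_num n\<close>. The convergents satisfy |h_n
  \<beta> - p_n| <= 2 n! (n+1)! / h_{n+1}. The factor a_n + k_n of the summability condition is at
  most h_{n+1} / h_n, so the product is at most 2 n! (n+1)! / h_n, and the factor 2^(n+1) ((n+2)!)^2
  of \<open>cf_quot\<close> makes this summable. For r = u / w the approximation survives
  multiplication by r only where r p_n is an integer; this is why n! has to divide p_n, which
  settles all n >= w at once. Irrationality of \<beta> makes the map from r to exp (2 pi i r
  \<beta>) injective. Both towers of a level consist of the same number a + k of subtowers. Hence
  the summed base masses of the two towers shrink by a factor independent of the measure, which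
  leads to uniqueness, and the edge numbers of a random path can be independent uniform digits,
  which leads to existence. The root is exceptional: there the two towers have one and two edges,
  which costs a conditioning on an event of probability at least 1/2.\<close>

lemma limit_of_contracting_steps:
  fixes x d :: "nat \<Rightarrow> real"
  assumes step: "\<And>n. \<bar>x (Suc n) - x n\<bar> = d n"
    and pos: "\<And>n. d n > 0"
    and contr: "\<And>n. 4 * d (Suc n) < d n"
  shows "\<exists>b. \<forall>n. b \<noteq> x n \<and> \<bar>b - x n\<bar> \<le> 2 * d n"
proof -
  have dec: "d (n + m) \<le> d n / 2 ^ m" for n m
  proof (induction m)
    case (Suc m)
    have "d (n + Suc m) \<le> d (n + m) / 2" using contr[of "n+m"] pos[of "Suc (n+m)"] by simp
    also have "\<dots> \<le> d n / 2 ^ m / 2" using Suc by simp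
    finally show ?case by (simp add: field_simps)
  qed simp
  \<comment> \<open>The subtracted term carries the induction: a further step adds d (n + m), and d
    (n + m) - 2 * d (n + m) <= - 2 * d (Suc (n + m)) by contraction.\<close>
  have bound: "\<bar>x (n + m) - x n\<bar> \<le> 2 * d n - 2 * d (n + m)" for n m
  proof (induction m)
    case (Suc m)
    have "\<bar>x (n + Suc m) - x n\<bar> \<le> \<bar>x (Suc (n + m)) - x (n+m)\<bar> + \<bar>x (n + m) - x n\<bar>"
      by simp
    also have "\<dots> \<le> d (n + m) + (2 * d n - 2 * d (n + m))" using Suc step[of "n+m"] by simp
    also have "\<dots> \<le> 2 * d n - 2 * d (n + Suc m)" using contr[of "n+m"] pos[of "Suc (n+m)"] by simp
    finally show ?case .
  qed simp
  have d0: "d \<longlonglongrightarrow> 0"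
  proof (rule tendsto_sandwich[OF _ _ tendsto_const])
    show "\<forall>\<^sub>F n in sequentially. 0 \<le> d n" using pos by (simp add: less_imp_le)
    show "\<forall>\<^sub>F n in sequentially. d n \<le> d 0 * (1/2) ^ n"
      using dec[of 0] by (simp add: power_divide)
    show "(\<lambda>n. d 0 * (1/2) ^ n) \<longlonglongrightarrow> 0"
      by (intro tendsto_mult_right_zero LIMSEQ_realpow_zero) auto
  qed
  have "Cauchy x"
  proof (rule metric_CauchyI)
    fix e :: real assume "e > 0"
    then obtain N where N: "\<bar>d N\<bar> < e / 4"
      using LIMSEQ_D[OF d0, of "e / 4"] by auto
    have "dist (x m) (x N) < e / 2" if "m \<ge> N" for m
    proof -
      from le_Suc_ex[OF that] obtain j where "m = N + j" by blast
      then show ?thesis using bound[of N j] N pos[of "N+j"] pos[of N] by (simp add: dist_real_def)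
    qed
    then show "\<exists>M. \<forall>m\<ge>M. \<forall>n\<ge>M. dist (x m) (x n) < e"
      by (meson dist_triangle_half_r dist_commute dist_triangle_half_l)
  qed
  then obtain b where b: "x \<longlonglongrightarrow> b" by (meson Cauchy_convergent convergent_def)
  have le: "\<bar>b - x n\<bar> \<le> 2 * d n" for n
  proof -
    have "(\<lambda>m. \<bar>x (m + n) - x n\<bar>) \<longlonglongrightarrow> \<bar>b - x n\<bar>"
      by (intro tendsto_intros LIMSEQ_ignore_initial_segment b)
    moreover have "\<bar>x (m + n) - x n\<bar> \<le> 2 * d n" for m
      using bound[of n m] pos[of "n+m"] by (simp add: add.commute)
    ultimately show ?thesis by (meson LIMSEQ_le_const2)
  qed
  \<comment> \<open>All steps after n + 1 together move by at most 2 * d (Suc n) < d n, so they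
    cannot undo step n. This is what later makes the errors of the convergents nonzero.\<close>
  have "b \<noteq> x n" for n
    using le[of "Suc n"] step[of n] contr[of n] pos[of "Suc n"] by auto
  with le show ?thesis by blast
qed

text \<open>Denominators and numerators of the convergents of a continued fraction whose numerators
  \<open>(n + 1) (n + 2)\<close> force \<open>fact n\<close> to divide the \<open>n\<close>-th numerator, so that all rational
  multiples of the limit are well approximated with the same denominators.\<close>

fun cf_den :: "nat \<Rightarrow> nat" where
  "cf_den 0 = 1"
| "cf_den (Suc 0) = 1"
| "cf_den (Suc (Suc n)) = 2 ^ (n+2) * (fact (n+3))\<^sup>2 * cf_den n * cf_den (Suc n) + (n+1) * (n+2) * cf_den n"

text \<open>The partial denominators, unfolded in the recursion of \<open>cf_den\<close> because
  they contain denominators themselves. The factor \<open>cf_den (n - 1)\<close> dominates the later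
  parameter k, the power of 2 gives summability, and the squared factorial absorbs the factorials of
  \<open>cf_det\<close> and makes the divisibility of the numerators inductive.\<close>

definition cf_quot :: "nat \<Rightarrow> nat" where
  "cf_quot n = 2 ^ (n+1) * (fact (n+2))\<^sup>2 * cf_den (n - 1)"

fun cf_num :: "nat \<Rightarrow> nat" where
  "cf_num 0 = 0"
| "cf_num (Suc 0) = 1"
| "cf_num (Suc (Suc n)) = cf_quot (Suc n) * cf_num (Suc n) + (n+1) * (n+2) * cf_num n"

lemma cf_den_Suc_Suc: "cf_den (Suc (Suc n)) = cf_quot (Suc n) * cf_den (Suc n) + (n+1) * (n+2) * cf_den n"
proof -
  have *: "Suc n + 1 = n + 2" "Suc n + 2 = n + 3" "Suc n - 1 = n" by simp_all
  show ?thesis unfolding cf_quot_def * cf_den.simps(3) by (simp only: ac_simps)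
qed

lemma cf_den_pos: "cf_den n > 0"
  by (induction n rule: cf_den.induct) auto

declare cf_den.simps(3) [simp del] cf_num.simps(3) [simp del]

text \<open>In the recursion (n+1) (n+2) raises n! to (n+2)!, and the partial denominator, being
  divisible by n+2, raises (n+1)! to (n+2)!.\<close>

lemma fact_dvd_cf_num: "fact n dvd cf_num n"
proof (induction n rule: cf_num.induct)
  case (3 n)
  have "fact (n+2) = (n+2) * fact (Suc n)" by simp
  moreover have "(n+2) dvd cf_quot (Suc n)"
  proof -
    have "(n+2) dvd (fact (Suc n + 2) :: nat)" by (rule dvd_fact) auto
    then have "(n+2) dvd (fact (Suc n + 2) :: nat)\<^sup>2" by (metis dvd_mult power2_eq_square)
    then show ?thesis unfolding cf_quot_def by (rule dvd_mult2[OF dvd_mult])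
  qed
  ultimately have 1: "fact (n+2) dvd cf_quot (Suc n) * cf_num (Suc n)"
    using 3(1) by (metis mult_dvd_mono)
  have "fact (n+2) = (n+1) * (n+2) * (fact n :: nat)" by (simp add: algebra_simps)
  then have "fact (n+2) dvd (n+1) * (n+2) * cf_num n" using 3(2) by (metis dvd_refl mult_dvd_mono)
  with 1 have "fact (n+2) dvd cf_num (Suc (Suc n))" unfolding cf_num.simps by (rule dvd_add)
  then show ?case by (metis add_2_eq_Suc')
qed auto

text \<open>Each step of the recursion multiplies the determinant by minus the partial numerator
  (n+1) (n+2); the product of these is n! (n+1)!.\<close>

lemma cf_det:
  "int (cf_num (Suc n)) * cf_den n - int (cf_num n) * cf_den (Suc n) = (- 1) ^ n * fact n * fact (Suc n)"
proof (induction n)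
  case (Suc n)
  have "int (cf_num (Suc (Suc n))) * cf_den (Suc n) - int (cf_num (Suc n)) * cf_den (Suc (Suc n))
    = - int ((n+1) * (n+2)) * (int (cf_num (Suc n)) * cf_den n - int (cf_num n) * cf_den (Suc n))"
    unfolding cf_num.simps cf_den_Suc_Suc by (simp add: algebra_simps)
  also have "\<dots> = (- 1) ^ Suc n * fact (Suc n) * fact (Suc (Suc n))"
    unfolding Suc by (simp add: algebra_simps)
  finally show ?case .
qed simp

lemma cf_quot_lower:
  "2 ^ (n+1) * (n+1) * (n+2) * cf_den (n - 1) \<le> cf_quot n"
  "2 ^ (n+1) * (fact (n+2))\<^sup>2 \<le> cf_quot n"
proof -
  have "(n+1) * (n+2) * 1 \<le> (n+1) * (n+2) * (fact n :: nat)" by (intro mult_le_mono2 fact_ge_1)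
  then have "(n+1) * (n+2) \<le> (fact (n+2) :: nat)" by (simp add: algebra_simps)
  also have "\<dots> \<le> (fact (n+2))\<^sup>2" by (simp add: power2_eq_square del: fact_Suc)
  finally have "(n+1) * (n+2) \<le> (fact (n+2))\<^sup>2" .
  then have "2 ^ (n+1) * ((n+1) * (n+2)) * cf_den (n - 1) \<le> 2 ^ (n+1) * (fact (n+2))\<^sup>2 * cf_den (n - 1)"
    by (intro mult_le_mono le_refl)
  then show "2 ^ (n+1) * (n+1) * (n+2) * cf_den (n - 1) \<le> cf_quot n"
    unfolding cf_quot_def by (simp only: mult.assoc)
  show "2 ^ (n+1) * (fact (n+2))\<^sup>2 \<le> cf_quot n"
    unfolding cf_quot_def using cf_den_pos[of "n-1"] by (simp del: fact_Suc)
qed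

text \<open>This is the contraction hypothesis of \<open>limit_of_contracting_steps\<close> for the
  distances n! (n+1)! / (q_n q_{n+1}) of consecutive convergents with q_n =
  \<open>cf_den n\<close>.\<close>

lemma cf_den_ratio: "4 * (n+1) * (n+2) * cf_den n < cf_den (Suc (Suc n))"
proof -
  have "(2::nat) ^ 2 \<le> 2 ^ (n+2)" by (rule power_increasing) auto
  then have "4 * ((n+2) * (n+3)) \<le> 2 ^ (n+2) * ((n+2) * (n+3))" by (intro mult_le_mono1) simp
  moreover have "4 * (n+1) * (n+2) < 4 * ((n+2) * (n+3))" by (simp add: algebra_simps)
  ultimately have "4 * (n+1) * (n+2) < 2 ^ (n+2) * ((n+2) * (n+3)) + (n+1) * (n+2)" by linarith
  then have "4 * (n+1) * (n+2) * cf_den n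
      < (2 ^ (n+2) * ((n+2) * (n+3)) + (n+1) * (n+2)) * cf_den n"
    using cf_den_pos[of n] by (rule mult_less_mono1)
  also have "\<dots> \<le> cf_quot (Suc n) + (n+1) * (n+2) * cf_den n"
    using cf_quot_lower(1)[of "Suc n"] by (simp add: algebra_simps)
  also have "\<dots> \<le> cf_den (Suc (Suc n))"
    unfolding cf_den_Suc_Suc using cf_den_pos[of "Suc n"] by simp
  finally show ?thesis .
qed

lemma norm_cis_minus_one_le: "cmod (cis (2 * pi * t) - 1) \<le> 2 * pi * \<bar>t - of_int m\<bar>"
proof -
  have "cis (2 * pi * t) = cis (2 * pi * (t - of_int m))"
  proof -
    have "cis (2 * pi * (t - of_int m)) = cis (2 * pi * t) / cis (2 * pi * of_int m)"
      by (simp add: cis_divide algebra_simps)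
    then show ?thesis by (simp add: cis_multiple_2pi)
  qed
  also have "cmod (cis (2 * pi * (t - of_int m)) - 1) = 2 * \<bar>sin (2 * pi * (t - of_int m) / 2)\<bar>"
    unfolding cis_conv_exp by (rule dist_exp_i_1)
  also have "\<dots> \<le> 2 * pi * \<bar>t - of_int m\<bar>"
    using abs_sin_x_le_abs_x[of "2 * pi * (t - of_int m) / 2"] by (simp add: abs_mult)
  finally show ?thesis .
qed

lemma cf_limit:
  obtains \<beta> where "\<beta> \<notin> \<rat>"
    "\<And>r. r \<in> \<rat> \<Longrightarrow> summable (\<lambda>n. real (cf_quot n) * cmod (cis (2 * pi * (r * \<beta>)) ^ cf_den n - 1))"
proof -
  define x where "x n = real (cf_num n) / cf_den n" for n
  define d where "d n = fact n * fact (Suc n) / (real (cf_den n) * cf_den (Suc n))" for n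
  have dpos: "cf_den n > 0" "real (cf_den n) > 0" for n using cf_den_pos by auto
  have "\<exists>b. \<forall>n. b \<noteq> x n \<and> \<bar>b - x n\<bar> \<le> 2 * d n"
  proof (rule limit_of_contracting_steps)
    fix n
    show "d n > 0" unfolding d_def using dpos by simp
    have "x (Suc n) - x n = (real (cf_num (Suc n)) * cf_den n - real (cf_num n) * cf_den (Suc n))
        / (real (cf_den n) * cf_den (Suc n))"
      unfolding x_def using dpos[of n] dpos[of "Suc n"] by (simp add: field_simps)
    also have "real (cf_num (Suc n)) * cf_den n - real (cf_num n) * cf_den (Suc n)
        = (- 1) ^ n * fact n * fact (Suc n)"
      using arg_cong[OF cf_det[of n], of real_of_int] by (simp del: fact_Suc)
    finally show "\<bar>x (Suc n) - x n\<bar> = d n"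
      unfolding d_def by (simp add: abs_mult power_abs del: fact_Suc)
    have "4 * d (Suc n) = (4 * (n+1) * (n+2) * cf_den n) * (fact n * fact (Suc n))
       / (real (cf_den n) * cf_den (Suc n) * cf_den (Suc (Suc n)))"
      unfolding d_def fact_Suc[of "Suc n"] fact_Suc[of n] using dpos[of n] dpos[of "Suc n"] dpos[of "Suc (Suc n)"]
      by (simp add: divide_simps) (simp add: algebra_simps)
    also have "\<dots> < cf_den (Suc (Suc n)) * (fact n * fact (Suc n))
       / (real (cf_den n) * cf_den (Suc n) * cf_den (Suc (Suc n)))"
      using cf_den_ratio[of n] dpos[of n] dpos[of "Suc n"] dpos[of "Suc (Suc n)"]
      by (intro divide_strict_right_mono mult_strict_right_mono mult_pos_pos)
         (simp_all del: cf_den.simps fact_Suc of_nat_mult of_nat_add add: of_nat_less_iff)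
    also have "\<dots> = d n" unfolding d_def using dpos[of "Suc (Suc n)"] by (simp del: cf_den.simps fact_Suc)
    finally show "4 * d (Suc n) < d n" .
  qed
  then obtain \<beta> where \<beta>: "\<And>n. \<beta> \<noteq> x n" "\<And>n. \<bar>\<beta> - x n\<bar> \<le> 2 * d n" by auto
  have err: "\<bar>\<beta> * cf_den n - cf_num n\<bar> \<le> 2 * (fact n * fact (Suc n)) / cf_den (Suc n)" for n
  proof -
    have "\<bar>\<beta> * cf_den n - cf_num n\<bar> = \<bar>\<beta> - x n\<bar> * cf_den n"
      unfolding x_def using dpos[of n] by (simp add: abs_mult_pos field_simps flip: abs_mult_pos)
    also have "\<dots> \<le> 2 * d n * cf_den n" using \<beta>(2) by (simp add: mult_right_mono)
    finally show ?thesis unfolding d_def using dpos[of n] by (simp del: fact_Suc)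
  qed
  \<comment> \<open>With n >= 2 the recursion applies to both denominators: it gives
    \<open>cf_quot n / cf_den (Suc n) <= 1 / cf_den n\<close>, and \<open>cf_den n\<close> is large
    enough to beat the factorials of \<open>err\<close>.\<close>
  have small: "cf_quot n * \<bar>\<beta> * cf_den n - cf_num n\<bar> \<le> 2 * (1/2) ^ n" if n: "n \<ge> 2" for n
  proof -
    obtain m where m: "n = Suc (Suc m)" using n by (metis add_2_eq_Suc le_Suc_ex)
    have "real (cf_quot n * cf_den n) \<le> cf_den (Suc n)"
      unfolding m cf_den_Suc_Suc of_nat_le_iff by simp
    then have q: "cf_quot n / cf_den (Suc n) \<le> 1 / real (cf_den n)"
      using dpos[of "Suc n"] dpos[of n] by (simp add: field_simps)
    have "2 ^ n * (fact (Suc n))\<^sup>2 \<le> cf_quot (Suc m)" using cf_quot_lower(2)[of "Suc m"] m by simp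
    also have "\<dots> \<le> cf_quot (Suc m) * cf_den (Suc m)" using dpos[of "Suc m"] by simp
    also have "\<dots> \<le> cf_den n" unfolding m cf_den_Suc_Suc by simp
    finally have "2 ^ n * (fact (Suc n))\<^sup>2 \<le> cf_den n" .
    moreover have "fact n * fact (Suc n) \<le> ((fact (Suc n))\<^sup>2 :: nat)"
      unfolding power2_eq_square by (rule mult_le_mono) (auto simp: fact_mono)
    ultimately have "2 ^ n * (fact n * fact (Suc n)) \<le> cf_den n"
      by (meson le_trans mult_le_mono2)
    then have "real (2 ^ n * (fact n * fact (Suc n))) \<le> cf_den n" by (rule of_nat_mono)
    then have f: "fact n * fact (Suc n) / real (cf_den n) \<le> (1/2) ^ n"
      using dpos[of n] by (simp add: field_simps power_divide del: fact_Suc)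
    have "cf_quot n * \<bar>\<beta> * cf_den n - cf_num n\<bar> \<le> cf_quot n * (2 * (fact n * fact (Suc n)) / cf_den (Suc n))"
      by (intro mult_left_mono err) simp
    also have "\<dots> = 2 * (fact n * fact (Suc n)) * (cf_quot n / cf_den (Suc n))" by (simp only: times_divide_eq_right ac_simps)
    also have "\<dots> \<le> 2 * (fact n * fact (Suc n)) * (1 / real (cf_den n))"
      by (rule mult_left_mono[OF q]) (simp del: fact_Suc)
    also have "\<dots> = 2 * (fact n * fact (Suc n) / real (cf_den n))" by (simp only: times_divide_eq_right mult_1_right ac_simps)
    also have "\<dots> \<le> 2 * (1/2) ^ n" by (rule mult_left_mono[OF f]) simp
    finally show ?thesis .
  qed
  have quot: "cf_quot n \<ge> 1" for n
    unfolding cf_quot_def using cf_den_pos[of "n-1"] by (simp add: Suc_le_eq del: fact_Suc)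
  \<comment> \<open>If \<beta> = u / w, the errors \<beta> * \<open>cf_den n\<close> -
    \<open>cf_num n\<close> would be nonzero multiples of 1 / w, whereas \<open>small\<close> forces
    them to 0.\<close>
  have irr: "\<beta> \<notin> \<rat>"
  proof
    assume "\<beta> \<in> \<rat>"
    then obtain u w :: int where uw: "w > 0" "\<beta> = of_int u / of_int w"
      by (elim Rats_cases') blast
    have low: "1 / real_of_int w \<le> \<bar>\<beta> * cf_den n - cf_num n\<bar>" for n
    proof -
      have eq: "\<beta> * cf_den n - cf_num n = of_int (u * int (cf_den n) - int (cf_num n) * w) / of_int w"
        using uw by (simp add: field_simps)
      have "\<beta> * cf_den n - cf_num n \<noteq> 0" using \<beta>(1)[of n] dpos[of n] unfolding x_def by (simp add: field_simps)
      then have "u * int (cf_den n) - int (cf_num n) * w \<noteq> 0" using eq by (metis div_0 of_int_0)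
      then have "1 \<le> \<bar>u * int (cf_den n) - int (cf_num n) * w\<bar>" by simp
      then have "1 \<le> \<bar>real_of_int (u * int (cf_den n) - int (cf_num n) * w)\<bar>" by (metis of_int_1_le_iff of_int_abs)
      then show ?thesis unfolding eq abs_divide using uw(1) by (simp add: divide_right_mono)
    qed
    have "1 / real_of_int w \<le> 2 * (1/2) ^ n" if "n \<ge> 2" for n
      using small[OF that] low[of n] quot[of n]
        mult_right_mono[of 1 "real (cf_quot n)" "\<bar>\<beta> * cf_den n - cf_num n\<bar>"] by simp
    then have ex: "\<exists>N. \<forall>n\<ge>N. 1 / real_of_int w \<le> 2 * (1/2) ^ n" by blast
    have "(\<lambda>n. 2 * (1/2::real) ^ n) \<longlonglongrightarrow> 0"
      by (intro tendsto_mult_right_zero LIMSEQ_realpow_zero) auto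
    from LIMSEQ_le_const[OF this ex] have "1 / real_of_int w \<le> 0" .
    then show False using uw(1) by (simp add: field_simps)
  qed
  have "summable (\<lambda>n. real (cf_quot n) * cmod (cis (2 * pi * (r * \<beta>)) ^ cf_den n - 1))" if "r \<in> \<rat>" for r
  proof -
    from that obtain u w :: int where uw: "w > 0" "r = of_int u / of_int w"
      by (elim Rats_cases') blast
    \<comment> \<open>From n >= w on, w divides n! and thus \<open>cf_num n\<close>, so r *
      \<open>cf_num n\<close> is an integer to compare the angle with.\<close>
    have "norm (real (cf_quot n) * cmod (cis (2 * pi * (r * \<beta>)) ^ cf_den n - 1)) \<le> 4 * pi * \<bar>r\<bar> * (1/2) ^ n"
      if n: "n \<ge> max 2 (nat w)" for n
    proof -
      have "nat w dvd fact n" using n uw(1) by (intro dvd_fact) linarith+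
      then have "nat w dvd cf_num n" using fact_dvd_cf_num dvd_trans by blast
      then obtain c where "cf_num n = nat w * c" by blast
      then have "real (cf_num n) = of_int w * of_int (int c)" using uw(1) by simp
      then have c: "r * cf_num n = of_int (u * int c)" using uw(1) unfolding uw(2) by (simp only: of_int_mult) simp
      have "cis (2 * pi * (r * \<beta>)) ^ cf_den n = cis (2 * pi * (r * \<beta> * cf_den n))"
        unfolding Complex.DeMoivre by (rule arg_cong[of _ _ cis]) (simp only: ac_simps)
      then have "cmod (cis (2 * pi * (r * \<beta>)) ^ cf_den n - 1) \<le> 2 * pi * \<bar>r * \<beta> * cf_den n - r * cf_num n\<bar>"
        unfolding c by (simp only: norm_cis_minus_one_le)
      also have "\<dots> = 2 * pi * \<bar>r\<bar> * \<bar>\<beta> * cf_den n - cf_num n\<bar>"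
        by (simp only: right_diff_distrib[symmetric] mult.assoc abs_mult)
      finally have "real (cf_quot n) * cmod (cis (2 * pi * (r * \<beta>)) ^ cf_den n - 1)
         \<le> real (cf_quot n) * (2 * pi * \<bar>r\<bar> * \<bar>\<beta> * cf_den n - cf_num n\<bar>)"
        by (rule mult_left_mono) simp
      also have "\<dots> = 2 * pi * \<bar>r\<bar> * (real (cf_quot n) * \<bar>\<beta> * cf_den n - cf_num n\<bar>)" by simp
      also have "\<dots> \<le> 2 * pi * \<bar>r\<bar> * (2 * (1/2) ^ n)"
        using small[of n] n by (intro mult_left_mono) auto
      finally show ?thesis by simp
    qed
    then have "\<exists>N. \<forall>n\<ge>N. norm (real (cf_quot n) * cmod (cis (2 * pi * (r * \<beta>)) ^ cf_den n - 1))
        \<le> 4 * pi * \<bar>r\<bar> * (1/2) ^ n" by blast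
    moreover have "summable (\<lambda>n. 4 * pi * \<bar>r\<bar> * (1/2) ^ n)"
      by (intro summable_mult summable_geometric) simp
    ultimately show ?thesis by (rule summable_comparison_test)
  qed
  with irr show thesis by (rule that)
qed

section \<open>A diagram with two towers\<close>

text \<open>An edge is coded by its level, its rank among the edges with the same range, and the
  tower it enters; its source is computed from these. Numbers are used because
  \<open>finite_topological_rank\<close> asks for a diagram over \<open>nat\<close>.\<close>

definition enc_edge :: "nat \<Rightarrow> nat \<Rightarrow> nat \<Rightarrow> nat" where
  "enc_edge n i b = prod_encode (n, prod_encode (i, b))"

definition lev :: "nat \<Rightarrow> nat" where "lev e = fst (prod_decode e)"
definition idx :: "nat \<Rightarrow> nat" where "idx e = fst (prod_decode (snd (prod_decode e)))"
definition ebit :: "nat \<Rightarrow> nat" where "ebit e = snd (prod_decode (snd (prod_decode e)))"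

lemma enc_edge_sel [simp]:
  "lev (enc_edge n i b) = n" "idx (enc_edge n i b) = i" "ebit (enc_edge n i b) = b"
  by (simp_all add: enc_edge_def lev_def idx_def ebit_def)

lemma enc_edge_collapse [simp]: "enc_edge (lev e) (idx e) (ebit e) = e"
  by (simp add: enc_edge_def lev_def idx_def ebit_def)

lemma edge_eqI: "lev e = lev f \<Longrightarrow> idx e = idx f \<Longrightarrow> ebit e = ebit f \<Longrightarrow> e = f"
  by (metis enc_edge_collapse)

text \<open>The height of tower A. At level 1 the towers have one and two edges from the root, hence
  heights 1 and 2, and the recursion only starts above.\<close>

fun tower_height :: "(nat \<Rightarrow> nat) \<Rightarrow> (nat \<Rightarrow> nat) \<Rightarrow> nat \<Rightarrow> nat" where
  "tower_height a k 0 = 1"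
| "tower_height a k (Suc 0) = 1"
| "tower_height a k (Suc (Suc n)) = (a (Suc n) + k (Suc n)) * tower_height a k (Suc n) + k (Suc n)"

text \<open>Bits \<open>0\<close> and \<open>1\<close> stand for the towers \<open>A\<close> and \<open>B\<close>.  Level \<open>0\<close> has the vertex \<open>0\<close> only; the value
  \<open>a 0 = 3\<close> exceeds all indices of edges there, so that the formulas \<open>src_bit\<close> for the source of the
  \<open>i\<close>-th edge into tower \<open>b\<close> and \<open>off\<close> for the total height of the edges before it hold at level \<open>0\<close>, too.
  \<open>V n x\<close> is the tower of level \<open>n\<close> containing \<open>x\<close>, and \<open>P n x\<close> is the position of \<open>x\<close> in it.\<close>

locale two_towers =
  fixes a k :: "nat \<Rightarrow> nat"
  assumes a_0: "a 0 = 3"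
    and a_ge: "n \<ge> 1 \<Longrightarrow> 2 \<le> a n"
    and k_ge: "n \<ge> 1 \<Longrightarrow> 2 \<le> k n"
begin

abbreviation h :: "nat \<Rightarrow> nat" where "h \<equiv> tower_height a k"

text \<open>The number of edges into tower \<open>b\<close> of level \<open>n + 1\<close>,
  independent of \<open>b\<close> except at the root.\<close>

definition Q :: "nat \<Rightarrow> nat \<Rightarrow> nat" where
  "Q n b = (if n = 0 then 1 + b else a n + k n)"

definition src_bit :: "nat \<Rightarrow> nat \<Rightarrow> nat \<Rightarrow> nat" where
  "src_bit n i b = (if a n \<le> i + b then 1 else 0)"

definition off :: "nat \<Rightarrow> nat \<Rightarrow> nat \<Rightarrow> nat" where
  "off n i b = i * h n + (i + b - a n)"

definition E :: "nat \<Rightarrow> nat set" where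
  "E n = {e. lev e = n \<and> ebit e \<le> 1 \<and> idx e < Q n (ebit e)}"

definition B :: "(nat, nat) bratteli" where
  "B = \<lparr>verts = (\<lambda>n. if n = 0 then {0} else {2 * n, 2 * n + 1}),
        edges = E,
        src = (\<lambda>e. 2 * lev e + src_bit (lev e) (idx e) (ebit e)),
        rng = (\<lambda>e. 2 * Suc (lev e) + ebit e),
        edge_le = {(e, f). e \<in> (\<Union>n. E n) \<and> f \<in> (\<Union>n. E n) \<and>
                    lev e = lev f \<and> ebit e = ebit f \<and> idx e \<le> idx f}\<rparr>"

abbreviation X :: "(nat \<Rightarrow> nat) set" where "X \<equiv> paths B"

definition V :: "nat \<Rightarrow> (nat \<Rightarrow> nat) \<Rightarrow> nat" where
  "V n x = src_bit n (idx (x n)) (ebit (x n))"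

definition P :: "nat \<Rightarrow> (nat \<Rightarrow> nat) \<Rightarrow> nat" where
  "P n x = (\<Sum>i<n. off i (idx (x i)) (ebit (x i)))"

lemma a_ge_2: "2 \<le> a n"
  using a_0 a_ge[of n] by (cases "n = 0") auto

lemma Q_pos: "0 < Q n b" 
  using a_ge_2[of n] by (simp add: Q_def)

lemma enc_in_E [simp]: "enc_edge m i b \<in> E n \<longleftrightarrow> m = n \<and> b \<le> 1 \<and> i < Q n b"
  by (auto simp: E_def)

lemma E_D: "e \<in> E n \<Longrightarrow> lev e = n" "e \<in> E n \<Longrightarrow> ebit e \<le> 1" "e \<in> E n \<Longrightarrow> idx e < Q n (ebit e)"
  by (auto simp: E_def)

lemma src_bit_le: "src_bit n i b \<le> 1"
  by (simp add: src_bit_def)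

lemma V_le: "V n x \<le> 1"
  unfolding V_def by (rule src_bit_le)

lemma src_bit_0: "b \<le> 1 \<Longrightarrow> src_bit n 0 b = 0"
  using a_ge_2[of n] by (simp add: src_bit_def)

lemma B_sel:
  "edges B = E"
  "src B e = 2 * lev e + src_bit (lev e) (idx e) (ebit e)"
  "rng B e = 2 * Suc (lev e) + ebit e"
  by (simp_all add: B_def)

lemma paths_iff: "x \<in> X \<longleftrightarrow> (\<forall>n. x n \<in> E n \<and> ebit (x n) = V (Suc n) x)"
proof -
  have "rng B (x n) = src B (x (Suc n)) \<longleftrightarrow> ebit (x n) = V (Suc n) x" if "\<forall>n. x n \<in> E n" for n
    using that E_D(1)[of "x n" n] E_D(1)[of "x (Suc n)" "Suc n"] by (simp add: B_sel V_def)
  then show ?thesis unfolding paths_def B_sel(1) mem_Collect_eq by blast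
qed

lemma pathsD: "x \<in> X \<Longrightarrow> x n \<in> E n" "x \<in> X \<Longrightarrow> ebit (x n) = V (Suc n) x"
  unfolding paths_iff by blast+

lemma V_0: "x \<in> X \<Longrightarrow> V 0 x = 0"
  using pathsD(1)[of x 0] a_0 by (auto simp: V_def src_bit_def E_def Q_def)

lemma V_cong: "x n = y n \<Longrightarrow> V n x = V n y"
  by (simp add: V_def)

section \<open>Heights and positions in the towers\<close>

lemma h_pos: "0 < h n"
proof (induction n)
  case (Suc n)
  then show ?case using a_ge_2[of n] by (cases n) auto
qed simp

lemma off_0: "b \<le> 1 \<Longrightarrow> off n 0 b = 0"
  using a_ge_2[of n] by (simp add: off_def)

lemma off_Suc: "off n (Suc i) b = off n i b + h n + src_bit n i b"
  by (auto simp: off_def src_bit_def)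

text \<open>The subtowers add up to the whole tower, and tower B is one higher than tower A. At
  level 0 this rests on the truncated difference with \<open>a 0 = 3\<close>.\<close>

lemma off_Q: "b \<le> 1 \<Longrightarrow> off n (Q n b) b = h (Suc n) + b"
proof (cases n)
  case 0
  assume "b \<le> 1"
  then have "1 + b + b - 3 = 0" by simp
  with 0 a_0 show ?thesis by (simp add: off_def Q_def)
qed (simp add: off_def Q_def)

lemma off_mono: "i \<le> j \<Longrightarrow> off n i b \<le> off n j b"
  by (induction j rule: dec_induct) (auto simp: off_Suc)

lemma P_Suc: "P (Suc n) x = P n x + off n (idx (x n)) (ebit (x n))"
  by (simp add: P_def)

lemma P_0 [simp]: "P 0 x = 0"
  by (simp add: P_def)

lemma P_cong: "(\<And>i. i < n \<Longrightarrow> x i = y i) \<Longrightarrow> P n x = P n y"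
  by (simp add: P_def)

lemma P_mono: "n \<le> m \<Longrightarrow> P n x \<le> P m x"
  by (induction m rule: dec_induct) (auto simp: P_Suc)

lemma P_less: "x \<in> X \<Longrightarrow> P n x < h n + V n x"
proof (induction n)
  case (Suc n)
  have "P (Suc n) x < off n (Suc (idx (x n))) (ebit (x n))"
    using Suc by (simp add: P_Suc off_Suc V_def)
  also have "\<dots> \<le> off n (Q n (ebit (x n))) (ebit (x n))"
    using E_D(3)[OF pathsD(1)[OF Suc.prems]] by (intro off_mono) (simp add: Suc_le_eq)
  also have "\<dots> = h (Suc n) + V (Suc n) x"
    using off_Q E_D(2)[OF pathsD(1)[OF Suc.prems]] pathsD(2)[OF Suc.prems] by simp
  finally show ?case .
qed simp

text \<open>A position is a mixed radix numeral: the contribution of the levels below n stays under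
  the height of the subtower, so it cannot make up for a different edge at level n. Working
  downwards from the common tail, every edge is determined.\<close>

lemma P_inj:
  assumes "x \<in> X" "y \<in> X" "\<And>i. i \<ge> n \<Longrightarrow> x i = y i" "P n x = P n y"
  shows "x = y"
  using assms(3,4)
proof (induction n)
  case (Suc n)
  let ?b = "ebit (x n)"
  have b: "ebit (y n) = ?b"
    using pathsD(2)[OF assms(1)] pathsD(2)[OF assms(2)] V_cong[of x "Suc n" y] Suc.prems(1)[of "Suc n"] by simp
  have less: "idx (v n) \<le> idx (u n)"
    if uv: "u \<in> X" "v \<in> X" "ebit (u n) = ebit (v n)" "P (Suc n) u = P (Suc n) v" for u v
  proof (rule ccontr)
    assume "\<not> idx (v n) \<le> idx (u n)"
    then have "off n (Suc (idx (u n))) (ebit (u n)) \<le> off n (idx (v n)) (ebit (v n))"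
      using uv(3) by (simp add: off_mono)
    then show False using P_less[OF uv(1), of n] uv(4) by (simp add: P_Suc off_Suc V_def)
  qed
  have "idx (x n) = idx (y n)"
    using less[OF assms(1,2)] less[OF assms(2,1)] b Suc.prems(2) by (simp add: le_antisym)
  then have xy: "x n = y n"
    using b E_D(1)[OF pathsD(1)[OF assms(1), of n]] E_D(1)[OF pathsD(1)[OF assms(2), of n]]
    by (metis edge_eqI)
  show ?case
  proof (rule Suc.IH)
    show "x i = y i" if "i \<ge> n" for i using that xy Suc.prems(1) by (cases "i = n") auto
    show "P n x = P n y" using Suc.prems(2) xy by (simp add: P_Suc)
  qed
qed auto

definition path_from :: "nat \<Rightarrow> (nat \<Rightarrow> nat) \<Rightarrow> bool" where
  "path_from n y \<longleftrightarrow> (\<forall>m\<ge>n. y m \<in> E m \<and> ebit (y m) = V (Suc m) y)"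

text \<open>Completes a path given from level n on by minimal edges. As all minimal edges start in
  tower A, only the edge directly below level n has to remember which tower it enters.\<close>

definition descend :: "nat \<Rightarrow> (nat \<Rightarrow> nat) \<Rightarrow> nat \<Rightarrow> nat" where
  "descend n y = (\<lambda>m. if m < n then enc_edge m 0 (if Suc m = n then V n y else 0) else y m)"

lemma path_from_path: "x \<in> X \<Longrightarrow> path_from n x"
  by (simp add: path_from_def paths_iff)

lemma path_from_update:
  assumes "path_from (Suc n) y" "i < Q n (V (Suc n) y)"
  shows "path_from n (y(n := enc_edge n i (V (Suc n) y)))"
  unfolding path_from_def
proof (intro allI impI)
  fix m assume m: "m \<ge> n"
  let ?z = "y(n := enc_edge n i (V (Suc n) y))"
  have "V (Suc m) ?z = V (Suc m) y" using m by (intro V_cong) simp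
  moreover have "y m \<in> E m \<and> ebit (y m) = V (Suc m) y" if "m \<noteq> n"
    using that m assms(1) unfolding path_from_def by simp
  ultimately show "?z m \<in> E m \<and> ebit (?z m) = V (Suc m) ?z"
    using assms(2) V_le by (cases "m = n") simp_all
qed

lemma descend_ge [simp]: "m \<ge> n \<Longrightarrow> descend n y m = y m"
  by (simp add: descend_def)

lemma descend_path: assumes "path_from n y" shows "descend n y \<in> X"
  unfolding paths_iff
proof
  fix m
  have "V (Suc m) (descend n y) = V (Suc m) y" if "Suc m \<ge> n"
    using that by (intro V_cong) simp
  moreover have "V (Suc m) (descend n y) = 0" if "Suc m < n"
    using that src_bit_0[OF V_le] by (simp add: V_def[of "Suc m"] descend_def src_bit_0)
  ultimately show "descend n y m \<in> E m \<and> ebit (descend n y m) = V (Suc m) (descend n y)"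
    using assms Q_pos V_le[of n y]
    by (cases "m < n"; cases "Suc m = n") (simp_all add: descend_def path_from_def)
qed

lemma P_descend: "P n (descend n y) = 0"
proof -
  have "off i (idx (descend n y i)) (ebit (descend n y i)) = 0" if "i < n" for i
    using that V_le[of n y] by (simp add: descend_def off_0)
  then show ?thesis by (simp add: P_def)
qed

text \<open>Together with \<open>P_inj\<close>, the prefixes below a fixed tail correspond
  bijectively to the floors of the tower. The edges are found greedily from the top.\<close>

lemma P_surj:
  assumes "path_from n y" "j < h n + V n y" "n = 0 \<Longrightarrow> V 0 y = 0"
  shows "\<exists>x\<in>X. (\<forall>i\<ge>n. x i = y i) \<and> P n x = j"
  using assms
proof (induction n arbitrary: y j)
  case 0
  then show ?case by (auto simp: path_from_def paths_iff)
next
  case (Suc n)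
  let ?b = "V (Suc n) y"
  have "j < off n (Q n ?b) ?b" using Suc.prems(2) off_Q V_le by simp
  \<comment> \<open>The edge whose block of floors, from \<open>off n i\<close> up to but excluding
    \<open>off n (Suc i)\<close>, contains j.\<close>
  define i where "i = (LEAST i. j < off n (Suc i) ?b)"
  have ex: "j < off n (Suc (Q n ?b - 1)) ?b" using \<open>j < off n (Q n ?b) ?b\<close> Q_pos[of n ?b] by simp
  have i: "j < off n (Suc i) ?b" unfolding i_def using ex by (rule LeastI)
  have "i \<le> Q n ?b - 1" unfolding i_def using ex by (rule Least_le)
  then have iQ: "i < Q n ?b" using Q_pos[of n ?b] by linarith
  have le: "off n i ?b \<le> j"
  proof (cases i)
    case 0
    then show ?thesis using off_0 V_le by simp
  next
    case (Suc l)
    then have "\<not> j < off n (Suc l) ?b" unfolding i_def by (metis not_less_Least lessI)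
    then show ?thesis using Suc by simp
  qed
  let ?y = "y(n := enc_edge n i ?b)"
  have Vy: "V n ?y = src_bit n i ?b" by (simp add: V_def)
  have "\<exists>x\<in>X. (\<forall>m\<ge>n. x m = ?y m) \<and> P n x = j - off n i ?b"
  proof (rule Suc.IH)
    show "path_from n ?y" using path_from_update Suc.prems(1) iQ .
    show "j - off n i ?b < h n + V n ?y" using i le unfolding Vy off_Suc by simp
    show "n = 0 \<Longrightarrow> V 0 ?y = 0" using iQ V_le[of "Suc n" y] by (simp add: V_def src_bit_def a_0 Q_def)
  qed
  then obtain x where x: "x \<in> X" "\<forall>m\<ge>n. x m = ?y m" "P n x = j - off n i ?b" by blast
  then have "P (Suc n) x = j" using le by (simp add: P_Suc)
  with x show ?case by (intro bexI[of _ x]) auto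
qed

section \<open>The edge order and its extremal paths\<close>

lemma all_edges_B: "all_edges B = (\<Union>n. E n)"
  by (simp add: all_edges_def B_def)

lemma edge_le_B: "(e, f) \<in> edge_le B \<longleftrightarrow>
    e \<in> (\<Union>n. E n) \<and> f \<in> (\<Union>n. E n) \<and> lev e = lev f \<and> ebit e = ebit f \<and> idx e \<le> idx f"
  by (simp add: B_def)

lemma max_edge_iff: "max_edge B e \<longleftrightarrow> (\<exists>n. e \<in> E n \<and> Suc (idx e) = Q n (ebit e))"
proof
  assume m: "max_edge B e"
  then obtain n where e: "e \<in> E n" by (auto simp: max_edge_def all_edges_B)
  have "Suc (idx e) = Q n (ebit e)"
  proof (rule ccontr)
    assume "Suc (idx e) \<noteq> Q n (ebit e)"
    then have f: "enc_edge n (Suc (idx e)) (ebit e) \<in> E n" using E_D[OF e] by simp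
    have "enc_edge n (Suc (idx e)) (ebit e) = e"
      using m e f E_D(1)[OF e] unfolding max_edge_def all_edges_B edge_le_B by fastforce
    then have "idx (enc_edge n (Suc (idx e)) (ebit e)) = idx e" by simp
    then show False by simp
  qed
  with e show "\<exists>n. e \<in> E n \<and> Suc (idx e) = Q n (ebit e)" by blast
next
  assume "\<exists>n. e \<in> E n \<and> Suc (idx e) = Q n (ebit e)"
  then obtain n where n: "e \<in> E n" "Suc (idx e) = Q n (ebit e)" by blast
  show "max_edge B e" unfolding max_edge_def all_edges_B edge_le_B
  proof (intro conjI ballI impI)
    fix f assume "e \<in> \<Union> (range E) \<and> f \<in> \<Union> (range E) \<and> lev e = lev f \<and> ebit e = ebit f \<and> idx e \<le> idx f"
    then obtain m where f: "f \<in> E m" "lev e = lev f" "ebit e = ebit f" "idx e \<le> idx f" by blast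
    then have "idx f < Q n (ebit e)" using E_D(1)[OF n(1)] E_D(1,3)[OF f(1)] by auto
    then have "idx e = idx f" using f(4) n(2) by linarith
    then show "f = e" using f(2,3) by (metis edge_eqI)
  qed (use n in blast)
qed

lemma min_edge_iff: "min_edge B e \<longleftrightarrow> (\<exists>n. e \<in> E n) \<and> idx e = 0"
proof
  assume m: "min_edge B e"
  then obtain n where e: "e \<in> E n" by (auto simp: min_edge_def all_edges_B)
  have f: "enc_edge n 0 (ebit e) \<in> E n" using E_D[OF e] Q_pos by simp
  have "enc_edge n 0 (ebit e) = e"
  proof -
    have "(enc_edge n 0 (ebit e), e) \<in> edge_le B" unfolding edge_le_B
      using e f E_D(1)[OF e] by (metis UN_I UNIV_I enc_edge_sel le0)
    then show ?thesis using m f unfolding min_edge_def all_edges_B by blast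
  qed
  then have "idx (enc_edge n 0 (ebit e)) = idx e" by simp
  with e show "(\<exists>n. e \<in> E n) \<and> idx e = 0" by auto
next
  assume e: "(\<exists>n. e \<in> E n) \<and> idx e = 0"
  then show "min_edge B e" unfolding min_edge_def all_edges_B edge_le_B
    by (metis edge_eqI le_zero_eq UN_I UNIV_I)
qed

lemma edge_le_iff:
  assumes "e \<in> E n"
  shows "(e, f) \<in> edge_le B \<longleftrightarrow> f \<in> E n \<and> ebit e = ebit f \<and> idx e \<le> idx f"
  unfolding edge_le_B using assms E_D(1) by (metis UN_I UNIV_I UN_E)

lemma is_edge_succ_iff:
  assumes e: "e \<in> E n"
  shows "is_edge_succ B e f \<longleftrightarrow> f = enc_edge n (Suc (idx e)) (ebit e) \<and> Suc (idx e) < Q n (ebit e)"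
proof
  let ?g = "enc_edge n (Suc (idx e)) (ebit e)"
  assume s: "is_edge_succ B e f"
  then have "(e, f) \<in> edge_le B" "f \<noteq> e" unfolding is_edge_succ_def by simp_all
  then have f: "f \<in> E n" "ebit e = ebit f" "idx e \<le> idx f" "f \<noteq> e"
    unfolding edge_le_iff[OF e] by simp_all
  have lev: "lev e = n" "lev f = n" using E_D(1) e f(1) by blast+
  then have lt: "idx e < idx f" using f by (metis edge_eqI le_neq_implies_less)
  then have q: "Suc (idx e) < Q n (ebit e)" using E_D(3)[OF f(1)] f(2) by simp
  then have g: "?g \<in> E n" using E_D[OF e] by simp
  have "?g \<noteq> e" by (metis enc_edge_sel(2) n_not_Suc_n)
  moreover have "(e, ?g) \<in> edge_le B" unfolding edge_le_iff[OF e] using g by simp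
  ultimately have "(f, ?g) \<in> edge_le B" using s unfolding is_edge_succ_def by blast
  then have "idx f \<le> Suc (idx e)" unfolding edge_le_iff[OF f(1)] by simp
  with lt have "idx f = Suc (idx e)" by linarith
  then have "f = ?g" using f lev by (metis edge_eqI enc_edge_sel)
  with q show "f = ?g \<and> Suc (idx e) < Q n (ebit e)" by simp
next
  assume f: "f = enc_edge n (Suc (idx e)) (ebit e) \<and> Suc (idx e) < Q n (ebit e)"
  then have fE: "f \<in> E n" "idx f = Suc (idx e)" "ebit f = ebit e" using E_D(2)[OF e] by auto
  have "(f, g) \<in> edge_le B" if g: "(e, g) \<in> edge_le B" "g \<noteq> e" for g
  proof -
    have "g \<in> E n" "ebit e = ebit g" "idx e \<le> idx g" using g(1) unfolding edge_le_iff[OF e] by simp_all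
    moreover have "idx e \<noteq> idx g" using calculation g(2) E_D(1) e by (metis edge_eqI)
    ultimately show ?thesis unfolding edge_le_iff[OF fE(1)] using fE by simp
  qed
  moreover have "(e, f) \<in> edge_le B" "f \<noteq> e" unfolding edge_le_iff[OF e] using fE by auto
  ultimately show "is_edge_succ B e f" unfolding is_edge_succ_def by blast
qed

text \<open>Both words of the substitution begin with A and end with B. Hence minimal edges start in
  tower A and, above the root, maximal edges start in tower B, which forces the tower at every level
  of an extremal path.\<close>

definition x_min :: "nat \<Rightarrow> nat" where "x_min n = enc_edge n 0 0"
definition x_max :: "nat \<Rightarrow> nat" where "x_max n = enc_edge n (Q n 1 - 1) 1"

lemma x_min_path: "x_min \<in> X"
  by (simp add: paths_iff x_min_def V_def src_bit_0 Q_pos)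

lemma x_max_path: "x_max \<in> X"
  unfolding paths_iff
proof
  fix n
  have "src_bit (Suc n) (Q (Suc n) 1 - 1) 1 = 1" using k_ge[of "Suc n"] by (simp add: src_bit_def Q_def)
  then show "x_max n \<in> E n \<and> ebit (x_max n) = V (Suc n) x_max"
    using Q_pos[of n 1] by (simp add: x_max_def V_def)
qed

lemma is_min_path_iff: "is_min_path B x \<longleftrightarrow> x = x_min"
proof
  assume "is_min_path B x"
  then have x: "x \<in> X" "\<And>n. idx (x n) = 0" by (auto simp: is_min_path_def min_edge_iff)
  have "ebit (x n) = 0" for n
    using pathsD(2)[OF x(1), of n] x(2)[of "Suc n"] E_D(2)[OF pathsD(1)[OF x(1), of "Suc n"]]
    by (simp add: V_def src_bit_0)
  then show "x = x_min" using x E_D(1)[OF pathsD(1)[OF x(1)]] by (intro ext) (metis edge_eqI enc_edge_sel x_min_def)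
next
  assume "x = x_min"
  then show "is_min_path B x" using x_min_path Q_pos by (auto simp: is_min_path_def min_edge_iff x_min_def)
qed

lemma is_max_path_iff: "is_max_path B x \<longleftrightarrow> x \<in> X \<and> (\<forall>n. Suc (idx (x n)) = Q n (ebit (x n)))"
  unfolding is_max_path_def max_edge_iff by (metis E_D(1) pathsD(1))

lemma is_max_path_iff': "is_max_path B x \<longleftrightarrow> x = x_max"
proof
  assume "is_max_path B x"
  then have x: "x \<in> X" "\<And>n. Suc (idx (x n)) = Q n (ebit (x n))" by (auto simp: is_max_path_iff)
  have b: "ebit (x n) = 1" for n
    using pathsD(2)[OF x(1), of n] x(2)[of "Suc n"] k_ge[of "Suc n"]
    by (simp add: V_def src_bit_def Q_def)
  have "idx (x n) = Q n 1 - 1" for n using x(2)[of n] b[of n] by simp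
  then show "x = x_max" using b E_D(1)[OF pathsD(1)[OF x(1)]] by (intro ext) (metis edge_eqI enc_edge_sel x_max_def)
next
  assume "x = x_max"
  then show "is_max_path B x" using x_max_path Q_pos by (auto simp: is_max_path_iff x_max_def)
qed

subsection \<open>The Vershik map\<close>

abbreviation T :: "(nat \<Rightarrow> nat) \<Rightarrow> nat \<Rightarrow> nat" where "T \<equiv> vershik_map B"

lemma bratteli_B: "bratteli_diagram B"
proof -
  have "finite (E n)" for n
  proof (rule finite_subset)
    show "E n \<subseteq> (\<lambda>(i, b). enc_edge n i b) ` ({..<Q n 0 + Q n 1} \<times> {..1})"
    proof
      fix e assume e: "e \<in> E n"
      have "ebit e = 0 \<or> ebit e = 1" using E_D(2)[OF e] by linarith
      then have "idx e < Q n 0 + Q n 1" using E_D(3)[OF e] by auto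
      then show "e \<in> (\<lambda>(i, b). enc_edge n i b) ` ({..<Q n 0 + Q n 1} \<times> {..1})"
        using E_D[OF e] by (intro image_eqI[of _ _ "(idx e, ebit e)"]) auto
    qed
  qed simp
  moreover have "\<exists>e\<in>E n. src B e = v" if v: "v \<in> verts B n" for n v
  proof (cases "n = 0")
    case True
    then have "v = 0" using v by (simp add: B_def)
    then show ?thesis using True Q_pos
      by (intro bexI[of _ "enc_edge 0 0 0"]) (simp_all add: B_sel src_bit_0)
  next
    case False
    then have "v = 2 * n \<or> v = 2 * n + 1" using v by (simp add: B_def)
    then show ?thesis
    proof
      assume "v = 2 * n"
      then show ?thesis using Q_pos
        by (intro bexI[of _ "enc_edge n 0 0"]) (simp_all add: B_sel src_bit_0)
    next
      assume "v = 2 * n + 1"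
      then show ?thesis using False k_ge[of n]
        by (intro bexI[of _ "enc_edge n (a n) 0"]) (simp_all add: B_sel src_bit_def Q_def)
    qed
  qed
  moreover have "\<exists>e\<in>E n. rng B e = v" if v: "v \<in> verts B (Suc n)" for n v
  proof -
    have "v = 2 * Suc n \<or> v = 2 * Suc n + 1" using v by (simp add: B_def)
    then show ?thesis
    proof
      assume "v = 2 * Suc n"
      then show ?thesis using Q_pos by (intro bexI[of _ "enc_edge n 0 0"]) (simp_all add: B_sel)
    next
      assume "v = 2 * Suc n + 1"
      then show ?thesis using Q_pos by (intro bexI[of _ "enc_edge n 0 1"]) (simp_all add: B_sel)
    qed
  qed
  moreover have "src B e \<in> verts B n \<and> rng B e \<in> verts B (Suc n)" if e: "e \<in> E n" for n e
  proof -
    have "src_bit n (idx e) (ebit e) = 0" if "n = 0"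
      using E_D[OF e] that by (auto simp: src_bit_def a_0 Q_def)
    moreover have "src_bit n (idx e) (ebit e) = 0 \<or> src_bit n (idx e) (ebit e) = 1"
      by (simp add: src_bit_def)
    moreover have "ebit e = 0 \<or> ebit e = 1" using E_D(2)[OF e] by linarith
    ultimately show ?thesis using E_D(1)[OF e] by (auto simp: B_def)
  qed
  moreover have "verts B m \<inter> verts B n = {}" if "m \<noteq> n" for m n
    using that by (auto simp: B_def)
  moreover have "verts B 0 = {0}" "finite (verts B n)" for n by (auto simp: B_def)
  ultimately show ?thesis unfolding bratteli_diagram_def B_sel(1) by blast
qed

lemma ordered_B: "ordered_bratteli_diagram B"
proof -
  have "partial_order_on (all_edges B) (edge_le B)"
    unfolding partial_order_on_def preorder_on_def
  proof (intro conjI)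
    show "refl_on (all_edges B) (edge_le B)"
      by (rule refl_onI) (simp_all add: all_edges_B edge_le_B)
    show "edge_le B \<subseteq> all_edges B \<times> all_edges B"
      unfolding all_edges_B by (auto simp only: edge_le_B)
    show "trans (edge_le B)"
      by (rule transI) (simp only: edge_le_B, metis le_trans)
    show "antisym (edge_le B)"
      by (rule antisymI) (simp only: edge_le_B, metis edge_eqI le_antisym)
  qed
  moreover have "(e, f) \<in> edge_le B \<or> (f, e) \<in> edge_le B \<longleftrightarrow> rng B e = rng B f"
    if ef: "e \<in> all_edges B" "f \<in> all_edges B" for e f
  proof -
    have "ebit e \<le> 1" "ebit f \<le> 1" using ef E_D(2) unfolding all_edges_B by blast+
    then have "rng B e = rng B f \<longleftrightarrow> lev e = lev f \<and> ebit e = ebit f"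
      unfolding B_sel by presburger
    then show ?thesis using ef unfolding edge_le_B all_edges_B by (metis nat_le_linear)
  qed
  ultimately show ?thesis using bratteli_B unfolding ordered_bratteli_diagram_def by blast
qed

lemma properly_ordered_B: "properly_ordered B"
  unfolding properly_ordered_def is_max_path_iff' is_min_path_iff using ordered_B by simp

text \<open>Both letters occur in both words of the substitution. Simplicity thus holds in one step,
  and prefixes and tails of different paths can be joined by a single edge.\<close>

lemma connecting_edge:
  assumes "n \<ge> 1" "u \<le> 1" "b \<le> 1"
  shows "\<exists>i<Q n b. src_bit n i b = u"
proof (cases "u = 0")
  case True
  then show ?thesis using src_bit_0 assms(3) Q_pos by blast
next
  case False
  then have "u = 1" using assms(2) by simp
  moreover have "a n < Q n b" using k_ge[OF assms(1)] assms(1) by (simp add: Q_def)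
  moreover have "src_bit n (a n) b = 1" by (simp add: src_bit_def)
  ultimately show ?thesis by blast
qed

lemma simple_B: "simple_bratteli B"
  unfolding simple_bratteli_def
proof (intro allI impI)
  fix m :: nat assume m: "1 \<le> m"
  have "joined_by_path B m (Suc m) u v" if uv: "u \<in> verts B m" "v \<in> verts B (Suc m)" for u v
  proof -
    have "\<exists>c\<le>1. u = 2 * m + c" "\<exists>b\<le>1. v = 2 * Suc m + b" using uv m by (auto simp: B_def)
    then obtain c b where cb: "c \<le> 1" "u = 2 * m + c" "b \<le> 1" "v = 2 * Suc m + b" by blast
    obtain i where i: "i < Q m b" "src_bit m i b = c" using connecting_edge[OF m cb(1,3)] by blast
    have "enc_edge m i b \<in> edges B m" "src B (enc_edge m i b) = u" "rng B (enc_edge m i b) = v"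
      using i cb by (simp_all add: B_sel)
    then show ?thesis unfolding joined_by_path_def
      by (intro conjI exI[of _ "\<lambda>_. enc_edge m i b"]) auto
  qed
  then show "\<exists>n>m. \<forall>u\<in>verts B m. \<forall>v\<in>verts B n. joined_by_path B m n u v" by blast
qed

lemma card_verts_B: "card (verts B n) \<le> 2"
  by (simp add: B_def card_insert_if)

section \<open>The Vershik map climbs the towers\<close>

definition step :: "nat \<Rightarrow> (nat \<Rightarrow> nat) \<Rightarrow> nat \<Rightarrow> nat" where
  "step m x = descend m (x(m := enc_edge m (Suc (idx (x m))) (ebit (x m))))"

lemma step_gt: "i > m \<Longrightarrow> step m x i = x i"
  by (simp add: step_def)

lemma step_at: "step m x m = enc_edge m (Suc (idx (x m))) (ebit (x m))"
  by (simp add: step_def)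

lemma step_path:
  assumes "x \<in> X" "Suc (idx (x m)) < Q m (ebit (x m))"
  shows "step m x \<in> X"
proof -
  have "path_from m (x(m := enc_edge m (Suc (idx (x m))) (V (Suc m) x)))"
    using assms pathsD(2)[OF assms(1), of m] by (intro path_from_update path_from_path) simp_all
  then show ?thesis unfolding step_def using pathsD(2)[OF assms(1), of m] by (simp add: descend_path)
qed

lemma P_step_low: "P m (step m x) = 0"
  unfolding step_def by (rule P_descend)

lemma P_step_at: "P (Suc m) (step m x) = off m (Suc (idx (x m))) (ebit (x m))"
  by (simp add: P_Suc P_step_low step_at)

lemma vershik_max: "T x_max = x_min"
  unfolding vershik_map_def is_max_path_iff' is_min_path_iff by simp

lemma max_edge_path_iff: "x \<in> X \<Longrightarrow> max_edge B (x n) \<longleftrightarrow> Suc (idx (x n)) = Q n (ebit (x n))"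
  unfolding max_edge_iff by (metis E_D(1) pathsD(1))

lemma vershik_step:
  assumes x: "x \<in> X" and low: "\<And>i. i < m \<Longrightarrow> Suc (idx (x i)) = Q i (ebit (x i))"
    and m: "Suc (idx (x m)) < Q m (ebit (x m))"
  shows "T x = step m x"
proof -
  have "\<not> is_max_path B x" using m unfolding is_max_path_iff by (metis less_irrefl)
  moreover have "(LEAST n. \<not> max_edge B (x n)) = m"
  proof (rule Least_equality)
    show "\<not> max_edge B (x m)" using m max_edge_path_iff[OF x] by simp
    show "m \<le> n" if "\<not> max_edge B (x n)" for n
      using that low max_edge_path_iff[OF x] not_le by blast
  qed
  moreover have "(THE y. y \<in> X \<and> (\<forall>i<m. min_edge B (y i)) \<and>
                is_edge_succ B (x m) (y m) \<and> (\<forall>i>m. y i = x i)) = step m x"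
  proof (rule the_equality)
    have "min_edge B (step m x i)" if "i < m" for i
      unfolding min_edge_iff using pathsD(1)[OF step_path[OF x m], of i] that
      by (auto simp: step_def descend_def)
    then show "step m x \<in> X \<and> (\<forall>i<m. min_edge B (step m x i)) \<and>
                is_edge_succ B (x m) (step m x m) \<and> (\<forall>i>m. step m x i = x i)"
      using step_path[OF x m] m step_gt is_edge_succ_iff[OF pathsD(1)[OF x]] step_at by simp
  next
    fix y assume y: "y \<in> X \<and> (\<forall>i<m. min_edge B (y i)) \<and>
                is_edge_succ B (x m) (y m) \<and> (\<forall>i>m. y i = x i)"
    have "off i (idx (y i)) (ebit (y i)) = 0" if "i < m" for i
    proof -
      have "idx (y i) = 0" using y that unfolding min_edge_iff by blast
      moreover have "ebit (y i) \<le> 1" using y pathsD(1) E_D(2) by blast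
      ultimately show ?thesis using off_0 by simp
    qed
    \<comment> \<open>Uniqueness of the successor path: both candidates sit on the bottom floor at
      level m and agree from there on, so \<open>P_inj\<close> identifies them.\<close>
    then have P0: "P m y = P m (step m x)" unfolding P_step_low by (simp add: P_def)
    have "y m = step m x m"
      using y is_edge_succ_iff[OF pathsD(1)[OF x]] step_at by simp
    then have "y i = step m x i" if "i \<ge> m" for i
      using y step_gt[of m i x] that by (cases "i = m") auto
    then show "y = step m x" using P_inj[of y "step m x" m] y step_path[OF x m] P0 by blast
  qed
  ultimately show ?thesis unfolding vershik_map_def Let_def by simp
qed

text \<open>By \<open>off_Suc\<close> and \<open>off_Q\<close>, the block of the last edge ends at
  the top of the tower. So a path that is not on the top floor has a non-maximal edge below n, which
  is how \<open>T_tower\<close> uses this.\<close>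

lemma P_top:
  assumes x: "x \<in> X" and low: "\<And>i. i < n \<Longrightarrow> Suc (idx (x i)) = Q i (ebit (x i))"
  shows "Suc (P n x) = h n + V n x"
  using low
proof (induction n)
  case 0
  then show ?case using V_0[OF x] by simp
next
  case (Suc n)
  have "Suc (P (Suc n) x) = off n (idx (x n)) (ebit (x n)) + h n + V n x"
    using Suc by (simp add: P_Suc)
  also have "\<dots> = off n (Q n (ebit (x n))) (ebit (x n))"
    using off_Suc[of n "idx (x n)" "ebit (x n)"] Suc.prems[of n] by (simp add: V_def)
  also have "\<dots> = h (Suc n) + V (Suc n) x"
    using off_Q E_D(2)[OF pathsD(1)[OF x]] pathsD(2)[OF x] by simp
  finally show ?case .
qed

lemma first_nonmax:
  assumes x: "x \<in> X" and m: "Suc (idx (x m)) \<noteq> Q m (ebit (x m))"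
  shows "\<exists>l\<le>m. (\<forall>i<l. Suc (idx (x i)) = Q i (ebit (x i))) \<and> Suc (idx (x l)) < Q l (ebit (x l))"
proof -
  let ?l = "LEAST l. Suc (idx (x l)) \<noteq> Q l (ebit (x l))"
  have "Suc (idx (x ?l)) \<noteq> Q ?l (ebit (x ?l))" using m by (rule LeastI)
  moreover have "idx (x ?l) < Q ?l (ebit (x ?l))" using E_D(3)[OF pathsD(1)[OF x]] .
  ultimately have "Suc (idx (x ?l)) < Q ?l (ebit (x ?l))" by linarith
  moreover have "?l \<le> m" using m by (rule Least_le)
  ultimately show ?thesis using not_less_Least by blast
qed

text \<open>At the first non-maximal level m the path is on the top floor of its subtower and moves
  to the bottom of the next one, which raises the position at level m + 1 by exactly one; the
  unchanged edges above add equal offsets to both positions.\<close>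

lemma T_tower:
  assumes x: "x \<in> X" and less: "Suc (P n x) < h n + V n x"
  shows "T x \<in> X" "P n (T x) = Suc (P n x)" "\<And>i. i \<ge> n \<Longrightarrow> T x i = x i"
proof -
  obtain l where "l < n" "Suc (idx (x l)) \<noteq> Q l (ebit (x l))"
    using P_top[OF x, of n] less by (metis less_irrefl)
  with first_nonmax[OF x, of l] obtain m where m: "m < n" "\<forall>i<m. Suc (idx (x i)) = Q i (ebit (x i))"
      "Suc (idx (x m)) < Q m (ebit (x m))"
    using le_less_trans by blast
  have T: "T x = step m x" using m by (intro vershik_step[OF x]) auto
  show "T x \<in> X" unfolding T by (rule step_path[OF x m(3)])
  show "T x i = x i" if "i \<ge> n" for i unfolding T using that m(1) by (simp add: step_gt)
  have base: "P (Suc m) (T x) = Suc (P (Suc m) x)"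
    unfolding T P_step_at off_Suc using P_top[OF x, of m] m(2) by (simp add: P_Suc V_def)
  have "P (Suc m + j) (T x) = Suc (P (Suc m + j) x)" for j
  proof (induction j)
    case (Suc j)
    have "T x (Suc m + j) = x (Suc m + j)" unfolding T by (rule step_gt) simp
    then show ?case using Suc by (simp add: P_Suc)
  qed (use base in simp)
  moreover have "n = Suc m + (n - Suc m)" using m(1) by simp
  ultimately show "P n (T x) = Suc (P n x)" by metis
qed

lemma nonmax_tower:
  assumes x: "x \<in> X" and ne: "x \<noteq> x_max"
  shows "\<exists>n. Suc (P n x) < h n + V n x"
proof -
  obtain m where "Suc (idx (x m)) \<noteq> Q m (ebit (x m))"
    using x ne is_max_path_iff is_max_path_iff' by blast
  then have m: "Suc (idx (x m)) < Q m (ebit (x m))" using E_D(3)[OF pathsD(1)[OF x, of m]] by linarith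
  have "Suc (P (Suc m) x) \<le> off m (Suc (idx (x m))) (ebit (x m))"
    using P_less[OF x, of m] by (simp add: P_Suc off_Suc V_def)
  also have "\<dots> < off m (Suc (Suc (idx (x m)))) (ebit (x m))" using h_pos[of m] off_Suc by simp
  also have "\<dots> \<le> off m (Q m (ebit (x m))) (ebit (x m))" using m by (intro off_mono) simp
  also have "\<dots> = h (Suc m) + V (Suc m) x"
    using off_Q E_D(2)[OF pathsD(1)[OF x]] pathsD(2)[OF x] by simp
  finally show ?thesis by blast
qed

lemma tower_mono:
  assumes x: "x \<in> X" and less: "Suc (P n x) < h n + V n x" and "n \<le> m"
  shows "Suc (P m x) < h m + V m x"
  using assms(3)
proof (induction m rule: dec_induct)
  case base
  show ?case by (rule less)
next
  case (step m)
  have "Suc (P (Suc m) x) < off m (Suc (idx (x m))) (ebit (x m))"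
    using step by (simp add: P_Suc off_Suc V_def)
  also have "\<dots> \<le> off m (Q m (ebit (x m))) (ebit (x m))"
    using E_D(3)[OF pathsD(1)[OF x]] by (intro off_mono) (simp add: Suc_le_eq)
  also have "\<dots> = h (Suc m) + V (Suc m) x"
    using off_Q E_D(2)[OF pathsD(1)[OF x]] pathsD(2)[OF x] by simp
  finally show ?case .
qed

lemma T_in: "x \<in> X \<Longrightarrow> T x \<in> X"
  using nonmax_tower T_tower(1) vershik_max x_min_path by metis

text \<open>Two points other than \<open>x_max\<close> are compared at a level where neither is on
  the top floor: equal images have equal positions and tails there. Nothing else reaches
  \<open>x_min\<close>, because climbing leads to a positive position.\<close>

lemma T_inj: "inj_on T X"
proof (rule inj_onI)
  have *: "y = x_max" if yX: "y \<in> X" "T y = x_min" for y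
  proof (rule ccontr)
    assume "y \<noteq> x_max"
    then obtain n where "Suc (P n y) < h n + V n y" using nonmax_tower[OF yX(1)] by blast
    then have "P n x_min = Suc (P n y)" using T_tower(2)[OF yX(1)] yX(2) by metis
    moreover have "P n x_min = 0" by (simp add: P_def x_min_def off_0)
    ultimately show False by simp
  qed
  fix x y assume xy: "x \<in> X" "y \<in> X" "T x = T y"
  show "x = y"
  proof (cases "x = x_max \<or> y = x_max")
    case True
    then show ?thesis using * xy vershik_max by metis
  next
    case False
    then obtain n m where nm: "Suc (P n x) < h n + V n x" "Suc (P m y) < h m + V m y"
      using nonmax_tower xy by metis
    let ?N = "max n m"
    have N: "Suc (P ?N x) < h ?N + V ?N x" "Suc (P ?N y) < h ?N + V ?N y"
      using tower_mono nm xy(1,2) by (meson max.cobounded1 max.cobounded2)+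
    have "Suc (P ?N x) = Suc (P ?N y)" using T_tower(2) N xy by metis
    moreover have "x i = y i" if "i \<ge> ?N" for i
      using T_tower(3)[OF xy(1) N(1) that] T_tower(3)[OF xy(2) N(2) that] xy(3) by simp
    ultimately show ?thesis using P_inj xy(1,2) by blast
  qed
qed

text \<open>The preimage is the point one floor lower with the same tail, supplied by
  \<open>P_surj\<close>.\<close>

lemma T_predecessor:
  assumes y: "y \<in> X" and pos: "P n y > 0"
  shows "\<exists>x\<in>X. T x = y \<and> (\<forall>i\<ge>n. x i = y i) \<and> Suc (P n x) = P n y"
proof -
  have "P n y - 1 < h n + V n y" using P_less[OF y, of n] by simp
  from P_surj[OF path_from_path[OF y] this V_0[OF y]]
  obtain x where x: "x \<in> X" "\<forall>i\<ge>n. x i = y i" "P n x = P n y - 1" by blast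
  have "V n x = V n y" using x(2) by (intro V_cong) simp
  then have less: "Suc (P n x) < h n + V n x" using x(3) pos P_less[OF y, of n] by simp
  have "T x = y"
    using x T_tower[OF x(1) less] y pos by (intro P_inj[of _ _ n]) auto
  with x pos show ?thesis by auto
qed

lemma x_min_if_P_0:
  assumes x: "x \<in> X" and "\<And>n. P n x = 0"
  shows "x = x_min"
proof -
  have "idx (x n) = 0" for n
  proof (rule ccontr)
    assume "idx (x n) \<noteq> 0"
    then have "off n 1 (ebit (x n)) \<le> off n (idx (x n)) (ebit (x n))" by (intro off_mono) simp
    moreover have "off n 1 (ebit (x n)) > 0" using h_pos[of n] off_Suc[of n 0] by simp
    ultimately show False using assms(2)[of "Suc n"] by (simp add: P_Suc)
  qed
  then have "is_min_path B x" using x pathsD(1) unfolding is_min_path_def min_edge_iff by blast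
  then show ?thesis using is_min_path_iff by simp
qed

lemma T_image: "T ` X = X"
proof
  show "T ` X \<subseteq> X" using T_in by blast
  show "X \<subseteq> T ` X"
  proof
    fix y assume y: "y \<in> X"
    show "y \<in> T ` X"
    proof (cases "\<exists>n. P n y > 0")
      case True
      then show ?thesis using T_predecessor[OF y] by blast
    next
      case False
      then have "y = x_min" using x_min_if_P_0[OF y] by simp
      then show ?thesis using vershik_max x_max_path by (metis image_eqI)
    qed
  qed
qed

lemma T_iterate:
  assumes x: "x \<in> X" and "P n x + j < h n + V n x"
  shows "(T ^^ j) x \<in> X \<and> P n ((T ^^ j) x) = P n x + j \<and> (\<forall>i\<ge>n. (T ^^ j) x i = x i)"
  using assms(2)
proof (induction j)
  case (Suc j)
  then have IH: "(T ^^ j) x \<in> X" "P n ((T ^^ j) x) = P n x + j" "\<forall>i\<ge>n. (T ^^ j) x i = x i" by auto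
  have "V n ((T ^^ j) x) = V n x" using IH(3) by (intro V_cong) simp
  then have "Suc (P n ((T ^^ j) x)) < h n + V n ((T ^^ j) x)" using IH(2) Suc.prems by simp
  from T_tower[OF IH(1) this] IH show ?case by simp
qed (use x in simp)

text \<open>Paths with a common tail lie on one orbit, and the difference of their positions is the
  time between them. Density and the estimates for continuous eigenfunctions rest on this.\<close>

lemma tail_orbit:
  assumes "x \<in> X" "y \<in> X" "\<And>i. i \<ge> n \<Longrightarrow> y i = x i" "P n x \<le> P n y"
  shows "y = (T ^^ (P n y - P n x)) x"
proof -
  have "V n y = V n x" using assms(3) by (intro V_cong) simp
  then have "P n x + (P n y - P n x) < h n + V n x" using P_less[OF assms(2), of n] assms(4) by simp
  from T_iterate[OF assms(1) this] assms show ?thesis by (intro P_inj[of _ _ n]) auto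
qed

text \<open>Near \<open>x_max\<close> this holds because all minimal edges start in the first tower.\<close>

lemma T_local:
  assumes x: "x \<in> X" and y: "y \<in> X" and eq: "\<And>i. i \<le> n \<Longrightarrow> x i = y i" and i: "i < n"
  shows "T x i = T y i"
proof (cases "\<forall>m\<le>n. Suc (idx (x m)) = Q m (ebit (x m))")
  case False
  then obtain l where "l \<le> n" "Suc (idx (x l)) \<noteq> Q l (ebit (x l))" by blast
  with first_nonmax[OF x, of l] obtain m where m: "m \<le> n" "\<forall>i<m. Suc (idx (x i)) = Q i (ebit (x i))"
      "Suc (idx (x m)) < Q m (ebit (x m))"
    using le_trans by blast
  have "T x = step m x" using m by (intro vershik_step[OF x]) auto
  moreover have "T y = step m y" using m eq by (intro vershik_step[OF y]) auto
  moreover have "step m x i = step m y i"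
    using eq[of i] eq[of m] i m(1) by (auto simp: step_def descend_def V_def)
  ultimately show ?thesis by simp
next
  case True
  have min: "T z i = x_min i" if z: "z \<in> X" "\<forall>m\<le>n. Suc (idx (z m)) = Q m (ebit (z m))" for z
  proof (cases "z = x_max")
    case True
    then show ?thesis using vershik_max by simp
  next
    case False
    then obtain m' where "Suc (idx (z m')) \<noteq> Q m' (ebit (z m'))"
      using z is_max_path_iff is_max_path_iff' by blast
    then obtain m where m: "\<forall>i<m. Suc (idx (z i)) = Q i (ebit (z i))" "Suc (idx (z m)) < Q m (ebit (z m))"
      using first_nonmax[OF z(1)] by blast
    \<comment> \<open>Only the edge at level m - 1 of the descending prefix can enter tower B, and m
      - 1 >= n; so all levels below n look like \<open>x_min\<close>.\<close>
    have "n < m" using m(2) z(2) by (metis not_less less_irrefl)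
    moreover have "T z = step m z" using m by (intro vershik_step[OF z(1)]) auto
    ultimately show ?thesis using i by (simp add: step_def descend_def x_min_def)
  qed
  have "\<forall>m\<le>n. Suc (idx (y m)) = Q m (ebit (y m))" using True eq by simp
  then show ?thesis using min x y True by simp
qed

end

section \<open>Cantor sets of sequences\<close>

text \<open>One topology covers both path spaces and Boolean sequences, so that continuity on either
  side reduces to agreement of finite prefixes.\<close>

definition seq_topology :: "(nat \<Rightarrow> 'a) set \<Rightarrow> (nat \<Rightarrow> 'a) topology" where
  "seq_topology S = subtopology (product_topology (\<lambda>_. discrete_topology UNIV) UNIV) S"

lemma topspace_seq_topology [simp]: "topspace (seq_topology S) = S"
  by (simp add: seq_topology_def)

lemma openin_seq_topology_UNIV:
  "openin (product_topology (\<lambda>_::nat. discrete_topology (UNIV :: 'a set)) UNIV) U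
     \<longleftrightarrow> (\<forall>x\<in>U. \<exists>n. \<forall>y. (\<forall>i<n. y i = x i) \<longrightarrow> y \<in> U)"
  unfolding openin_product_topology_alt
proof (intro ball_cong refl iffI)
  fix x assume "\<exists>W. finite {i \<in> UNIV. W i \<noteq> topspace (discrete_topology (UNIV :: 'a set))} \<and>
            (\<forall>i\<in>UNIV. openin (discrete_topology UNIV) (W i)) \<and> x \<in> Pi\<^sub>E UNIV W \<and> Pi\<^sub>E UNIV W \<subseteq> U"
  then obtain W where W: "finite {i. W i \<noteq> (UNIV :: 'a set)}" "x \<in> Pi\<^sub>E UNIV W" "Pi\<^sub>E UNIV W \<subseteq> U"
    by auto
  obtain n where n: "\<And>i. W i \<noteq> UNIV \<Longrightarrow> i < n"
    using W(1) unfolding finite_nat_set_iff_bounded by blast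
  have "y \<in> U" if y: "\<forall>i<n. y i = x i" for y
  proof -
    have "y i \<in> W i" for i using n[of i] y W(2) by (cases "W i = UNIV") (auto simp: PiE_iff)
    then show ?thesis using W(3) by (auto simp: PiE_iff)
  qed
  then show "\<exists>n. \<forall>y. (\<forall>i<n. y i = x i) \<longrightarrow> y \<in> U" by blast
next
  fix x assume "\<exists>n. \<forall>y. (\<forall>i<n. y i = x i) \<longrightarrow> y \<in> U"
  then obtain n where n: "\<And>y. (\<forall>i<n. y i = x i) \<Longrightarrow> y \<in> U" by blast
  let ?W = "\<lambda>i. if i < n then {x i} else UNIV"
  have "finite {i. ?W i \<noteq> UNIV}" by (rule finite_subset[of _ "{..<n}"]) auto
  moreover have "x \<in> Pi\<^sub>E UNIV ?W" by (simp add: PiE_iff)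
  moreover have "Pi\<^sub>E UNIV ?W \<subseteq> U"
  proof
    fix y assume "y \<in> Pi\<^sub>E UNIV ?W"
    then have "y i \<in> ?W i" for i by (simp add: PiE_iff)
    then have "y i = x i" if "i < n" for i using that by (metis singletonD)
    then show "y \<in> U" using n by blast
  qed
  ultimately show "\<exists>W. finite {i \<in> UNIV. W i \<noteq> topspace (discrete_topology (UNIV :: 'a set))} \<and>
            (\<forall>i\<in>UNIV. openin (discrete_topology UNIV) (W i)) \<and> x \<in> Pi\<^sub>E UNIV W \<and> Pi\<^sub>E UNIV W \<subseteq> U"
    by (intro exI[of _ ?W]) simp
qed

lemma openin_seq_topology:
  "openin (seq_topology S) U \<longleftrightarrow> U \<subseteq> S \<and> (\<forall>x\<in>U. \<exists>n. \<forall>y\<in>S. (\<forall>i<n. y i = x i) \<longrightarrow> y \<in> U)"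
proof
  assume "openin (seq_topology S) U"
  then obtain W where W: "\<forall>x\<in>W. \<exists>n. \<forall>y. (\<forall>i<n. y i = x i) \<longrightarrow> y \<in> W" "U = W \<inter> S"
    unfolding seq_topology_def openin_subtopology openin_seq_topology_UNIV by blast
  then show "U \<subseteq> S \<and> (\<forall>x\<in>U. \<exists>n. \<forall>y\<in>S. (\<forall>i<n. y i = x i) \<longrightarrow> y \<in> U)"
    by (metis IntD1 IntD2 IntI inf_le2)
next
  assume U: "U \<subseteq> S \<and> (\<forall>x\<in>U. \<exists>n. \<forall>y\<in>S. (\<forall>i<n. y i = x i) \<longrightarrow> y \<in> U)"
  \<comment> \<open>The union of all cylinders of the full sequence space that are centred in U and
    meet S only within U.\<close>
  define W where "W = {y. \<exists>x\<in>U. \<exists>n. (\<forall>i<n. y i = x i) \<and> (\<forall>z\<in>S. (\<forall>i<n. z i = x i) \<longrightarrow> z \<in> U)}"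
  have "\<exists>n. \<forall>z. (\<forall>i<n. z i = y i) \<longrightarrow> z \<in> W" if y: "y \<in> W" for y
  proof -
    obtain x n where xn: "x \<in> U" "\<forall>i<n. y i = x i" "\<forall>z\<in>S. (\<forall>i<n. z i = x i) \<longrightarrow> z \<in> U"
      using y unfolding W_def by blast
    have "z \<in> W" if "\<forall>i<n. z i = y i" for z
      using xn that unfolding W_def by (intro CollectI bexI[of _ x] exI[of _ n]) auto
    then show ?thesis by blast
  qed
  moreover have "U = W \<inter> S"
  proof
    show "U \<subseteq> W \<inter> S" using U unfolding W_def by blast
    show "W \<inter> S \<subseteq> U" unfolding W_def by blast
  qed
  ultimately show "openin (seq_topology S) U"
    unfolding seq_topology_def openin_subtopology openin_seq_topology_UNIV by blast
qed

lemma Hausdorff_seq_topology: "Hausdorff_space (seq_topology S)"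
  unfolding seq_topology_def
  by (intro Hausdorff_space_subtopology) (simp add: Hausdorff_space_product_topology)

text \<open>The set is closed in the product of its finite coordinate images, which is compact by
  Tychonoff.\<close>

lemma compact_seq_topology:
  assumes fin: "\<And>n. finite ((\<lambda>x. x n) ` S)"
    and closed: "\<And>z. (\<And>n. \<exists>y\<in>S. \<forall>i<n. y i = z i) \<Longrightarrow> z \<in> S"
  shows "compact_space (seq_topology S)"
proof -
  let ?N = "product_topology (\<lambda>_::nat. discrete_topology (UNIV :: 'a set)) UNIV"
  let ?K = "Pi\<^sub>E UNIV (\<lambda>n. (\<lambda>x. x n) ` S)"
  have "compactin ?N ?K"
    unfolding compactin_PiE by (simp add: finite_imp_compactin fin)
  moreover have "S \<subseteq> ?K" by auto
  moreover have "closedin ?N S"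
  proof -
    have "openin ?N (UNIV - S)" unfolding openin_seq_topology_UNIV
    proof
      fix x assume "x \<in> UNIV - S"
      then have "\<exists>n. \<forall>y\<in>S. \<not> (\<forall>i<n. y i = x i)" using closed[of x] by blast
      then show "\<exists>n. \<forall>y. (\<forall>i<n. y i = x i) \<longrightarrow> y \<in> UNIV - S" by blast
    qed
    then show ?thesis unfolding closedin_def by simp
  qed
  ultimately show ?thesis
    unfolding seq_topology_def by (metis compact_space_subtopology closed_compactin)
qed

lemma continuous_map_seq_topology:
  assumes "f \<in> S \<rightarrow> S'"
    and loc: "\<And>x n. x \<in> S \<Longrightarrow> \<exists>m. \<forall>y\<in>S. (\<forall>i<m. y i = x i) \<longrightarrow> (\<forall>i<n. f y i = f x i)"
  shows "continuous_map (seq_topology S) (seq_topology S') f"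
  unfolding continuous_map_def
proof (intro conjI allI impI)
  show "f \<in> topspace (seq_topology S) \<rightarrow> topspace (seq_topology S')" using assms(1) by simp
  fix U assume "openin (seq_topology S') U"
  then have U: "\<forall>x\<in>U. \<exists>n. \<forall>y\<in>S'. (\<forall>i<n. y i = x i) \<longrightarrow> y \<in> U" unfolding openin_seq_topology by blast
  have "\<exists>n. \<forall>y\<in>S. (\<forall>i<n. y i = x i) \<longrightarrow> y \<in> {x \<in> S. f x \<in> U}" if x: "x \<in> S" "f x \<in> U" for x
  proof -
    obtain n where n: "\<forall>y\<in>S'. (\<forall>i<n. y i = f x i) \<longrightarrow> y \<in> U" using U x(2) by blast
    obtain m where m: "\<forall>y\<in>S. (\<forall>i<m. y i = x i) \<longrightarrow> (\<forall>i<n. f y i = f x i)" using loc[OF x(1)] by blast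
    show ?thesis using n m assms(1) by blast
  qed
  then show "openin (seq_topology S) {x \<in> topspace (seq_topology S). f x \<in> U}"
    unfolding openin_seq_topology topspace_seq_topology by blast
qed

text \<open>Splitting a nonempty clopen set at the first coordinate on which it is not constant, by
  separating the least value there from the others, and iterating, produces a binary tree of
  clopen sets whose branches shrink to points.\<close>

definition split_at :: "(nat \<Rightarrow> nat) set \<Rightarrow> nat" where
  "split_at U = (LEAST n. \<exists>x\<in>U. \<exists>y\<in>U. x n \<noteq> y n)"

definition split_bit :: "(nat \<Rightarrow> nat) set \<Rightarrow> (nat \<Rightarrow> nat) \<Rightarrow> bool" where
  "split_bit U x \<longleftrightarrow> x (split_at U) = (LEAST v. \<exists>y\<in>U. y (split_at U) = v)"

primrec branch :: "(nat \<Rightarrow> nat) set \<Rightarrow> (nat \<Rightarrow> bool) \<Rightarrow> nat \<Rightarrow> (nat \<Rightarrow> nat) set" where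
  "branch S \<beta> 0 = S"
| "branch S \<beta> (Suc l) = {x \<in> branch S \<beta> l. split_bit (branch S \<beta> l) x = \<beta> l}"

text \<open>\<open>branch\<close> follows prescribed bits, \<open>piece\<close> follows the bits of
  a given point; the former serves surjectivity of the coding, the latter its definition.\<close>

primrec piece :: "(nat \<Rightarrow> nat) set \<Rightarrow> (nat \<Rightarrow> nat) \<Rightarrow> nat \<Rightarrow> (nat \<Rightarrow> nat) set" where
  "piece S x 0 = S"
| "piece S x (Suc l) = {y \<in> piece S x l. split_bit (piece S x l) y = split_bit (piece S x l) x}"

lemma piece_eq_branch: "piece S x l = branch S (\<lambda>l. split_bit (piece S x l) x) l"
  by (induction l) auto

lemma branch_antimono: "l \<le> m \<Longrightarrow> branch S \<beta> m \<subseteq> branch S \<beta> l"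
  by (induction m rule: dec_induct) auto

lemma split_bit_surj:
  assumes "x \<in> U" "y \<in> U" "x \<noteq> y"
  shows "\<exists>z\<in>U. split_bit U z = b" "\<forall>i<split_at U. \<forall>x\<in>U. \<forall>y\<in>U. x i = y i"
    "\<exists>u\<in>U. \<exists>w\<in>U. u (split_at U) \<noteq> w (split_at U)"
proof -
  have "\<exists>n. \<exists>x\<in>U. \<exists>y\<in>U. x n \<noteq> y n" using assms by blast
  then show ne: "\<exists>u\<in>U. \<exists>w\<in>U. u (split_at U) \<noteq> w (split_at U)" unfolding split_at_def by (rule LeastI_ex)
  show "\<forall>i<split_at U. \<forall>x\<in>U. \<forall>y\<in>U. x i = y i" unfolding split_at_def using not_less_Least by blast
  have "\<exists>y\<in>U. y (split_at U) = (LEAST v. \<exists>y\<in>U. y (split_at U) = v)"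
    by (rule LeastI_ex) (use assms(1) in blast)
  then show "\<exists>z\<in>U. split_bit U z = b" using ne unfolding split_bit_def by (cases b) metis+
qed

text \<open>Brouwer's characterisation of the Cantor set, for sets of sequences: \<open>fin\<close>
  and \<open>closed\<close> express compactness, \<open>perfect\<close> the absence of isolated
  points.\<close>

locale cantor_tree =
  fixes S :: "(nat \<Rightarrow> nat) set"
  assumes nonempty: "S \<noteq> {}"
    and fin: "\<And>n. finite ((\<lambda>x. x n) ` S)"
    and closed: "\<And>z. (\<And>n. \<exists>y\<in>S. \<forall>i<n. y i = z i) \<Longrightarrow> z \<in> S"
    and perfect: "\<And>x n. x \<in> S \<Longrightarrow> \<exists>y\<in>S. y \<noteq> x \<and> (\<forall>i<n. y i = x i)"
begin

text \<open>The two claims need each other: a set determined by finitely many coordinates contains,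
  with any point, a second one by \<open>perfect\<close>, and then both values of the splitting bit
  occur.\<close>

lemma branch_clopen:
  "branch S \<beta> l \<noteq> {} \<and> (\<exists>m. \<forall>x\<in>branch S \<beta> l. \<forall>y\<in>S. (\<forall>i<m. y i = x i) \<longrightarrow> y \<in> branch S \<beta> l)"
proof (induction l)
  case 0
  then show ?case using nonempty by auto
next
  case (Suc l)
  let ?U = "branch S \<beta> l"
  obtain m where m: "\<forall>x\<in>?U. \<forall>y\<in>S. (\<forall>i<m. y i = x i) \<longrightarrow> y \<in> ?U" using Suc by blast
  obtain x where x: "x \<in> ?U" using Suc by blast
  then have "x \<in> S" using branch_antimono[of 0 l S \<beta>] by auto
  then obtain y where "y \<in> S" "y \<noteq> x" "\<forall>i<m. y i = x i" using perfect by blast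
  then have "y \<in> ?U" "x \<noteq> y" using m x by auto
  then obtain z where z: "z \<in> ?U" "split_bit ?U z = \<beta> l" using split_bit_surj(1)[OF x] by blast
  let ?m = "max m (Suc (split_at ?U))"
  have "w \<in> branch S \<beta> (Suc l)" if "u \<in> branch S \<beta> (Suc l)" "w \<in> S" "\<forall>i<?m. w i = u i" for u w
  proof -
    have "u \<in> ?U" "\<forall>i<m. w i = u i" using that by simp_all
    then have "w \<in> ?U" using that(2) m by blast
    moreover have "w (split_at ?U) = u (split_at ?U)" using that(3) by simp
    ultimately show ?thesis using that(1) unfolding split_bit_def by (simp add: split_bit_def)
  qed
  then have "\<exists>m. \<forall>x\<in>branch S \<beta> (Suc l). \<forall>y\<in>S. (\<forall>i<m. y i = x i) \<longrightarrow> y \<in> branch S \<beta> (Suc l)"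
    by blast
  moreover have "branch S \<beta> (Suc l) \<noteq> {}" using z by auto
  ultimately show ?case by blast
qed

lemma branch_subset: "branch S \<beta> l \<subseteq> S"
  using branch_antimono[of 0 l S \<beta>] by simp

text \<open>Once the coordinates below n are constant, every split of a set not constant at n
  happens at n and discards at least one of the finitely many values there, so the number of values
  drops until coordinate n is constant too.\<close>

lemma branch_shrinks: "\<exists>l. \<forall>i<n. \<forall>x\<in>branch S \<beta> l. \<forall>y\<in>branch S \<beta> l. x i = y i"
proof (induction n)
  case (Suc n)
  then obtain l0 where l0: "\<forall>i<n. \<forall>x\<in>branch S \<beta> l0. \<forall>y\<in>branch S \<beta> l0. x i = y i" by blast
  have "\<exists>l'\<ge>l0. \<forall>x\<in>branch S \<beta> l'. \<forall>y\<in>branch S \<beta> l'. x n = y n"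
    if "l \<ge> l0" "card ((\<lambda>x. x n) ` branch S \<beta> l) = c" for l c
    using that
  proof (induction c arbitrary: l rule: less_induct)
    case (less c)
    let ?U = "branch S \<beta> l" and ?U' = "branch S \<beta> (Suc l)"
    show ?case
    proof (cases "\<forall>x\<in>?U. \<forall>y\<in>?U. x n = y n")
      case True
      then show ?thesis using less.prems by blast
    next
      case False
      then obtain x y where xy: "x \<in> ?U" "y \<in> ?U" "x n \<noteq> y n" by blast
      then have "x \<noteq> y" by auto
      note sp = split_bit_surj[OF xy(1,2) this]
      have "split_at ?U \<le> n" using sp(2) xy by (meson not_less)
      moreover have "\<not> split_at ?U < n"
        using sp(3) l0 branch_antimono[OF less.prems(1), of S \<beta>] by blast
      ultimately have n: "split_at ?U = n" by simp
      obtain z where z: "z \<in> ?U" "split_bit ?U z = (\<not> \<beta> l)" using sp(1) by blast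
      have "z n \<noteq> w n" if "w \<in> ?U'" for w
        using that z n unfolding split_bit_def by (auto simp: split_bit_def)
      then have "z n \<notin> (\<lambda>x. x n) ` ?U'" by auto
      then have "(\<lambda>x. x n) ` ?U' \<subset> (\<lambda>x. x n) ` ?U" using z(1) by auto
      moreover have "finite ((\<lambda>x. x n) ` ?U)"
        by (rule finite_subset[OF image_mono[OF branch_subset] fin])
      ultimately have "card ((\<lambda>x. x n) ` ?U') < card ((\<lambda>x. x n) ` ?U)" by (intro psubset_card_mono)
      then have "card ((\<lambda>x. x n) ` ?U') < c" unfolding less.prems(2) .
      from less.IH[OF this le_SucI[OF less.prems(1)] refl] show ?thesis .
    qed
  qed
  then obtain l where l: "l \<ge> l0" "\<forall>x\<in>branch S \<beta> l. \<forall>y\<in>branch S \<beta> l. x n = y n" by blast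
  have "\<forall>i<Suc n. \<forall>x\<in>branch S \<beta> l. \<forall>y\<in>branch S \<beta> l. x i = y i"
    using l l0 branch_antimono[OF l(1), of S \<beta>] unfolding less_Suc_eq by blast
  then show ?case by blast
qed simp

definition address :: "(nat \<Rightarrow> nat) \<Rightarrow> nat \<Rightarrow> bool" where
  "address x l = split_bit (piece S x l) x"

lemma piece_address: "piece S x l = branch S (address x) l"
  unfolding address_def[abs_def] by (rule piece_eq_branch)

lemma mem_piece: "x \<in> S \<Longrightarrow> x \<in> piece S x l"
  by (induction l) auto

lemma address_inj: "inj_on address S"
proof (rule inj_onI, rule ext)
  fix x y n assume xy: "x \<in> S" "y \<in> S" "address x = address y"
  obtain l where "\<forall>i<Suc n. \<forall>u\<in>branch S (address x) l. \<forall>w\<in>branch S (address x) l. u i = w i"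
    using branch_shrinks by blast
  moreover have "x \<in> branch S (address x) l" "y \<in> branch S (address x) l"
    using mem_piece[OF xy(1)] mem_piece[OF xy(2)] xy(3) unfolding piece_address by simp_all
  ultimately show "x n = y n" by blast
qed

lemma address_surj: "\<exists>z\<in>S. address z = \<beta>"
proof -
  have "\<exists>l. \<forall>n. \<forall>i<n. \<forall>x\<in>branch S \<beta> (l n). \<forall>y\<in>branch S \<beta> (l n). x i = y i"
    by (intro choice allI branch_shrinks)
  then obtain l where l: "\<And>n. \<forall>i<n. \<forall>x\<in>branch S \<beta> (l n). \<forall>y\<in>branch S \<beta> (l n). x i = y i"
    by blast
  define w where "w m = (SOME x. x \<in> branch S \<beta> m)" for m
  have w: "w m \<in> branch S \<beta> m" for m
    unfolding w_def using branch_clopen[of \<beta> m] by (simp add: some_in_eq)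
  \<comment> \<open>The common point of the branch: coordinate i is read off at a depth where all
    points of the branch share it.\<close>
  define z where "z i = w (l (Suc i)) i" for i
  have agree: "x i = z i" if "x \<in> branch S \<beta> (l n)" "i < n" for x i n
  proof -
    let ?m = "max (l n) (l (Suc i))"
    have "w ?m \<in> branch S \<beta> (l n)" "w ?m \<in> branch S \<beta> (l (Suc i))"
      using w[of ?m] branch_antimono[of _ ?m S \<beta>] by (meson max.cobounded1 max.cobounded2 subsetD)+
    then have "x i = w ?m i" "w ?m i = w (l (Suc i)) i" using l that w by blast+
    then show ?thesis unfolding z_def by simp
  qed
  have "\<exists>y\<in>S. \<forall>i<n. y i = z i" for n
    using agree w branch_subset by blast
  then have z: "z \<in> S" by (rule closed)
  have zb: "z \<in> branch S \<beta> j" for j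
  proof -
    obtain m where m: "\<forall>x\<in>branch S \<beta> j. \<forall>y\<in>S. (\<forall>i<m. y i = x i) \<longrightarrow> y \<in> branch S \<beta> j"
      using branch_clopen by blast
    let ?k = "max j (l m)"
    have k: "w ?k \<in> branch S \<beta> j" "w ?k \<in> branch S \<beta> (l m)"
      using w[of ?k] branch_antimono[of _ ?k S \<beta>] by (meson max.cobounded1 max.cobounded2 subsetD)+
    have "\<forall>i<m. z i = w ?k i" using agree[OF k(2)] by simp
    then show ?thesis using m k(1) z by blast
  qed
  have "piece S z j = branch S \<beta> j" for j
  proof (induction j)
    case (Suc j)
    moreover have "split_bit (branch S \<beta> j) z = \<beta> j" using zb[of "Suc j"] by simp
    ultimately show ?case by simp
  qed simp
  then have "address z = \<beta>" using zb[of "Suc _"] by (intro ext) (simp add: address_def)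
  with z show ?thesis by blast
qed

lemma address_local: "y \<in> piece S x l \<Longrightarrow> piece S y l = piece S x l \<and> (\<forall>i<l. address y i = address x i)"
proof (induction l)
  case (Suc l)
  then show ?case by (auto simp: address_def less_Suc_eq)
qed simp

lemma cantor_space_seq_topology: "cantor_space (seq_topology S)"
proof -
  have "homeomorphic_map (seq_topology S) (seq_topology (UNIV :: (nat \<Rightarrow> bool) set)) address"
  proof (rule continuous_imp_homeomorphic_map)
    show "compact_space (seq_topology S)" using fin closed by (rule compact_seq_topology)
    show "Hausdorff_space (seq_topology (UNIV :: (nat \<Rightarrow> bool) set))" by (rule Hausdorff_seq_topology)
    show "continuous_map (seq_topology S) (seq_topology UNIV) address"
    proof (rule continuous_map_seq_topology)
      fix x n assume x: "x \<in> S"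
      have "\<exists>m. \<forall>x'\<in>piece S x n. \<forall>y\<in>S. (\<forall>i<m. y i = x' i) \<longrightarrow> y \<in> piece S x n"
        unfolding piece_address using branch_clopen by (rule conjunct2)
      then obtain m where "\<forall>x'\<in>piece S x n. \<forall>y\<in>S. (\<forall>i<m. y i = x' i) \<longrightarrow> y \<in> piece S x n"
        by blast
      then have "\<forall>i<n. address y i = address x i" if "y \<in> S" "\<forall>i<m. y i = x i" for y
        using that mem_piece[OF x, of n] address_local[of y x n] by simp
      then show "\<exists>m. \<forall>y\<in>S. (\<forall>i<m. y i = x i) \<longrightarrow> (\<forall>i<n. address y i = address x i)"
        by blast
    qed simp
    show "address ` topspace (seq_topology S) = topspace (seq_topology UNIV)"
      using address_surj by (auto simp: image_iff) metis
    show "inj_on address (topspace (seq_topology S))" using address_inj by simp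
  qed
  then show ?thesis
    unfolding cantor_space_def using homeomorphic_map_imp_homeomorphic_space
    by (simp add: seq_topology_def[of UNIV]) blast
qed

end

section \<open>Minimality and topological weak mixing\<close>

lemma path_topology_eq: "path_topology D = seq_topology (paths D)"
  unfolding topology_eq
proof (intro allI iffI)
  fix U assume "openin (path_topology D) U"
  then have "generate_topology_on {path_cylinder D n p |n p. p \<in> paths D} U"
    unfolding path_topology_def by (rule openin_topology_generated_by)
  then show "openin (seq_topology (paths D)) U"
  proof (induction rule: generate_topology_on.induct)
    case (Basis s)
    then obtain n p where "s = path_cylinder D n p" by blast
    then show ?case unfolding openin_seq_topology path_cylinder_def by (auto intro!: exI[of _ n])
  qed auto
next
  fix U assume U: "openin (seq_topology (paths D)) U"
  then have sub: "U \<subseteq> paths D" and loc: "\<forall>x\<in>U. \<exists>n. \<forall>y\<in>paths D. (\<forall>i<n. y i = x i) \<longrightarrow> y \<in> U"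
    unfolding openin_seq_topology by blast+
  have eq: "U = \<Union>{path_cylinder D n p |n p. p \<in> paths D \<and> path_cylinder D n p \<subseteq> U}" (is "U = \<Union>?C")
  proof
    show "U \<subseteq> \<Union>?C"
    proof
      fix x assume x: "x \<in> U"
      then obtain n where "\<forall>y\<in>paths D. (\<forall>i<n. y i = x i) \<longrightarrow> y \<in> U" using loc by blast
      then have "path_cylinder D n x \<subseteq> U" unfolding path_cylinder_def by blast
      moreover have "x \<in> path_cylinder D n x" using sub x unfolding path_cylinder_def by blast
      ultimately show "x \<in> \<Union>?C" using sub x by blast
    qed
  qed blast
  have "openin (path_topology D) (\<Union>?C)"
  proof (rule openin_Union)
    fix s assume "s \<in> ?C"
    then show "openin (path_topology D) s"
      unfolding path_topology_def by (intro topology_generated_by_Basis) blast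
  qed
  then show "openin (path_topology D) U" by (subst eq)
qed

lemma continuous_map_seq_topology_dist:
  fixes f :: "(nat \<Rightarrow> 'a) \<Rightarrow> 'b :: metric_space"
  assumes "continuous_map (seq_topology S) euclidean f" "x \<in> S" "e > 0"
  shows "\<exists>n. \<forall>y\<in>S. (\<forall>i<n. y i = x i) \<longrightarrow> dist (f y) (f x) < e"
proof -
  have "openin (seq_topology S) {y \<in> topspace (seq_topology S). f y \<in> ball (f x) e}"
    using assms(1) by (rule openin_continuous_map_preimage) simp
  moreover have "x \<in> {y \<in> topspace (seq_topology S). f y \<in> ball (f x) e}" using assms by simp
  ultimately have "\<exists>n. \<forall>y\<in>S. (\<forall>i<n. y i = x i) \<longrightarrow> y \<in> {y \<in> topspace (seq_topology S). f y \<in> ball (f x) e}"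
    unfolding openin_seq_topology by blast
  then show ?thesis by (auto simp: dist_commute)
qed

context two_towers begin

lemma E_finite: "finite (E n)"
  using bratteli_B unfolding bratteli_diagram_def B_sel(1) by blast

lemma X_closed:
  assumes "\<And>n. \<exists>y\<in>X. \<forall>i<n. y i = z i"
  shows "z \<in> X"
  unfolding paths_iff
proof
  fix n
  obtain y where y: "y \<in> X" "\<forall>i<Suc (Suc n). y i = z i" using assms by blast
  then have "y n = z n" "V (Suc n) y = V (Suc n) z" by (simp_all add: V_def)
  then show "z n \<in> E n \<and> ebit (z n) = V (Suc n) z" using pathsD[OF y(1), of n] by simp
qed

lemma coord_finite: "finite ((\<lambda>x. x n) ` X)"
  by (rule finite_subset[OF _ E_finite[of n]]) (use pathsD(1) in blast)

lemma splice_path: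
  assumes x: "x \<in> X" and w: "path_from n w" and eq: "V n w = V n x"
  shows "(\<lambda>m. if m < n then x m else w m) \<in> X"
  unfolding paths_iff
proof
  fix m
  let ?z = "\<lambda>m. if m < n then x m else w m"
  have "V (Suc m) ?z = (if Suc m \<le> n then V (Suc m) x else V (Suc m) w)"
    using eq unfolding V_def by (cases "Suc m = n") auto
  then show "?z m \<in> E m \<and> ebit (?z m) = V (Suc m) ?z"
    using pathsD[OF x, of m] w unfolding path_from_def by auto
qed

lemma V_x_min: "V n x_min = 0"
  by (simp add: V_def x_min_def src_bit_0)

lemma V_x_max: "n \<ge> 1 \<Longrightarrow> V n x_max = 1"
  using k_ge[of n] by (simp add: V_def x_max_def src_bit_def Q_def)

lemma V_update [simp]: "V n (x(n := enc_edge n i b)) = src_bit n i b"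
  by (simp add: V_def)

lemma X_perfect:
  assumes x: "x \<in> X"
  shows "\<exists>y\<in>X. y \<noteq> x \<and> (\<forall>i<n. y i = x i)"
proof -
  let ?N = "Suc n"
  \<comment> \<open>The new path enters the other tower at level n + 1, and \<open>x_min\<close> or
    \<open>x_max\<close> supplies a tail passing through that tower.\<close>
  let ?b = "1 - ebit (x ?N)"
  have "?b \<le> 1" by simp
  obtain w where w: "w \<in> X" "V (Suc ?N) w = ?b"
  proof (cases "?b = 0")
    case True
    then show ?thesis using that[OF x_min_path] V_x_min by simp
  next
    case False
    then have "?b = 1" by simp
    then show ?thesis using that[OF x_max_path] V_x_max[of "Suc ?N"] by simp
  qed
  obtain i where i: "i < Q ?N ?b" "src_bit ?N i ?b = V ?N x"
    using connecting_edge[OF _ V_le \<open>?b \<le> 1\<close>, of ?N ?N x] by auto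
  let ?w = "w(?N := enc_edge ?N i ?b)"
  have "path_from ?N ?w"
    using path_from_update[OF path_from_path[OF w(1)], of i ?N] i(1) unfolding w(2) .
  moreover have "V ?N ?w = V ?N x" unfolding V_update by (rule i(2))
  ultimately have "(\<lambda>m. if m < ?N then x m else ?w m) \<in> X" by (rule splice_path[OF x])
  moreover have "(\<lambda>m. if m < ?N then x m else ?w m) \<noteq> x"
  proof
    assume "(\<lambda>m. if m < ?N then x m else ?w m) = x"
    from fun_cong[OF this, of ?N] have "ebit (enc_edge ?N i ?b) = ebit (x ?N)" by simp
    then have "1 - ebit (x ?N) = ebit (x ?N)" by simp
    then show False using E_D(2)[OF pathsD(1)[OF x, of ?N]] by presburger
  qed
  ultimately show ?thesis by (intro bexI[of _ "\<lambda>m. if m < ?N then x m else ?w m"]) auto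
qed

sublocale cantor_tree X
  using x_min_path coord_finite X_closed X_perfect by unfold_locales auto

lemma T_homeomorphic: "homeomorphic_map (path_topology B) (path_topology B) T"
  unfolding path_topology_eq
proof (rule continuous_imp_homeomorphic_map)
  show "compact_space (seq_topology X)" using coord_finite X_closed by (rule compact_seq_topology)
  show "Hausdorff_space (seq_topology X)" by (rule Hausdorff_seq_topology)
  show "continuous_map (seq_topology X) (seq_topology X) T"
  proof (rule continuous_map_seq_topology)
    fix x n assume x: "x \<in> X"
    have "\<forall>i<n. T y i = T x i" if "y \<in> X" "\<forall>i<Suc n. y i = x i" for y
      using T_local[OF that(1) x, of n] that(2) by simp
    then show "\<exists>m. \<forall>y\<in>X. (\<forall>i<m. y i = x i) \<longrightarrow> (\<forall>i<n. T y i = T x i)" by blast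
  qed (use T_in in blast)
  show "T ` topspace (seq_topology X) = topspace (seq_topology X)" using T_image by simp
  show "inj_on T (topspace (seq_topology X))" using T_inj by simp
qed

text \<open>One free edge at level n suffices to join any prefix to any tail, by
  \<open>connecting_edge\<close>.\<close>

lemma tail_with_prefix:
  assumes x: "x \<in> X" and y: "y \<in> X" and n: "n \<ge> 1"
  shows "\<exists>z\<in>X. (\<forall>i<n. z i = y i) \<and> (\<forall>i>n. z i = x i)"
proof -
  obtain i where i: "i < Q n (V (Suc n) x)" "src_bit n i (V (Suc n) x) = V n y"
    using connecting_edge[OF n V_le V_le] by blast
  let ?w = "x(n := enc_edge n i (V (Suc n) x))"
  have "path_from n ?w" using path_from_update[OF path_from_path[OF x] i(1)] .
  moreover have "V n ?w = V n y" unfolding V_update by (rule i(2))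
  ultimately have "(\<lambda>m. if m < n then y m else ?w m) \<in> X" by (rule splice_path[OF y])
  then show ?thesis by (rule bexI[rotated]) simp
qed

lemma inv_iterate:
  "x \<in> X \<Longrightarrow> (inv_into X T ^^ j) ((T ^^ j) x) = x \<and> (T ^^ j) x \<in> X"
proof (induction j)
  case (Suc j)
  have "(inv_into X T ^^ Suc j) ((T ^^ Suc j) x) = (inv_into X T ^^ j) (inv_into X T (T ((T ^^ j) x)))"
    by (simp add: funpow_swap1)
  then show ?case using Suc T_inj T_in by (simp add: inv_into_f_f)
qed simp

lemma orbit_dense:
  assumes x: "x \<in> X"
  shows "path_topology B closure_of two_sided_orbit (path_topology B) T x = X"
  unfolding path_topology_eq
proof (intro Set.set_eqI iffI)
  fix y assume y: "y \<in> X"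
  show "y \<in> seq_topology X closure_of two_sided_orbit (seq_topology X) T x"
    unfolding in_closure_of topspace_seq_topology
  proof (intro conjI allI impI)
    fix U assume "y \<in> U \<and> openin (seq_topology X) U"
    then obtain n where n: "\<forall>z\<in>X. (\<forall>i<n. z i = y i) \<longrightarrow> z \<in> U"
      unfolding openin_seq_topology by blast
    obtain z where z: "z \<in> X" "\<forall>i<Suc n. z i = y i" "\<forall>i>Suc n. z i = x i"
      using tail_with_prefix[OF x y, of "Suc n"] by auto
    then have "z \<in> U" using n by simp
    moreover have "z \<in> two_sided_orbit (seq_topology X) T x"
    \<comment> \<open>The spliced point shares a tail with x; whether it lies in the future or the
      past of x depends on which position is higher.\<close>
    proof (cases "P (Suc (Suc n)) x \<le> P (Suc (Suc n)) z")
      case True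
      then have "z = (T ^^ (P (Suc (Suc n)) z - P (Suc (Suc n)) x)) x"
        using x z by (intro tail_orbit) auto
      then show ?thesis unfolding two_sided_orbit_def by blast
    next
      case False
      then have "x = (T ^^ (P (Suc (Suc n)) x - P (Suc (Suc n)) z)) z"
        using x z by (intro tail_orbit) auto
      then have "z = (inv_into X T ^^ (P (Suc (Suc n)) x - P (Suc (Suc n)) z)) x"
        using inv_iterate[OF z(1)] by metis
      then show ?thesis unfolding two_sided_orbit_def topspace_seq_topology by blast
    qed
    ultimately show "\<exists>z. z \<in> two_sided_orbit (seq_topology X) T x \<and> z \<in> U" by blast
  qed (use y in simp)
next
  fix y assume "y \<in> seq_topology X closure_of two_sided_orbit (seq_topology X) T x"
  then show "y \<in> X" unfolding in_closure_of by simp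
qed

lemma minimal_B: "minimal_cantor_system (path_topology B) T"
  unfolding minimal_cantor_system_def
  using cantor_space_seq_topology T_homeomorphic orbit_dense by (simp add: path_topology_eq)

lemma finite_rank_B: "finite_topological_rank (path_topology B) T"
proof -
  have "topologically_conjugate (path_topology B) T (path_topology B) T"
    unfolding topologically_conjugate_def by (intro exI[of _ id]) (simp add: homeomorphic_map_id)
  then show ?thesis
    unfolding finite_topological_rank_def bratteli_vershik_representation_def
    using properly_ordered_B simple_B card_verts_B by blast
qed

section \<open>Continuous eigenfunctions\<close>

lemma P_x_min: "P n x_min = 0"
  by (simp add: P_def x_min_def off_0)

lemma x_min_orbit_dense:
  assumes y: "y \<in> X"
  shows "\<exists>j. \<forall>i<n. (T ^^ j) x_min i = y i"
proof -
  obtain z where z: "z \<in> X" "\<forall>i<Suc n. z i = y i" "\<forall>i>Suc n. z i = x_min i"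
    using tail_with_prefix[OF x_min_path y, of "Suc n"] by auto
  then have "z = (T ^^ (P (Suc (Suc n)) z - P (Suc (Suc n)) x_min)) x_min"
    using x_min_path P_x_min by (intro tail_orbit) auto
  then show ?thesis using z(2) by (metis less_SucI)
qed

text \<open>The hypothesis reads \<open>Suc i < n\<close> because the edge at level n - 1 of a
  descended path may enter tower B, unlike that of \<open>x_min\<close>.\<close>

lemma limit_at_x_min:
  assumes f: "continuous_map (seq_topology X) euclidean (f :: _ \<Rightarrow> complex)"
    and s: "\<And>n. n \<ge> 1 \<Longrightarrow> s n \<in> X" "\<And>n i. Suc i < n \<Longrightarrow> s n i = x_min i"
  shows "(\<lambda>n. f (s n)) \<longlonglongrightarrow> f x_min"
proof (rule metric_LIMSEQ_I)
  fix e :: real assume "e > 0"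
  then obtain m where m: "\<forall>y\<in>X. (\<forall>i<m. y i = x_min i) \<longrightarrow> dist (f y) (f x_min) < e"
    using continuous_map_seq_topology_dist[OF f x_min_path] by blast
  have "dist (f (s n)) (f x_min) < e" if "n \<ge> Suc m" for n
    using m s(1)[of n] s(2)[of _ n] that by simp
  then show "\<exists>no. \<forall>n\<ge>no. dist (f (s n)) (f x_min) < e" by blast
qed

text \<open>An eigenvalue satisfies \<open>z ^ h n \<longlonglongrightarrow> 1\<close> because \<open>x_min\<close> runs twice through the first tower, and
  \<open>z ^ (h n + 1) \<longlonglongrightarrow> 1\<close> because the second tower is also traversed twice in a row.\<close>

lemma eigenvalue_trivial:
  assumes f: "continuous_map (seq_topology X) euclidean (f :: _ \<Rightarrow> complex)"
    and eig: "\<And>x. x \<in> X \<Longrightarrow> f (T x) = z * f x" and ne: "f x_min \<noteq> 0"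
  shows "z = 1"
proof -
  have iter: "f ((T ^^ j) x) = z ^ j * f x" if "x \<in> X" for x j
  proof (induction j)
    case (Suc j)
    then show ?case using eig[of "(T ^^ j) x"] inv_iterate[OF that, of j] by simp
  qed simp
  \<comment> \<open>The bottom of the i-th subtower of tower A of level n + 1, continued above like
    \<open>x_min\<close>. All these points tend to \<open>x_min\<close>, and passing from i to i + 1
    takes time \<open>h n\<close> or \<open>h n + 1\<close>.\<close>
  define s where "s i n = descend n (x_min(n := enc_edge n i 0))" for i n
  have s_path: "s i n \<in> X" if "i < Q n 0" for i n
  proof -
    have "path_from n (x_min(n := enc_edge n i 0))"
      using path_from_update[OF path_from_path[OF x_min_path], of i n] that V_x_min by simp
    then show ?thesis unfolding s_def by (rule descend_path)
  qed
  have s_eq: "s i n l = x_min l" if "Suc l < n" for i n l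
    using that by (simp add: s_def descend_def x_min_def)
  have s_tail: "s i n l = x_min l" if "l > n" for i n l
    using that by (simp add: s_def)
  have s_P: "P (Suc n) (s i n) = off n i 0" for i n
    using P_descend by (simp add: P_Suc s_def)
  have jump: "f (s (Suc i) n) = z ^ (h n + src_bit n i 0) * f (s i n)" if "Suc i < Q n 0" for i n
  proof -
    have "s (Suc i) n = (T ^^ (P (Suc n) (s (Suc i) n) - P (Suc n) (s i n))) (s i n)"
      using s_path that s_tail by (intro tail_orbit) (auto simp: s_P off_Suc)
    moreover have "P (Suc n) (s (Suc i) n) - P (Suc n) (s i n) = h n + src_bit n i 0"
      unfolding s_P off_Suc by simp
    ultimately show ?thesis using iter[OF s_path[of i n]] that by simp
  qed
  have Q: "Suc (a n) < Q n 0" if "n \<ge> 1" for n using k_ge[OF that] that by (simp add: Q_def)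
  have Q': "1 < Q n 0" if "n \<ge> 1" for n using Q[OF that] a_ge[OF that] by simp
  have lim: "(\<lambda>n. f (s (i n) n)) \<longlonglongrightarrow> f x_min" if "\<And>n. n \<ge> 1 \<Longrightarrow> i n < Q n 0" for i
    using s_path that s_eq by (intro limit_at_x_min[OF f]) auto
  have A: "(\<lambda>n. f (s 1 n)) \<longlonglongrightarrow> f x_min" "(\<lambda>n. f (s 0 n)) \<longlonglongrightarrow> f x_min"
    using lim[of "\<lambda>_. 1"] lim[of "\<lambda>_. 0"] Q' Q_pos by auto
  have Bl: "(\<lambda>n. f (s (Suc (a n)) n)) \<longlonglongrightarrow> f x_min" "(\<lambda>n. f (s (a n) n)) \<longlonglongrightarrow> f x_min"
    using lim[of "\<lambda>n. Suc (a n)"] lim[of a] Q Suc_lessD by auto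
  have L1: "(\<lambda>n. z * f (s 1 n) * f (s (a n) n)) \<longlonglongrightarrow> z * f x_min * f x_min"
    by (intro tendsto_intros A Bl)
  \<comment> \<open>Multiplying the two return equations crosswise eliminates the power
    \<open>z ^ h n\<close> and leaves a single factor z to compare in the limit.\<close>
  have ev: "\<forall>\<^sub>F n in sequentially. f (s (Suc (a n)) n) * f (s 0 n) = z * f (s 1 n) * f (s (a n) n)"
    unfolding eventually_sequentially
  proof (intro exI allI impI)
    fix n :: nat assume n: "1 \<le> n"
    have "f (s 1 n) = z ^ h n * f (s 0 n)"
      using jump[of 0 n] Q'[OF n] src_bit_0[of 0 n] by simp
    moreover have "f (s (Suc (a n)) n) = z ^ (h n + 1) * f (s (a n) n)"
      using jump[OF Q[OF n]] by (simp add: src_bit_def)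
    ultimately show "f (s (Suc (a n)) n) * f (s 0 n) = z * f (s 1 n) * f (s (a n) n)" by simp
  qed
  have "(\<lambda>n. f (s (Suc (a n)) n) * f (s 0 n)) \<longlonglongrightarrow> f x_min * f x_min"
    by (intro tendsto_intros A Bl)
  from LIMSEQ_unique[OF L1 Lim_transform_eventually[OF this ev]]
  have "z * f x_min * f x_min = f x_min * f x_min" .
  then show ?thesis using ne by simp
qed

lemma weakly_mixing_B: "topologically_weakly_mixing (path_topology B) T"
  unfolding topologically_weakly_mixing_def path_topology_eq topspace_seq_topology
proof
  assume "\<exists>f :: _ \<Rightarrow> complex. continuous_map (seq_topology X) euclidean f \<and>
     \<not> (\<exists>c. \<forall>x\<in>X. f x = c) \<and> (\<exists>z. \<forall>x\<in>X. f (T x) = z * f x)"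
  then obtain f :: "_ \<Rightarrow> complex" and z where
    f: "continuous_map (seq_topology X) euclidean f" and nc: "\<not> (\<exists>c. \<forall>x\<in>X. f x = c)"
    and eig: "\<And>x. x \<in> X \<Longrightarrow> f (T x) = z * f x"
    by blast
  \<comment> \<open>Either f vanishes at \<open>x_min\<close> or z = 1; in both cases f is constant
    along the dense forward orbit of \<open>x_min\<close>.\<close>
  have z: "z * f x_min = f x_min" using eigenvalue_trivial[OF f eig] by (cases "f x_min = 0") auto
  have orbit: "f ((T ^^ j) x_min) = f x_min" for j
  proof (induction j)
    case (Suc j)
    then show ?case using eig[of "(T ^^ j) x_min"] inv_iterate[OF x_min_path, of j] z by simp
  qed simp
  have "f y = f x_min" if y: "y \<in> X" for y
  proof (rule ccontr)
    assume "f y \<noteq> f x_min"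
    then have "dist (f x_min) (f y) > 0" by simp
    then obtain n where n: "\<forall>x\<in>X. (\<forall>i<n. x i = y i) \<longrightarrow> dist (f x) (f y) < dist (f x_min) (f y)"
      using continuous_map_seq_topology_dist[OF f y] by blast
    obtain j where "\<forall>i<n. (T ^^ j) x_min i = y i" using x_min_orbit_dense[OF y] by blast
    then have "dist (f ((T ^^ j) x_min)) (f y) < dist (f x_min) (f y)"
      using n inv_iterate[OF x_min_path, of j] by blast
    then show False unfolding orbit by simp
  qed
  with nc show False by blast
qed

section \<open>Unique ergodicity\<close>

abbreviation cyl :: "nat \<Rightarrow> (nat \<Rightarrow> nat) \<Rightarrow> (nat \<Rightarrow> nat) set" where "cyl \<equiv> path_cylinder B"

definition cyls :: "(nat \<Rightarrow> nat) set set" where "cyls = {cyl n p |n p. p \<in> X}"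

lemma mem_cyl: "x \<in> cyl n p \<longleftrightarrow> x \<in> X \<and> (\<forall>i<n. x i = p i)"
  by (simp add: path_cylinder_def)

lemma cyl_subset: "cyl n p \<subseteq> X"
  by (auto simp: mem_cyl)

lemma cyl_0: "cyl 0 p = X"
  by (auto simp: mem_cyl)

lemma cyl_cong: "(\<And>i. i < n \<Longrightarrow> p i = q i) \<Longrightarrow> cyl n p = cyl n q"
  by (auto simp: path_cylinder_def)

lemma cyl_mono: "q \<in> cyl n p \<Longrightarrow> n \<le> m \<Longrightarrow> cyl m q \<subseteq> cyl n p"
  by (auto simp: mem_cyl)

lemma countable_cyls: "countable cyls"
proof -
  have "cyls \<subseteq> (\<Union>n. cyl n ` (Pi\<^sub>E {..<n} E))"
  proof
    fix c assume "c \<in> cyls"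
    then obtain n p where c: "c = cyl n p" "p \<in> X" unfolding cyls_def by blast
    have "restrict p {..<n} \<in> Pi\<^sub>E {..<n} E" using pathsD(1)[OF c(2)] by auto
    moreover have "c = cyl n (restrict p {..<n})" unfolding c(1) by (rule cyl_cong) simp
    ultimately show "c \<in> (\<Union>n. cyl n ` (Pi\<^sub>E {..<n} E))" by blast
  qed
  moreover have "countable (\<Union>n. cyl n ` (Pi\<^sub>E {..<n} E))"
    by (intro countable_UN countableI_type countable_image countable_finite finite_PiE E_finite finite_lessThan)
  ultimately show ?thesis by (rule countable_subset)
qed

lemma openin_path_topology:
  "openin (path_topology B) U \<longleftrightarrow> U \<subseteq> X \<and> (\<forall>x\<in>U. \<exists>n. cyl n x \<subseteq> U)"
  unfolding path_topology_eq openin_seq_topology by (simp add: path_cylinder_def subset_iff Ball_def imp_conjL)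

lemma openin_cyl: "openin (path_topology B) (cyl n p)"
  unfolding openin_path_topology using cyl_subset cyl_mono by blast

lemma borel_eq: "sigma_sets X {U. openin (path_topology B) U} = sigma_sets X cyls"
proof (rule sigma_sets_eqI)
  fix U assume "U \<in> {U. openin (path_topology B) U}"
  then have U: "U \<subseteq> X" "\<forall>x\<in>U. \<exists>n. cyl n x \<subseteq> U" unfolding openin_path_topology by auto
  have "U = \<Union>{c \<in> cyls. c \<subseteq> U}"
  proof
    show "U \<subseteq> \<Union>{c \<in> cyls. c \<subseteq> U}"
    proof
      fix x assume x: "x \<in> U"
      then obtain n where "cyl n x \<subseteq> U" using U by blast
      moreover have "x \<in> cyl n x" "cyl n x \<in> cyls" using x U(1) by (auto simp: mem_cyl cyls_def)
      ultimately show "x \<in> \<Union>{c \<in> cyls. c \<subseteq> U}" by blast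
    qed
  qed blast
  moreover have "\<Union>{c \<in> cyls. c \<subseteq> U} \<in> sigma_sets X cyls"
    by (rule sigma_sets_UNION) (auto intro: countable_subset[OF _ countable_cyls])
  ultimately show "U \<in> sigma_sets X cyls" by metis
next
  fix c assume "c \<in> cyls"
  then have "openin (path_topology B) c" unfolding cyls_def using openin_cyl by blast
  then show "c \<in> sigma_sets X {U. openin (path_topology B) U}" by (intro sigma_sets.Basic) simp
qed

text \<open>The last edge of a prefix records the tower it enters; for the empty prefix there is
  only the root.\<close>

lemma V_cyl: "x \<in> X \<Longrightarrow> y \<in> X \<Longrightarrow> (\<And>i. i < n \<Longrightarrow> x i = y i) \<Longrightarrow> V n x = V n y"
  using V_0 pathsD(2)[of x "n - 1"] pathsD(2)[of y "n - 1"] by (cases n) auto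

text \<open>Splicing the prefix of x onto the tail of y reduces this to \<open>P_inj\<close>: tower
  and floor together code a prefix.\<close>

lemma prefix_unique:
  assumes "x \<in> X" "y \<in> X" "V n x = V n y" "P n x = P n y" "i < n"
  shows "x i = y i"
proof -
  let ?z = "\<lambda>m. if m < n then x m else y m"
  have "?z \<in> X" using assms(1-3) by (intro splice_path path_from_path) auto
  moreover have "P n ?z = P n x" by (rule P_cong) simp
  ultimately have "?z = y" using assms(2,4) by (intro P_inj[of _ _ n]) auto
  from fun_cong[OF this, of i] assms(5) show ?thesis by simp
qed

text \<open>Cylinders of length n are the floors of the towers of level n, and the Vershik map
  carries each floor onto the next one of the same tower.\<close>

lemma T_preimage_cyl:
  assumes p: "p \<in> X" and p': "p' \<in> X" and V: "V n p = V n p'" and P: "P n p' = Suc (P n p)"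
  shows "T -` cyl n p' \<inter> X = cyl n p"
proof (rule Set.set_eqI, rule iffI)
  fix x assume "x \<in> T -` cyl n p' \<inter> X"
  then have x: "x \<in> X" "T x \<in> X" "\<And>i. i < n \<Longrightarrow> T x i = p' i" by (auto simp: mem_cyl)
  have PT: "P n (T x) = P n p'" using x(3) by (rule P_cong)
  then have "0 < P n (T x)" using P by simp
  then obtain u where u: "u \<in> X" "T u = T x" "\<forall>i\<ge>n. u i = T x i" "Suc (P n u) = P n (T x)"
    using T_predecessor[OF x(2), of n] by blast
  have "u = x" using inj_onD[OF T_inj u(2) u(1) x(1)] .
  then have "P n x = P n p" using u(4) PT P by simp
  moreover have "V n x = V n p"
    using V_cong[of x n "T x"] u(3) \<open>u = x\<close> V_cyl[OF x(2) p' x(3)] V by simp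
  ultimately show "x \<in> cyl n p" using prefix_unique[OF x(1) p] x(1) by (auto simp: mem_cyl)
next
  fix x assume "x \<in> cyl n p"
  then have x: "x \<in> X" "\<And>i. i < n \<Longrightarrow> x i = p i" by (auto simp: mem_cyl)
  have Px: "P n x = P n p" using x(2) by (rule P_cong)
  have Vx: "V n x = V n p" by (rule V_cyl[OF x(1) p x(2)])
  have "Suc (P n x) < h n + V n x" using P_less[OF p', of n] P Px Vx V by simp
  note t = T_tower[OF x(1) this]
  have "V n (T x) = V n p'" using V_cong[of "T x" n x] t(3)[of n] Vx V by simp
  moreover have "P n (T x) = P n p'" using t(2) Px P by simp
  ultimately have "T x i = p' i" if "i < n" for i using prefix_unique[OF t(1) p' _ _ that] by blast
  then show "x \<in> T -` cyl n p' \<inter> X" using x(1) t(1) by (simp add: mem_cyl)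
qed

definition base :: "nat \<Rightarrow> nat \<Rightarrow> nat \<Rightarrow> nat" where
  "base n b = descend n (if b = 0 then x_min else x_max)"

lemma base_path: "base n b \<in> X"
  unfolding base_def using x_min_path x_max_path by (intro descend_path path_from_path) simp

lemma P_base: "P n (base n b) = 0"
  unfolding base_def by (rule P_descend)

lemma V_base: "n \<ge> 1 \<Longrightarrow> b \<le> 1 \<Longrightarrow> V n (base n b) = b"
proof -
  assume "n \<ge> 1" "b \<le> 1"
  then have "V n (if b = 0 then x_min else x_max) = b" using V_x_min V_x_max by auto
  moreover have "V n (base n b) = V n (if b = 0 then x_min else x_max)"
    unfolding base_def by (rule V_cong) simp
  ultimately show ?thesis by simp
qed

lemma V_base_V: "p \<in> X \<Longrightarrow> V n (base n (V n p)) = V n p"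
  using V_base[of n "V n p"] V_le[of n p] V_0[OF base_path] V_0[of p] by (cases "n = 0") auto

section \<open>Floor masses and uniqueness of the measure\<close>

definition mass :: "(nat \<Rightarrow> nat) measure \<Rightarrow> nat \<Rightarrow> nat \<Rightarrow> real" where
  "mass \<mu> n b = measure \<mu> (cyl n (base n b))"

text \<open>All floors of one tower have the same mass. This turns invariance, to which it is
  equivalent by \<open>invariant_iff_tower_measure\<close>, into linear recursions for two numbers
  per level.\<close>

definition tower_measure :: "(nat \<Rightarrow> nat) measure \<Rightarrow> bool" where
  "tower_measure \<mu> \<longleftrightarrow> space \<mu> = X \<and> sets \<mu> = sigma_sets X cyls \<and> prob_space \<mu> \<and>
     (\<forall>n. \<forall>p\<in>X. measure \<mu> (cyl n p) = mass \<mu> n (V n p))"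

lemma invariant_imp_tower_measure:
  assumes "invariant_borel_prob (path_topology B) T \<mu>"
  shows "tower_measure \<mu>"
proof -
  have inv: "space \<mu> = X" "sets \<mu> = sigma_sets X cyls" "prob_space \<mu>" "T \<in> measurable \<mu> \<mu>" "distr \<mu> \<mu> T = \<mu>"
    using assms unfolding invariant_borel_prob_def path_topology_eq topspace_seq_topology
    by (simp_all add: borel_eq[unfolded path_topology_eq])
  have meas: "cyl n p \<in> sets \<mu>" if "p \<in> X" for n p
    unfolding inv(2) cyls_def using that by (intro sigma_sets.Basic) blast
  have "measure \<mu> (cyl n p) = mass \<mu> n (V n p)" if "p \<in> X" for n p
    using that
  proof (induction "P n p" arbitrary: p)
    case 0
    then have "base n (V n p) i = p i" if "i < n" for i
      using prefix_unique[OF base_path 0(2) V_base_V[OF 0(2)] _ that] P_base by simp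
    then have "cyl n (base n (V n p)) = cyl n p" by (rule cyl_cong)
    then show ?case unfolding mass_def by simp
  next
    case (Suc j)
    then obtain u where u: "u \<in> X" "\<forall>i\<ge>n. u i = p i" "Suc (P n u) = P n p"
      using T_predecessor[OF Suc.prems, of n] by (metis zero_less_Suc)
    have V: "V n u = V n p" using u(2) by (intro V_cong) simp
    have "measure \<mu> (cyl n p) = measure (distr \<mu> \<mu> T) (cyl n p)" by (simp only: inv(5))
    also have "\<dots> = measure \<mu> (T -` cyl n p \<inter> X)"
      using measure_distr[OF inv(4) meas[OF Suc.prems]] inv(1) by simp
    also have "\<dots> = measure \<mu> (cyl n u)"
      using T_preimage_cyl[OF u(1) Suc.prems V] u(3) by simp
    also have "\<dots> = mass \<mu> n (V n u)" using Suc.hyps u by simp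
    finally show ?case unfolding V .
  qed
  then show ?thesis unfolding tower_measure_def using inv by blast
qed

lemma extend_path:
  assumes p: "p \<in> X" and b: "b \<le> 1" "i < Q n b" "src_bit n i b = V n p"
  shows "\<exists>z\<in>X. (\<forall>m<n. z m = p m) \<and> z n = enc_edge n i b"
proof -
  let ?w = "(base (Suc n) b)(n := enc_edge n i b)"
  have "path_from n ?w"
    using path_from_update[OF path_from_path[OF base_path], of i n "Suc n" b] b V_base[of "Suc n" b] by simp
  moreover have "V n ?w = V n p" using b(3) by simp
  ultimately have "(\<lambda>m. if m < n then p m else ?w m) \<in> X" by (rule splice_path[OF p])
  then show ?thesis by (rule bexI[rotated]) simp
qed

text \<open>A floor of level n is the disjoint union of one floor of level n + 1 for each edge
  leaving its tower.\<close>

lemma mass_split: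
  assumes \<mu>: "tower_measure \<mu>" and p: "p \<in> X"
  shows "mass \<mu> n (V n p) = (\<Sum>b\<le>1. card {i. i < Q n b \<and> src_bit n i b = V n p} * mass \<mu> (Suc n) b)"
proof -
  interpret prob_space \<mu> using \<mu> unfolding tower_measure_def by blast
  have meas: "cyl n p \<in> sets \<mu>" if "p \<in> X" for n p
    using \<mu> that unfolding tower_measure_def cyls_def by (auto intro: sigma_sets.Basic)
  have val: "measure \<mu> (cyl n p) = mass \<mu> n (V n p)" if "p \<in> X" for n p
    using \<mu> that unfolding tower_measure_def by blast
  let ?I = "SIGMA b:{..1}. {i. i < Q n b \<and> src_bit n i b = V n p}"
  let ?A = "\<lambda>(b, i). {x \<in> cyl n p. x n = enc_edge n i b}"
  have A: "?A (b, i) \<in> sets \<mu> \<and> measure \<mu> (?A (b, i)) = mass \<mu> (Suc n) b" if "(b, i) \<in> ?I" for b i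
  proof -
    from that have "b \<le> 1" "i < Q n b" "src_bit n i b = V n p" by auto
    from extend_path[OF p this]
    obtain z where z: "z \<in> X" "\<forall>m<n. z m = p m" "z n = enc_edge n i b" by blast
    have "?A (b, i) = cyl (Suc n) z" using z by (auto simp: mem_cyl less_Suc_eq)
    moreover have "V (Suc n) z = b" using pathsD(2)[OF z(1), of n] z(3) by simp
    ultimately show ?thesis using meas[OF z(1)] val[OF z(1)] by simp
  qed
  have fin: "finite ?I" by auto
  have "cyl n p = (\<Union>k\<in>?I. ?A k)"
  proof
    show "cyl n p \<subseteq> (\<Union>k\<in>?I. ?A k)"
    proof
      fix x assume x: "x \<in> cyl n p"
      then have xX: "x \<in> X" "\<And>i. i < n \<Longrightarrow> x i = p i" by (auto simp: mem_cyl)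
      have "V n x = V n p" by (rule V_cyl[OF xX(1) p xX(2)])
      then have "(ebit (x n), idx (x n)) \<in> ?I"
        using E_D(2,3)[OF pathsD(1)[OF xX(1), of n]] by (simp add: V_def)
      moreover have "x \<in> ?A (ebit (x n), idx (x n))"
        using x enc_edge_collapse[of "x n"] E_D(1)[OF pathsD(1)[OF xX(1), of n]] by simp
      ultimately show "x \<in> (\<Union>k\<in>?I. ?A k)" by blast
    qed
  qed auto
  then have "mass \<mu> n (V n p) = measure \<mu> (\<Union>k\<in>?I. ?A k)" using val[OF p] by simp
  also have "\<dots> = (\<Sum>k\<in>?I. measure \<mu> (?A k))"
  proof (rule finite_measure_finite_Union[OF fin])
    show "?A ` ?I \<subseteq> sets \<mu>" using A by blast
    show "disjoint_family_on ?A ?I"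
      unfolding disjoint_family_on_def by (auto dest: arg_cong[where f = idx] arg_cong[where f = ebit])
  qed
  also have "\<dots> = (\<Sum>k\<in>?I. mass \<mu> (Suc n) (fst k))"
    using A by (intro sum.cong) auto
  also have "\<dots> = (\<Sum>b\<le>1. \<Sum>i\<in>{i. i < Q n b \<and> src_bit n i b = V n p}. mass \<mu> (Suc n) b)"
    by (subst sum.Sigma) (auto simp: case_prod_unfold)
  also have "\<dots> = (\<Sum>b\<le>1. card {i. i < Q n b \<and> src_bit n i b = V n p} * mass \<mu> (Suc n) b)"
    by simp
  finally show ?thesis .
qed

lemma card_src_bit_1:
  assumes "n \<ge> 1" "b \<le> 1"
  shows "card {i. i < Q n b \<and> src_bit n i b = 1} = k n + b"
proof -
  have "{i. i < Q n b \<and> src_bit n i b = 1} = {a n - b..<Q n b}"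
    by (auto simp: src_bit_def)
  then show ?thesis using assms a_ge_2[of n] by (simp add: Q_def)
qed

lemma card_src_bit_0:
  assumes "n \<ge> 1" "b \<le> 1"
  shows "card {i. i < Q n b \<and> src_bit n i b = 0} = a n - b"
proof -
  have "{i. i < Q n b \<and> src_bit n i b = 0} = {..<a n - b}"
    using assms(1) by (auto simp: src_bit_def Q_def split: if_splits)
  then show ?thesis by simp
qed

lemma mass_rec:
  assumes \<mu>: "tower_measure \<mu>" and n: "n \<ge> 1"
  shows "mass \<mu> n 0 = a n * mass \<mu> (Suc n) 0 + (a n - 1) * mass \<mu> (Suc n) 1"
    and "mass \<mu> n 1 = k n * mass \<mu> (Suc n) 0 + (k n + 1) * mass \<mu> (Suc n) 1"
proof -
  have s: "mass \<mu> n c = (\<Sum>b\<le>1. card {i. i < Q n b \<and> src_bit n i b = c} * mass \<mu> (Suc n) b)"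
    if "c \<le> 1" for c
    using mass_split[OF \<mu> base_path[of n c], of n] V_base[OF n that] by simp
  have set2: "{..1::nat} = {0, 1}" by auto
  show "mass \<mu> n 0 = a n * mass \<mu> (Suc n) 0 + (a n - 1) * mass \<mu> (Suc n) 1"
    unfolding s[OF zero_le_one] set2 using card_src_bit_0[OF n] by simp
  show "mass \<mu> n 1 = k n * mass \<mu> (Suc n) 0 + (k n + 1) * mass \<mu> (Suc n) 1"
    unfolding s[OF order_refl] set2 using card_src_bit_1[OF n] by simp
qed

lemma mass_total:
  assumes \<mu>: "tower_measure \<mu>"
  shows "1 = mass \<mu> 1 0 + 2 * mass \<mu> 1 1"
proof -
  interpret prob_space \<mu> using \<mu> unfolding tower_measure_def by blast
  have "mass \<mu> 0 0 = 1"
    unfolding mass_def cyl_0 using \<mu> prob_space unfolding tower_measure_def by simp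
  moreover have "mass \<mu> 0 0 = (\<Sum>b\<le>1. card {i. i < Q 0 b \<and> src_bit 0 i b = 0} * mass \<mu> (Suc 0) b)"
    using mass_split[OF \<mu> x_min_path, of 0] V_x_min by simp
  moreover have "{i. i < Q 0 b \<and> src_bit 0 i b = 0} = {..<1+b}" if "b \<le> 1" for b
    using that by (auto simp: src_bit_def Q_def a_0)
  moreover have "{..1::nat} = {0, 1}" by auto
  ultimately show ?thesis by simp
qed

lemma mass_nonneg: "0 \<le> mass \<mu> n b"
  by (simp add: mass_def)

text \<open>Adding the two recursions works because both towers have \<open>a n + k n\<close>
  subtowers; the resulting factor does not depend on the measure.\<close>

lemma mass_sum:
  assumes "tower_measure \<mu>" "n \<ge> 1"
  shows "mass \<mu> n 0 + mass \<mu> n 1 = (a n + k n) * (mass \<mu> (Suc n) 0 + mass \<mu> (Suc n) 1)"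
proof -
  have "real (a n - 1) = real (a n) - 1" using a_ge[OF assms(2)] by simp
  then show ?thesis unfolding mass_rec(1)[OF assms] mass_rec(2)[OF assms] by (simp add: algebra_simps)
qed

lemma mass_tendsto:
  assumes \<mu>: "tower_measure \<mu>" and b: "b \<le> 1"
  shows "(\<lambda>n. mass \<mu> n b) \<longlonglongrightarrow> 0"
proof -
  let ?s = "\<lambda>n. mass \<mu> (Suc n) 0 + mass \<mu> (Suc n) 1"
  have half: "?s n \<le> ?s 0 * (1/2) ^ n" for n
  proof (induction n)
    case (Suc n)
    have "2 * ?s (Suc n) \<le> real (a (Suc n) + k (Suc n)) * ?s (Suc n)"
      using a_ge[of "Suc n"] mass_nonneg by (intro mult_right_mono add_nonneg_nonneg) auto
    also have "\<dots> = ?s n" using mass_sum[OF \<mu>, of "Suc n"] by simp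
    finally show ?case using Suc by simp
  qed simp
  have "(\<lambda>n. mass \<mu> (Suc n) b) \<longlonglongrightarrow> 0"
  proof (rule tendsto_sandwich[OF _ _ tendsto_const])
    show "\<forall>\<^sub>F n in sequentially. 0 \<le> mass \<mu> (Suc n) b" using mass_nonneg by simp
    have "b = 0 \<or> b = 1" using b by linarith
    then have "mass \<mu> (Suc n) b \<le> ?s 0 * (1/2) ^ n" for n
      using half[of n] mass_nonneg[of \<mu> "Suc n" 0] mass_nonneg[of \<mu> "Suc n" 1] by auto
    then show "\<forall>\<^sub>F n in sequentially. mass \<mu> (Suc n) b \<le> ?s 0 * (1/2) ^ n" by simp
    show "(\<lambda>n. ?s 0 * (1/2) ^ n) \<longlonglongrightarrow> 0"
      by (intro tendsto_mult_right_zero LIMSEQ_realpow_zero) auto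
  qed
  then show ?thesis by (rule LIMSEQ_imp_Suc)
qed

text \<open>By \<open>mass_sum\<close> the total base masses s and t of the two measures are
  proportional. The mass of base B drops by k times the next total, so the differences D, scaled
  crosswise by s 1 and t 1, do not change with the level; being null sequences they vanish. Total
  mass 1 at level 1 then fixes the proportionality factor.\<close>

lemma mass_unique:
  assumes \<mu>: "tower_measure \<mu>" and \<nu>: "tower_measure \<nu>" and n: "n \<ge> 1"
  shows "mass \<mu> n 0 = mass \<nu> n 0 \<and> mass \<mu> n 1 = mass \<nu> n 1"
proof -
  define s where "s n = mass \<mu> n 0 + mass \<mu> n 1" for n
  define t where "t n = mass \<nu> n 0 + mass \<nu> n 1" for n
  have qpos: "real (a n + k n) > 0" if "n \<ge> 1" for n using a_ge[OF that] by simp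
  have ratio: "t 1 * s (Suc n) = s 1 * t (Suc n)" for n
  proof (induction n)
    case (Suc n)
    let ?q = "real (a (Suc n) + k (Suc n))"
    have "?q * s (Suc (Suc n)) = s (Suc n)"
      using mass_sum[OF \<mu>, of "Suc n"] unfolding s_def by simp
    moreover have "?q * t (Suc (Suc n)) = t (Suc n)"
      using mass_sum[OF \<nu>, of "Suc n"] unfolding t_def by simp
    ultimately have "?q * (t 1 * s (Suc (Suc n))) = ?q * (s 1 * t (Suc (Suc n)))"
      using Suc by (metis mult.left_commute)
    moreover have "?q \<noteq> 0" using qpos[of "Suc n"] by simp
    ultimately show ?case using mult_left_cancel by blast
  qed simp
  define D where "D n = t 1 * mass \<mu> (Suc n) 1 - s 1 * mass \<nu> (Suc n) 1" for n
  have "D (Suc n) = D n" for n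
  proof -
    have "mass \<mu> (Suc n) 1 = k (Suc n) * s (Suc (Suc n)) + mass \<mu> (Suc (Suc n)) 1"
      using mass_rec(2)[OF \<mu>, of "Suc n"] unfolding s_def by (simp add: algebra_simps)
    moreover have "mass \<nu> (Suc n) 1 = k (Suc n) * t (Suc (Suc n)) + mass \<nu> (Suc (Suc n)) 1"
      using mass_rec(2)[OF \<nu>, of "Suc n"] unfolding t_def by (simp add: algebra_simps)
    ultimately have "D n = k (Suc n) * (t 1 * s (Suc (Suc n)) - s 1 * t (Suc (Suc n))) + D (Suc n)"
      unfolding D_def by (simp add: algebra_simps)
    then show ?thesis using ratio[of "Suc n"] by simp
  qed
  then have Dc: "D n = D 0" for n by (induction n) auto
  have "D \<longlonglongrightarrow> t 1 * 0 - s 1 * 0" unfolding D_def[abs_def]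
    by (intro tendsto_intros LIMSEQ_Suc mass_tendsto \<mu> \<nu>) auto
  moreover have "D = (\<lambda>_. D 0)" using Dc by blast
  ultimately have "(\<lambda>_::nat. D 0) \<longlonglongrightarrow> 0" by (metis diff_zero mult_zero_right)
  then have "D 0 = 0" by (simp add: LIMSEQ_const_iff)
  then have D0: "D n = 0" for n using Dc by simp
  have total: "1 = s 1 + mass \<mu> 1 1" "1 = t 1 + mass \<nu> 1 1"
    using mass_total[OF \<mu>] mass_total[OF \<nu>] unfolding s_def t_def by simp_all
  have "1 - s 1 = mass \<mu> 1 1" "1 - t 1 = mass \<nu> 1 1" using total by linarith+
  then have "t 1 * (1 - s 1) = s 1 * (1 - t 1)" using D0[of 0] unfolding D_def by simp
  then have st: "s 1 = t 1" by (simp add: algebra_simps)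
  have "mass \<mu> 1 1 \<le> s 1" unfolding s_def using mass_nonneg by simp
  then have pos: "s 1 > 0" using total(1) by linarith
  obtain m where m: "n = Suc m" using n by (metis Suc_le_D One_nat_def)
  have "s n = t n" using ratio[of m] st pos m by simp
  moreover have "mass \<mu> n 1 = mass \<nu> n 1" using D0[of m] st pos m unfolding D_def by simp
  ultimately show ?thesis unfolding s_def t_def by simp
qed

lemma Int_stable_cyls: "Int_stable (insert {} cyls)"
proof (rule Int_stableI)
  have *: "cyl n p \<inter> cyl m q \<in> insert {} cyls" if "n \<le> m" "p \<in> X" "q \<in> X" for n m p q
  proof (cases "cyl n p \<inter> cyl m q = {}")
    case False
    then obtain r where r: "r \<in> cyl n p" "r \<in> cyl m q" by blast
    have "cyl m q \<subseteq> cyl n p" using that(1) r by (auto simp: mem_cyl)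
    then show ?thesis using that(3) unfolding cyls_def by (metis (mono_tags, lifting) inf.absorb2 insertCI mem_Collect_eq)
  qed simp
  fix c d assume cd: "c \<in> insert {} cyls" "d \<in> insert {} cyls"
  show "c \<inter> d \<in> insert {} cyls"
  proof (cases "c = {} \<or> d = {}")
    case False
    then obtain n p m q where "c = cyl n p" "p \<in> X" "d = cyl m q" "q \<in> X"
      using cd unfolding cyls_def by blast
    then show ?thesis using *[of n m p q] *[of m n q p] by (cases "n \<le> m") (auto simp: Int_commute)
  qed auto
qed

lemma sigma_insert_cyls: "sigma_sets X (insert {} cyls) = sigma_sets X cyls"
  by (rule sigma_sets_eqI) (auto intro: sigma_sets.Empty sigma_sets.Basic)

lemma cyls_Pow: "insert {} cyls \<subseteq> Pow X"
  unfolding cyls_def using cyl_subset by blast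

lemma tower_measure_unique:
  assumes \<mu>: "tower_measure \<mu>" and \<nu>: "tower_measure \<nu>"
  shows "\<mu> = \<nu>"
proof (rule measure_eqI_generator_eq[OF Int_stable_cyls cyls_Pow])
  interpret M: prob_space \<mu> using \<mu> unfolding tower_measure_def by blast
  interpret N: prob_space \<nu> using \<nu> unfolding tower_measure_def by blast
  show "sets \<mu> = sigma_sets X (insert {} cyls)" "sets \<nu> = sigma_sets X (insert {} cyls)"
    unfolding sigma_insert_cyls using \<mu> \<nu> unfolding tower_measure_def by blast+
  have "X \<in> insert {} cyls" unfolding cyls_def using cyl_0 x_min_path by blast
  then show "range (\<lambda>_::nat. X) \<subseteq> insert {} cyls" by blast
  show "(\<Union>i::nat. X) = X" by simp
  show "emeasure \<mu> X \<noteq> \<infinity>" by simp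
  fix c assume c: "c \<in> insert {} cyls"
  show "emeasure \<mu> c = emeasure \<nu> c"
  proof (cases "c = {}")
    case False
    then obtain n p where np: "c = cyl n p" "p \<in> X" using c unfolding cyls_def by blast
    have "measure \<mu> c = measure \<nu> c"
    proof (cases "n = 0")
      case True
      then show ?thesis unfolding np(1) True cyl_0
        using \<mu> \<nu> M.prob_space N.prob_space unfolding tower_measure_def by simp
    next
      case False
      have "V n p = 0 \<or> V n p = 1" using V_le[of n p] by linarith
      then have "mass \<mu> n (V n p) = mass \<nu> n (V n p)"
        using mass_unique[OF \<mu> \<nu>, of n] False by auto
      then show ?thesis unfolding np(1) using \<mu> \<nu> np(2) unfolding tower_measure_def by simp
    qed
    then show ?thesis unfolding M.emeasure_eq_measure N.emeasure_eq_measure by simp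
  qed simp
qed

section \<open>Equal floor masses imply invariance\<close>

lemma T_measurable:
  assumes \<mu>: "tower_measure \<mu>"
  shows "T \<in> measurable \<mu> \<mu>"
proof -
  have sp: "space \<mu> = X" "sets \<mu> = sigma_sets X {U. openin (path_topology B) U}"
    using \<mu> unfolding tower_measure_def borel_eq by blast+
  have "T \<in> measurable \<mu> (measure_of X {U. openin (path_topology B) U} (\<lambda>_. 0))"
  proof (rule measurable_measure_of)
    show "{U. openin (path_topology B) U} \<subseteq> Pow X" unfolding openin_path_topology by blast
    show "T \<in> space \<mu> \<rightarrow> X" using sp T_in by auto
    fix U assume "U \<in> {U. openin (path_topology B) U}"
    then have "openin (path_topology B) {x \<in> topspace (path_topology B). T x \<in> U}"
      using T_homeomorphic by (intro openin_continuous_map_preimage homeomorphic_imp_continuous_map) auto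
    moreover have "{x \<in> topspace (path_topology B). T x \<in> U} = T -` U \<inter> space \<mu>"
      unfolding path_topology_eq sp(1) by auto
    ultimately show "T -` U \<inter> space \<mu> \<in> sets \<mu>" unfolding sp(2) by (intro sigma_sets.Basic) simp
  qed
  moreover have "sets (measure_of X {U. openin (path_topology B) U} (\<lambda>_. 0)) = sets \<mu>"
    unfolding sp(2) by (rule sets_measure_of) (auto simp: openin_path_topology)
  ultimately show ?thesis using measurable_cong_sets by blast
qed

text \<open>The preimage under \<open>T\<close> of a cylinder around \<open>x_min\<close> is not a cylinder, so invariance is checked on the
  remaining cylinders and on the null set \<open>{x_min}\<close>.\<close>

definition high_cyls :: "(nat \<Rightarrow> nat) set set" where
  "high_cyls = {cyl n p |n p. p \<in> X \<and> 0 < P n p}"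

lemma x_min_cylI: "x_min \<in> cyl n p \<Longrightarrow> P n p = 0"
  using P_cong[of n x_min p] P_x_min by (simp add: mem_cyl)

lemma x_min_closed: "{x_min} \<in> sigma_sets X cyls"
proof -
  have "openin (path_topology B) (X - {x_min})"
    unfolding openin_path_topology
  proof (intro conjI ballI)
    fix x assume x: "x \<in> X - {x_min}"
    then obtain i where "x i \<noteq> x_min i" by blast
    then show "\<exists>n. cyl n x \<subseteq> X - {x_min}"
      by (intro exI[of _ "Suc i"]) (force simp: mem_cyl)
  qed blast
  then have "X - {x_min} \<in> sigma_sets X cyls" unfolding borel_eq[symmetric] by (intro sigma_sets.Basic) simp
  then have "X - (X - {x_min}) \<in> sigma_sets X cyls" by (rule sigma_sets.Compl)
  then show ?thesis using x_min_path by (simp add: double_diff)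
qed

lemma sigma_high_cyls: "sigma_sets X (insert {} (insert {x_min} high_cyls)) = sigma_sets X cyls"
proof (rule sigma_sets_eqI)
  fix c assume "c \<in> insert {} (insert {x_min} high_cyls)"
  moreover have "high_cyls \<subseteq> cyls" unfolding high_cyls_def cyls_def by blast
  ultimately show "c \<in> sigma_sets X cyls"
    using x_min_closed by (auto intro: sigma_sets.Empty sigma_sets.Basic)
next
  let ?S = "sigma_sets X (insert {} (insert {x_min} high_cyls))"
  fix c assume "c \<in> cyls"
  then obtain n p where np: "c = cyl n p" "p \<in> X" unfolding cyls_def by blast
  let ?H = "{d \<in> insert {} (insert {x_min} high_cyls). d \<subseteq> c}"
  have "c = \<Union>?H"
  proof
    show "c \<subseteq> \<Union>?H"
    proof
      fix x assume x: "x \<in> c"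
      then have xX: "x \<in> X" unfolding np(1) by (simp add: mem_cyl)
      show "x \<in> \<Union>?H"
      proof (cases "x = x_min")
        case True
        then show ?thesis using x by blast
      next
        case False
        then obtain m where "0 < P m x" using x_min_if_P_0[OF xX] by blast
        then have "0 < P (max n m) x" using P_mono[of m "max n m" x] by simp
        then have "cyl (max n m) x \<in> high_cyls" unfolding high_cyls_def using xX by blast
        moreover have "cyl (max n m) x \<subseteq> c" using x unfolding np(1) by (intro cyl_mono) auto
        moreover have "x \<in> cyl (max n m) x" using xX by (simp add: mem_cyl)
        ultimately show ?thesis by blast
      qed
    qed
  qed blast
  moreover have "\<Union>?H \<in> ?S"
  proof (rule sigma_sets_UNION)
    have "high_cyls \<subseteq> cyls" unfolding high_cyls_def cyls_def by blast
    then have "countable (insert {} (insert {x_min} high_cyls))"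
      using countable_cyls by (simp add: countable_subset)
    then show "countable ?H" by (rule countable_subset[rotated]) blast
  qed (auto intro: sigma_sets.Basic)
  ultimately show "c \<in> ?S" by metis
qed

lemma Int_stable_high_cyls: "Int_stable (insert {} (insert {x_min} high_cyls))"
proof (rule Int_stableI)
  let ?E = "insert {} (insert {x_min} high_cyls)"
  have *: "cyl n p \<inter> cyl m q \<in> ?E" if "n \<le> m" "p \<in> X" "q \<in> X" "0 < P m q" for n m p q
  proof (cases "cyl n p \<inter> cyl m q = {}")
    case False
    then obtain r where r: "r \<in> cyl n p" "r \<in> cyl m q" by blast
    have "cyl m q \<subseteq> cyl n p" using that(1) r by (auto simp: mem_cyl)
    then have "cyl n p \<inter> cyl m q = cyl m q" by blast
    then show ?thesis using that(3,4) unfolding high_cyls_def by blast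
  qed simp
  have x0: "x_min \<notin> c" if "c \<in> high_cyls" for c
    using that x_min_cylI unfolding high_cyls_def by fastforce
  fix c d assume cd: "c \<in> ?E" "d \<in> ?E"
  show "c \<inter> d \<in> ?E"
  proof (cases "c \<in> high_cyls \<and> d \<in> high_cyls")
    case True
    then obtain n p m q where "c = cyl n p" "p \<in> X" "0 < P n p" "d = cyl m q" "q \<in> X" "0 < P m q"
      unfolding high_cyls_def by blast
    then show ?thesis using *[of n m p q] *[of m n q p] by (cases "n \<le> m") (auto simp: Int_commute)
  next
    case False
    then have "c \<inter> d = {} \<or> c \<inter> d = {x_min}" using cd x0 by blast
    then show ?thesis by blast
  qed
qed

text \<open>A point lies in a single floor of each level, and floor masses tend to 0.\<close>

lemma point_null:
  assumes \<mu>: "tower_measure \<mu>" and x: "x \<in> X"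
  shows "emeasure \<mu> {x} = 0"
proof -
  interpret prob_space \<mu> using \<mu> unfolding tower_measure_def by blast
  have meas: "cyl n x \<in> sets \<mu>" for n
    using \<mu> x unfolding tower_measure_def cyls_def by (auto intro: sigma_sets.Basic)
  have "measure \<mu> {x} \<le> mass \<mu> n 0 + mass \<mu> n 1" for n
  proof -
    have "measure \<mu> {x} \<le> measure \<mu> (cyl n x)"
      using x meas by (intro finite_measure_mono) (auto simp: mem_cyl)
    also have "\<dots> = mass \<mu> n (V n x)" using \<mu> x unfolding tower_measure_def by blast
    also have "\<dots> \<le> mass \<mu> n 0 + mass \<mu> n 1"
    proof -
      have "V n x = 0 \<or> V n x = 1" using V_le[of n x] by linarith
      then show ?thesis using mass_nonneg[of \<mu> n 0] mass_nonneg[of \<mu> n 1] by auto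
    qed
    finally show ?thesis .
  qed
  moreover have "(\<lambda>n. mass \<mu> n 0 + mass \<mu> n 1) \<longlonglongrightarrow> 0 + 0"
    by (intro tendsto_add mass_tendsto \<mu>) auto
  ultimately have "measure \<mu> {x} \<le> 0 + 0" by (intro LIMSEQ_le_const) auto
  then show ?thesis unfolding emeasure_eq_measure by (simp add: measure_le_0_iff)
qed

lemma tower_measure_imp_invariant:
  assumes \<mu>: "tower_measure \<mu>"
  shows "invariant_borel_prob (path_topology B) T \<mu>"
proof -
  let ?E = "insert {} (insert {x_min} high_cyls)"
  interpret prob_space \<mu> using \<mu> unfolding tower_measure_def by blast
  have sp: "space \<mu> = X" "sets \<mu> = sigma_sets X cyls" using \<mu> unfolding tower_measure_def by blast+
  note T = T_measurable[OF \<mu>]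
  have "distr \<mu> \<mu> T = \<mu>"
  proof (rule measure_eqI_generator_eq[OF Int_stable_high_cyls])
    show Pow: "?E \<subseteq> Pow X" unfolding high_cyls_def using cyl_subset x_min_path by blast
    show "sets (distr \<mu> \<mu> T) = sigma_sets X ?E" "sets \<mu> = sigma_sets X ?E"
      unfolding sigma_high_cyls using sp by simp_all
    have "high_cyls \<subseteq> cyls" unfolding high_cyls_def cyls_def by blast
    then have cnt: "countable ?E" using countable_cyls by (simp add: countable_subset)
    \<comment> \<open>The whole space is not in this generator, whose larger members all avoid
      \<open>x_min\<close>; so the required countable cover enumerates the generator itself.\<close>
    have rng: "range (from_nat_into ?E) = ?E" using cnt by (intro range_from_nat_into) auto
    then show "range (from_nat_into ?E) \<subseteq> ?E" by blast
    have "X \<subseteq> \<Union>?E"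
    proof
      fix x assume x: "x \<in> X"
      show "x \<in> \<Union>?E"
      proof (cases "x = x_min")
        case False
        then obtain m where "0 < P m x" using x_min_if_P_0[OF x] by blast
        then have "cyl m x \<in> high_cyls" unfolding high_cyls_def using x by blast
        moreover have "x \<in> cyl m x" using x by (simp add: mem_cyl)
        ultimately show ?thesis by blast
      qed simp
    qed
    then have "\<Union>?E = X" using Pow by blast
    then show "(\<Union>i. from_nat_into ?E i) = X" using rng by simp
    show "emeasure (distr \<mu> \<mu> T) (from_nat_into ?E i) \<noteq> \<infinity>" for i
      using finite_measure.emeasure_finite[OF prob_space.finite_measure[OF prob_space_distr[OF T]]] by simp
    fix c assume c: "c \<in> ?E"
    then have "c \<in> sets \<mu>" unfolding sp(2) sigma_high_cyls[symmetric] by (rule sigma_sets.Basic)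
    then have d: "emeasure (distr \<mu> \<mu> T) c = emeasure \<mu> (T -` c \<inter> X)"
      using emeasure_distr[OF T] sp(1) by simp
    consider "c = {}" | "c = {x_min}" | "c \<in> high_cyls" using c by blast
    then show "emeasure (distr \<mu> \<mu> T) c = emeasure \<mu> c"
    proof cases
      case 2
      have "T -` {x_min} \<inter> X = {x_max}"
        using vershik_max x_max_path inj_onD[OF T_inj] by fastforce
      then show ?thesis using d 2 point_null[OF \<mu>] x_min_path x_max_path by simp
    next
      case 3
      then obtain n p where np: "c = cyl n p" "p \<in> X" "0 < P n p" unfolding high_cyls_def by blast
      then obtain u where u: "u \<in> X" "\<forall>i\<ge>n. u i = p i" "Suc (P n u) = P n p"
        using T_predecessor by blast
      have V: "V n u = V n p" using u(2) by (intro V_cong) simp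
      have "T -` c \<inter> X = cyl n u" unfolding np(1) using T_preimage_cyl[OF u(1) np(2) V] u(3) by simp
      moreover have "measure \<mu> (cyl n u) = measure \<mu> (cyl n p)"
        using \<mu> u(1) np(2) V unfolding tower_measure_def by simp
      ultimately show ?thesis unfolding d emeasure_eq_measure by (simp add: np(1))
    qed simp
  qed
  then show ?thesis unfolding invariant_borel_prob_def borel_eq
    using sp T prob_space_axioms by (simp add: path_topology_eq borel_eq[unfolded path_topology_eq])
qed

lemma invariant_iff_tower_measure:
  "invariant_borel_prob (path_topology B) T \<mu> \<longleftrightarrow> tower_measure \<mu>"
  using invariant_imp_tower_measure tower_measure_imp_invariant by blast

section \<open>Existence: a measure from independent uniform digits\<close>

definition radix :: "nat \<Rightarrow> nat" where
  "radix n = (if n = 0 then 2 else a n + k n)"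

text \<open>Random edge numbers, from which the towers are reconstructed afterwards. This works
  because above the root both towers have the same number of incoming edges; at the root, radix 2
  counts the edges into tower B.\<close>

definition digits :: "(nat \<Rightarrow> nat) measure" where
  "digits = PiM UNIV (\<lambda>n. measure_pmf (pmf_of_set {..<radix n}))"

text \<open>The level-\<open>n\<close> vertex of the path with digit sequence \<open>y\<close>: digits other than \<open>a m - 1\<close> determine
  the source of their edge, whereas the digit \<open>a m - 1\<close> passes on the vertex at level \<open>m + 1\<close>.\<close>

definition digit_vertex :: "nat \<Rightarrow> (nat \<Rightarrow> nat) \<Rightarrow> nat" where
  "digit_vertex n y = (if \<exists>m\<ge>n. (\<forall>i\<in>{n..<m}. y i = a i - 1) \<and> a m \<le> y m then 1 else 0)"

definition digit_path :: "(nat \<Rightarrow> nat) \<Rightarrow> nat \<Rightarrow> nat" where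
  "digit_path y n = enc_edge n (y n) (digit_vertex (Suc n) y)"

text \<open>Two edges end in tower \<open>1\<close> of level \<open>1\<close>, but only one in tower \<open>0\<close>; hence not all digit sequences
  give paths.\<close>

definition admissible :: "(nat \<Rightarrow> nat) set" where
  "admissible = {y. (\<forall>n. y n < radix n) \<and> y 0 < 1 + digit_vertex 1 y}"

lemma radix_ge: "2 \<le> radix n"
  using a_ge_2[of n] by (simp add: radix_def)

lemma radix_pos [simp]: "0 < radix n"
  using radix_ge[of n] by linarith

lemma radix_nonempty: "{..<radix n} \<noteq> {}"
  using radix_pos[of n] by (simp add: lessThan_empty_iff)

interpretation D: product_prob_space "\<lambda>n. measure_pmf (pmf_of_set {..<radix n})" UNIV
  by unfold_locales

interpretation D: prob_space digits
  unfolding digits_def by (rule D.prob_space_axioms)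

lemma space_digits [simp]: "space digits = UNIV"
  by (simp add: digits_def space_PiM)

lemma digit_measurable [measurable]: "(\<lambda>y. y n) \<in> measurable digits (count_space UNIV)"
proof -
  have "(\<lambda>y. y n) \<in> measurable digits (measure_pmf (pmf_of_set {..<radix n}))"
    unfolding digits_def by (rule measurable_component_singleton) simp
  then show ?thesis by (simp add: measurable_cong_sets[OF refl sets_measure_pmf_count_space])
qed

lemma digit_vertex_measurable [measurable]: "digit_vertex n \<in> measurable digits (count_space UNIV)"
  unfolding digit_vertex_def[abs_def] by measurable

lemma digit_borel_measurable [measurable]:
  "(\<lambda>y. y n) \<in> borel_measurable digits" "digit_vertex n \<in> borel_measurable digits"
  by (auto intro: measurable_compose[OF digit_measurable] measurable_compose[OF digit_vertex_measurable])

lemma digit_path_measurable [measurable]: "(\<lambda>y. digit_path y n) \<in> measurable digits (count_space UNIV)"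
  unfolding digit_path_def[abs_def] by measurable

lemma admissible_measurable [measurable]: "admissible \<in> sets digits"
proof -
  have "{y \<in> space digits. (\<forall>n. y n < radix n) \<and> y 0 < 1 + digit_vertex 1 y} \<in> sets digits" by measurable
  then show ?thesis by (simp add: admissible_def)
qed

lemma prob_box:
  assumes "finite J"
  shows "D.prob {y. \<forall>i\<in>J. y i \<in> S i} = (\<Prod>i\<in>J. measure_pmf.prob (pmf_of_set {..<radix i}) (S i))"
proof -
  have "emeasure digits {y \<in> space digits. \<forall>i\<in>J. y i \<in> S i} = (\<Prod>i\<in>J. emeasure (measure_pmf (pmf_of_set {..<radix i})) (S i))"
    unfolding digits_def using assms by (intro D.emeasure_PiM_Collect) auto
  then have "ennreal (D.prob {y. \<forall>i\<in>J. y i \<in> S i}) = ennreal (\<Prod>i\<in>J. measure_pmf.prob (pmf_of_set {..<radix i}) (S i))"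
    by (simp add: D.emeasure_eq_measure measure_pmf.emeasure_eq_measure prod_ennreal)
  then show ?thesis by (simp add: prod_nonneg)
qed

lemma prob_digit: "d < radix n \<Longrightarrow> measure_pmf.prob (pmf_of_set {..<radix n}) {d} = 1 / radix n"
  using radix_nonempty by (subst measure_pmf_of_set) auto

text \<open>\<open>digit_vertex n\<close> depends only on digits from n on and is thus independent
  of the prefix, and all prefixes within the radices are equally likely. The event is split by the
  first level m whose digit decides the vertex, which gives boxes with explicit probability.\<close>

lemma prob_prefix_vertex_1:
  assumes "\<And>i. i < n \<Longrightarrow> d i < radix i" "\<And>i. i < n \<Longrightarrow> e i < radix i"
  shows "D.prob {y. (\<forall>i<n. y i = d i) \<and> digit_vertex n y = 1} = D.prob {y. (\<forall>i<n. y i = e i) \<and> digit_vertex n y = 1}"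
proof -
  let ?A = "\<lambda>d m. if m < n then {} else
      {y. (\<forall>i<n. y i = d i) \<and> (\<forall>i\<in>{n..<m}. y i = a i - 1) \<and> a m \<le> y m}"
  have meas: "?A c m \<in> sets digits" for c m
  proof -
    have "{y \<in> space digits. (\<forall>i<n. y i = c i) \<and> (\<forall>i\<in>{n..<m}. y i = a i - 1) \<and> a m \<le> y m} \<in> sets digits"
      by measurable
    then show ?thesis by simp
  qed
  have un: "{y. (\<forall>i<n. y i = c i) \<and> digit_vertex n y = 1} = (\<Union>m. ?A c m)" for c
    by (auto simp: digit_vertex_def not_less split: if_splits)
  have disj: "disjoint_family (?A c)" for c
  proof -
    have "?A c m \<inter> ?A c m' = {}" if "m < m'" for m m'
    proof (rule ccontr)
      assume "?A c m \<inter> ?A c m' \<noteq> {}"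
      then obtain y where y: "y \<in> ?A c m" "y \<in> ?A c m'" by blast
      then have "n \<le> m" "a m \<le> y m" by (auto split: if_splits)
      moreover have "y m = a m - 1" using y(2) that \<open>n \<le> m\<close> by (auto split: if_splits)
      ultimately show False using a_ge_2[of m] by simp
    qed
    note lt = this
    show ?thesis
      unfolding disjoint_family_on_def
    proof (intro ballI impI)
      fix m m' :: nat assume "m \<noteq> m'"
      then consider "m < m'" | "m' < m" by linarith
      then show "?A c m \<inter> ?A c m' = {}"
      proof cases
        case 1
        then show ?thesis by (rule lt)
      next
        case 2
        from lt[OF this] show ?thesis by (simp only: Int_commute)
      qed
    qed
  qed
  have val: "D.prob (?A c m) = (if m < n then 0 else (\<Prod>i<n. 1 / radix i) * (\<Prod>i\<in>{n..m}. measure_pmf.prob (pmf_of_set {..<radix i}) (if i < m then {a i - 1} else {a m..})))"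
    if "\<And>i. i < n \<Longrightarrow> c i < radix i" for c m
  proof (cases "m < n")
    case False
    let ?S = "\<lambda>i. if i < n then {c i} else if i < m then {a i - 1} else {a m..}"
    let ?p = "\<lambda>i S. measure_pmf.prob (pmf_of_set {..<radix i}) S"
    have "?A c m = {y. \<forall>i\<in>{..m}. y i \<in> ?S i}" 
    proof (rule Set.set_eqI)
      fix y
      have "y \<in> {y. \<forall>i\<in>{..m}. y i \<in> ?S i}" if "y \<in> ?A c m"
        using that False by (auto split: if_splits simp: not_less)
      moreover have "y \<in> ?A c m" if y: "y \<in> {y. \<forall>i\<in>{..m}. y i \<in> ?S i}"
      proof -
        have y: "y i \<in> ?S i" if "i \<le> m" for i using y that by blast
        have "y i = c i" if "i < n" for i using y[of i] that False by simp
        moreover have "y i = a i - 1" if "n \<le> i" "i < m" for i using y[of i] that by simp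
        moreover have "a m \<le> y m" using y[of m] False by simp
        ultimately show ?thesis using False by simp
      qed
      ultimately show "y \<in> ?A c m \<longleftrightarrow> y \<in> {y. \<forall>i\<in>{..m}. y i \<in> ?S i}" by blast
    qed
    then have "D.prob (?A c m) = (\<Prod>i\<in>{..m}. ?p i (?S i))" using prob_box[of "{..m}" ?S] by simp
    also have "{..m} = {..<n} \<union> {n..m}" using False by auto
    also have "(\<Prod>i\<in>{..<n} \<union> {n..m}. ?p i (?S i)) = (\<Prod>i<n. ?p i (?S i)) * (\<Prod>i\<in>{n..m}. ?p i (?S i))"
      by (rule prod.union_disjoint) auto
    also have "(\<Prod>i<n. ?p i (?S i)) = (\<Prod>i<n. 1 / radix i)"
      using that by (intro prod.cong) (auto simp: prob_digit)
    also have "(\<Prod>i\<in>{n..m}. ?p i (?S i)) = (\<Prod>i\<in>{n..m}. ?p i (if i < m then {a i - 1} else {a m..}))"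
      by (intro prod.cong) auto
    finally show ?thesis using False by simp
  qed simp
  have S: "(\<lambda>m. D.prob (?A c m)) sums D.prob (\<Union>m. ?A c m)" for c
  proof (rule D.finite_measure_UNION)
    show "range (?A c) \<subseteq> sets digits" using meas by blast
    show "disjoint_family (?A c)" by (rule disj)
  qed
  have "D.prob (?A d m) = D.prob (?A e m)" for m
    by (rule trans[OF val[OF assms(1)] val[OF assms(2), symmetric]])
  then have eq: "(\<lambda>m. D.prob (?A d m)) = (\<lambda>m. D.prob (?A e m))" by (rule ext)
  have "(\<lambda>m. D.prob (?A d m)) sums D.prob (\<Union>m. ?A d m)" by (rule S)
  moreover have "(\<lambda>m. D.prob (?A e m)) sums D.prob (\<Union>m. ?A e m)" by (rule S)
  ultimately show ?thesis unfolding un eq by (rule sums_unique2)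
qed

lemma prob_prefix_vertex:
  assumes "\<And>i. i < n \<Longrightarrow> d i < radix i" "\<And>i. i < n \<Longrightarrow> e i < radix i" "b \<le> 1"
  shows "D.prob {y. (\<forall>i<n. y i = d i) \<and> digit_vertex n y = b} = D.prob {y. (\<forall>i<n. y i = e i) \<and> digit_vertex n y = b}"
proof (cases "b = 1")
  case True
  then show ?thesis using prob_prefix_vertex_1[OF assms(1,2)] by simp
next
  case False
  then have b: "b = 0" using assms(3) by simp
  have *: "D.prob {y. (\<forall>i<n. y i = d i) \<and> digit_vertex n y = 0} =
      (\<Prod>i<n. 1 / radix i) - D.prob {y. (\<forall>i<n. y i = d i) \<and> digit_vertex n y = 1}"
    if d: "\<And>i. i < n \<Longrightarrow> d i < radix i" for d
  proof -
    have m: "{y \<in> space digits. \<forall>i<n. y i = d i} \<in> sets digits"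
      "{y \<in> space digits. (\<forall>i<n. y i = d i) \<and> digit_vertex n y = 1} \<in> sets digits" by measurable
    have "{y. (\<forall>i<n. y i = d i) \<and> digit_vertex n y = 0} =
        {y. \<forall>i<n. y i = d i} - {y. (\<forall>i<n. y i = d i) \<and> digit_vertex n y = 1}"
      by (auto simp: digit_vertex_def)
    moreover have "D.prob {y. \<forall>i<n. y i = d i} = (\<Prod>i<n. 1 / radix i)"
      using prob_box[of "{..<n}" "\<lambda>i. {d i}"] d by (simp add: prob_digit Ball_def)
    ultimately show ?thesis
      using D.finite_measure_Diff[of "{y. \<forall>i<n. y i = d i}" "{y. (\<forall>i<n. y i = d i) \<and> digit_vertex n y = 1}"] m
      by fastforce
  qed
  show ?thesis unfolding b using *[OF assms(1)] *[OF assms(2)] prob_prefix_vertex_1[OF assms(1,2)] by simp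
qed

text \<open>This is the path condition. A digit from \<open>a n\<close> on starts in B, one below
  \<open>a n - 1\<close> in A, and \<open>a n - 1\<close> in the tower it enters; the default 0 for
  a tail of digits \<open>a i - 1\<close> is consistent with the last case.\<close>

lemma digit_vertex_src: "digit_vertex n y = src_bit n (y n) (digit_vertex (Suc n) y)"
proof -
  have le: "digit_vertex (Suc n) y \<le> 1" by (simp add: digit_vertex_def)
  consider "a n \<le> y n" | "y n = a n - 1" | "y n < a n - 1" by linarith
  then show ?thesis
  proof cases
    case 1
    then have "\<exists>m\<ge>n. (\<forall>i\<in>{n..<m}. y i = a i - 1) \<and> a m \<le> y m" by (intro exI[of _ n]) simp
    then show ?thesis using 1 by (simp add: digit_vertex_def src_bit_def)
  next
    case 2
    have na: "\<not> a n \<le> y n" using 2 a_ge_2[of n] by simp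
    have "(\<exists>m\<ge>n. (\<forall>i\<in>{n..<m}. y i = a i - 1) \<and> a m \<le> y m) \<longleftrightarrow>
        (\<exists>m\<ge>Suc n. (\<forall>i\<in>{Suc n..<m}. y i = a i - 1) \<and> a m \<le> y m)" (is "?l \<longleftrightarrow> ?r")
    proof
      assume ?l
      then obtain m where m: "m \<ge> n" "\<forall>i\<in>{n..<m}. y i = a i - 1" "a m \<le> y m" by blast
      then have "m \<noteq> n" using na by blast
      then show ?r using m by (intro exI[of _ m]) auto
    next
      assume ?r
      then obtain m where m: "m \<ge> Suc n" "\<forall>i\<in>{Suc n..<m}. y i = a i - 1" "a m \<le> y m" by blast
      have "y i = a i - 1" if "i \<in> {n..<m}" for i
        using m(2) 2 that by (cases "i = n") auto
      then show ?l using m by (intro exI[of _ m]) auto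
    qed
    then have "digit_vertex n y = digit_vertex (Suc n) y" by (simp only: digit_vertex_def)
    moreover have "src_bit n (y n) (digit_vertex (Suc n) y) = digit_vertex (Suc n) y"
      using 2 le a_ge_2[of n] by (auto simp: src_bit_def digit_vertex_def)
    ultimately show ?thesis by simp
  next
    case 3
    have "\<not> (\<exists>m\<ge>n. (\<forall>i\<in>{n..<m}. y i = a i - 1) \<and> a m \<le> y m)"
    proof
      assume "\<exists>m\<ge>n. (\<forall>i\<in>{n..<m}. y i = a i - 1) \<and> a m \<le> y m"
      then obtain m where m: "m \<ge> n" "\<forall>i\<in>{n..<m}. y i = a i - 1" "a m \<le> y m" by blast
      show False using m 3 by (cases "m = n") auto
    qed
    then have "digit_vertex n y = 0" by (simp only: digit_vertex_def if_False)
    moreover have "\<not> a n \<le> y n + digit_vertex (Suc n) y" using 3 le by linarith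
    ultimately show ?thesis by (simp add: src_bit_def)
  qed
qed

lemma V_digit_path: "V n (digit_path y) = digit_vertex n y"
  unfolding V_def digit_path_def enc_edge_sel by (rule digit_vertex_src[symmetric])

lemma digit_vertex_le: "digit_vertex n y \<le> 1"
  by (simp add: digit_vertex_def)

lemma digit_path_in: assumes "y \<in> admissible" shows "digit_path y \<in> X"
  unfolding paths_iff
proof
  fix n
  have "y n < Q n (digit_vertex (Suc n) y)"
    using assms unfolding admissible_def Q_def radix_def by (cases "n = 0") (auto split: if_splits dest: spec[of _ n])
  then show "digit_path y n \<in> E n \<and> ebit (digit_path y n) = V (Suc n) (digit_path y)"
    unfolding V_digit_path using digit_vertex_le[of "Suc n" y] by (simp add: digit_path_def)
qed

lemma AE_digits: "AE y in digits. \<forall>n. y n < radix n"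
proof (rule AE_all_countable[THEN iffD2], rule allI)
  fix n
  have "D.prob {y. \<forall>i\<in>{n}. y i \<in> {..<radix n}} = 1"
    unfolding prob_box[OF finite.insertI[OF finite.emptyI]] using radix_nonempty
    by (simp add: measure_pmf_of_set)
  then have "D.prob {y \<in> space digits. y n < radix n} = 1" by simp
  moreover have "{y \<in> space digits. y n < radix n} \<in> sets digits" by measurable
  ultimately show "AE y in digits. y n < radix n"
    using D.prob_Collect_eq_1[of "\<lambda>y. y n < radix n"] by simp
qed

text \<open>The edge number 0 exists at the root for either tower and has probability 1/2
  there.\<close>

lemma prob_admissible: "D.prob admissible \<ge> 1/2"
proof -
  have m: "{y. y 0 = 0} \<in> sets digits"
  proof -
    have "{y \<in> space digits. y 0 = 0} \<in> sets digits" by measurable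
    then show ?thesis by simp
  qed
  have "1/2 = D.prob {y. y 0 = 0}"
    using prob_box[of "{0}" "\<lambda>_. {0}"] prob_digit[of 0 0] by (simp add: radix_def)
  also have "\<dots> \<le> D.prob admissible"
    by (rule D.finite_measure_mono_AE[OF _ admissible_measurable])
       (use AE_digits in \<open>auto simp: admissible_def\<close>)
  finally show ?thesis .
qed

text \<open>The value \<open>x_min\<close> only makes the map total; conditioning gives the
  inadmissible digit sequences probability 0.\<close>

definition path_measure :: "(nat \<Rightarrow> nat) measure" where
  "path_measure = distr (uniform_measure digits admissible) (sigma X cyls)
     (\<lambda>y. if y \<in> admissible then digit_path y else x_min)"

lemma digit_path_borel:
  "(\<lambda>y. if y \<in> admissible then digit_path y else x_min) \<in> measurable digits (sigma X cyls)"
proof (rule measurable_measure_of)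
  show "cyls \<subseteq> Pow X" using cyls_Pow by blast
  show "(\<lambda>y. if y \<in> admissible then digit_path y else x_min) \<in> space digits \<rightarrow> X"
    using digit_path_in x_min_path by auto
  fix c assume "c \<in> cyls"
  then obtain n p where c: "c = cyl n p" unfolding cyls_def by blast
  have "{y \<in> space digits. if y \<in> admissible then (\<forall>i<n. digit_path y i = p i) else (\<forall>i<n. x_min i = p i)} \<in> sets digits"
    by measurable
  moreover have "(\<lambda>y. if y \<in> admissible then digit_path y else x_min) -` c \<inter> space digits =
    {y \<in> space digits. if y \<in> admissible then (\<forall>i<n. digit_path y i = p i) else (\<forall>i<n. x_min i = p i)}"
    unfolding c using digit_path_in x_min_path by (auto simp: mem_cyl)
  ultimately show "(\<lambda>y. if y \<in> admissible then digit_path y else x_min) -` c \<inter> space digits \<in> sets digits"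
    by simp
qed

lemma admissible_pos: "emeasure digits admissible \<noteq> 0" "emeasure digits admissible \<noteq> \<infinity>"
  using prob_admissible unfolding D.emeasure_eq_measure by auto

lemma measure_path_measure:
  assumes "c \<in> sigma_sets X cyls"
  shows "measure path_measure c = D.prob {y \<in> admissible. digit_path y \<in> c} / D.prob admissible"
    and "{y \<in> admissible. digit_path y \<in> c} \<in> sets digits"
proof -
  let ?f = "\<lambda>y. if y \<in> admissible then digit_path y else x_min"
  have c: "c \<in> sets (sigma X cyls)" using assms cyls_Pow by (simp add: sets_measure_of)
  have f: "?f \<in> measurable (uniform_measure digits admissible) (sigma X cyls)"
    using digit_path_borel by (simp cong: measurable_cong_sets)
  have eq: "admissible \<inter> (?f -` c \<inter> space digits) = {y \<in> admissible. digit_path y \<in> c}" by auto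
  have m: "?f -` c \<inter> space digits \<in> sets digits" by (rule measurable_sets[OF digit_path_borel c])
  show "{y \<in> admissible. digit_path y \<in> c} \<in> sets digits"
    using sets.Int[OF admissible_measurable m] unfolding eq .
  have "measure path_measure c = measure (uniform_measure digits admissible) (?f -` c \<inter> space digits)"
    unfolding path_measure_def using measure_distr[OF f c] by simp
  also have "\<dots> = D.prob {y \<in> admissible. digit_path y \<in> c} / D.prob admissible"
    using measure_uniform_measure[OF admissible_pos m] unfolding eq .
  finally show "measure path_measure c = D.prob {y \<in> admissible. digit_path y \<in> c} / D.prob admissible" .
qed

lemma tower_path_measure: "tower_measure path_measure"
proof -
  let ?F = "\<lambda>n p. {y. (\<forall>i<n. y i = idx (p i)) \<and> digit_vertex n y = V n p}"
  have idx: "idx (p i) < radix i" if "p \<in> X" for p i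
    using E_D(2,3)[OF pathsD(1)[OF that, of i]] by (auto simp: Q_def radix_def split: if_splits)
  have Fm: "?F n p \<in> sets digits" for n p
  proof -
    have "{y \<in> space digits. (\<forall>i<n. y i = idx (p i)) \<and> digit_vertex n y = V n p} \<in> sets digits" by measurable
    then show ?thesis by simp
  qed
  \<comment> \<open>For n >= 1 admissibility disappears from the event, since the root edge agrees
    with that of the path p. Conversely, the vertex at level n and the digits below it determine all
    lower vertices downwards.\<close>
  have cylF: "D.prob {y \<in> admissible. digit_path y \<in> cyl n p} = D.prob (?F n p)"
    if p: "p \<in> X" and n: "n \<ge> 1" for n p
  proof (rule D.finite_measure_eq_AE)
    have *: "y \<in> admissible \<and> digit_path y \<in> cyl n p \<longleftrightarrow> y \<in> ?F n p" if y: "\<forall>n. y n < radix n" for y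
    proof
      assume "y \<in> admissible \<and> digit_path y \<in> cyl n p"
      then have d: "digit_path y \<in> X" "\<And>i. i < n \<Longrightarrow> digit_path y i = p i" by (auto simp: mem_cyl)
      then have "V n (digit_path y) = V n p" using p by (intro V_cyl) auto
      moreover have "y i = idx (p i)" if "i < n" for i
        using d(2)[OF that] by (metis digit_path_def enc_edge_sel(2))
      ultimately show "y \<in> ?F n p" unfolding V_digit_path by simp
    next
      assume F: "y \<in> ?F n p"
      have v: "digit_vertex m y = V m p" if "m \<le> n" for m
        using that
      proof (induction m rule: inc_induct)
        case base
        show ?case using F by simp
      next
        case (step m)
        then show ?case using F pathsD(2)[OF p, of m] digit_vertex_src[of m y] by (simp add: V_def[of m])
      qed
      have eq: "digit_path y i = p i" if "i < n" for i
        using F that v[of "Suc i"] pathsD[OF p, of i] E_D(1)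
        by (metis (mono_tags, lifting) digit_path_def enc_edge_collapse mem_Collect_eq Suc_leI)
      have "y 0 < Q 0 (digit_vertex 1 y)"
        using eq[of 0] n E_D(3)[OF pathsD(1)[OF p, of 0]] by (metis One_nat_def digit_path_def enc_edge_sel(2,3) less_eq_Suc_le)
      then have adm: "y \<in> admissible" unfolding admissible_def using y by (simp add: Q_def)
      then show "y \<in> admissible \<and> digit_path y \<in> cyl n p" using digit_path_in eq by (simp add: mem_cyl)
    qed
    show "AE y in digits. y \<in> {y \<in> admissible. digit_path y \<in> cyl n p} \<longleftrightarrow> y \<in> ?F n p"
      using AE_digits by eventually_elim (use * in blast)
    have "cyl n p \<in> sigma_sets X cyls" using p unfolding cyls_def by (intro sigma_sets.Basic) blast
    then show "{y \<in> admissible. digit_path y \<in> cyl n p} \<in> sets digits" by (rule measure_path_measure(2))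
    show "?F n p \<in> sets digits" by (rule Fm)
  qed
  have "measure path_measure (cyl n p) = mass path_measure n (V n p)" if p: "p \<in> X" for n p
  proof (cases "n = 0")
    case True
    then show ?thesis unfolding mass_def by (simp add: cyl_0)
  next
    case False
    then have n: "n \<ge> 1" by simp
    let ?b = "base n (V n p)"
    have "D.prob (?F n p) = D.prob (?F n ?b)"
      unfolding V_base_V[OF p] by (rule prob_prefix_vertex) (use idx p base_path V_le in auto)
    then have eq: "D.prob {y \<in> admissible. digit_path y \<in> cyl n p} = D.prob {y \<in> admissible. digit_path y \<in> cyl n ?b}"
      unfolding cylF[OF p n] cylF[OF base_path n] .
    have c: "cyl n q \<in> sigma_sets X cyls" if "q \<in> X" for q
      using that unfolding cyls_def by (intro sigma_sets.Basic) blast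
    show ?thesis
      unfolding mass_def measure_path_measure(1)[OF c[OF p]] measure_path_measure(1)[OF c[OF base_path]] eq ..
  qed
  moreover have "prob_space path_measure"
    unfolding path_measure_def
    by (intro prob_space.prob_space_distr prob_space_uniform_measure admissible_pos)
       (use digit_path_borel in \<open>simp cong: measurable_cong_sets\<close>)
  moreover have "space path_measure = X" "sets path_measure = sigma_sets X cyls"
    unfolding path_measure_def using cyls_Pow by (simp_all add: space_measure_of_conv sets_measure_of)
  ultimately show ?thesis unfolding tower_measure_def by blast
qed

lemma uniquely_ergodic_B: "uniquely_ergodic (path_topology B) T"
  unfolding uniquely_ergodic_def invariant_iff_tower_measure
  using tower_path_measure tower_measure_unique by blast

text \<open>Of the \<open>a n + k n\<close> equally likely digits, \<open>k n + 1\<close> are at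
  least \<open>a n - 1\<close>, and the conditioning costs at most a factor 2. The threshold is
  \<open>a n - 1\<close> because a smaller edge has only copies of A before and at it, whichever
  tower it enters.\<close>

lemma measure_late_digit:
  assumes n: "n \<ge> 1"
  shows "{x \<in> X. a n - 1 \<le> idx (x n)} \<in> sets path_measure"
    and "measure path_measure {x \<in> X. a n - 1 \<le> idx (x n)} \<le> 2 * ((k n + 1) / (a n + k n))"
proof -
  let ?S = "{x \<in> X. a n - 1 \<le> idx (x n)}"
  have "openin (path_topology B) ?S"
    unfolding openin_path_topology
  proof (intro conjI ballI)
    fix x assume "x \<in> ?S"
    then show "\<exists>m. cyl m x \<subseteq> ?S" by (intro exI[of _ "Suc n"]) (auto simp: mem_cyl)
  qed auto
  then have S: "?S \<in> sigma_sets X cyls" unfolding borel_eq[symmetric] by (intro sigma_sets.Basic) simp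
  then show "?S \<in> sets path_measure" using tower_path_measure unfolding tower_measure_def by blast
  have "D.prob {y \<in> admissible. digit_path y \<in> ?S} \<le> D.prob {y. \<forall>i\<in>{n}. y i \<in> {a n - 1..}}"
  proof (rule D.finite_measure_mono)
    show "{y \<in> admissible. digit_path y \<in> ?S} \<subseteq> {y. \<forall>i\<in>{n}. y i \<in> {a n - 1..}}"
      by (auto simp: digit_path_def)
    have "{y \<in> space digits. a n - 1 \<le> y n} \<in> sets digits" by measurable
    then show "{y. \<forall>i\<in>{n}. y i \<in> {a n - 1..}} \<in> sets digits" by simp
  qed
  also have "\<dots> = measure_pmf.prob (pmf_of_set {..<radix n}) {a n - 1..}"
    using prob_box[of "{n}" "\<lambda>_. {a n - 1..}"] by simp
  also have "\<dots> = card ({..<radix n} \<inter> {a n - 1..}) / radix n"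
    using radix_nonempty by (subst measure_pmf_of_set) auto
  also have "{..<radix n} \<inter> {a n - 1..} = {a n - 1..<radix n}" by auto
  also have "card {a n - 1..<radix n} / radix n = (k n + 1) / (a n + k n)"
    using n a_ge[OF n] by (simp add: radix_def)
  finally have le: "D.prob {y \<in> admissible. digit_path y \<in> ?S} \<le> (k n + 1) / (a n + k n)" .
  have "measure path_measure ?S = D.prob {y \<in> admissible. digit_path y \<in> ?S} / D.prob admissible"
    by (rule measure_path_measure(1)[OF S])
  also have "\<dots> \<le> ((k n + 1) / (a n + k n)) / (1/2)"
    using le prob_admissible by (intro frac_le) auto
  also have "\<dots> = 2 * ((k n + 1) / (a n + k n))" by simp
  finally show "measure path_measure ?S \<le> 2 * ((k n + 1) / (a n + k n))" .
qed

section \<open>Measurable eigenvalues\<close>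

text \<open>For edge numbers below \<open>a n - 1\<close> the offset is exactly i *
  \<open>h n\<close>, so consecutive powers differ by at most i |z^h - 1|, and the increments are
  summable.\<close>

lemma convergent_tower_powers:
  fixes z :: complex
  assumes z: "cmod z = 1" and sum: "summable (\<lambda>n. real (a n + k n) * cmod (z ^ h n - 1))"
    and x: "x \<in> X" and ev: "\<forall>\<^sub>F n in sequentially. idx (x n) < a n - 1"
  shows "convergent (\<lambda>n. z ^ P n x)"
proof -
  let ?F = "\<lambda>n. z ^ P n x"
  obtain N where N: "\<And>n. n \<ge> N \<Longrightarrow> idx (x n) < a n - 1"
    using ev unfolding eventually_sequentially by blast
  have bound: "norm (?F (Suc n) - ?F n) \<le> real (a n + k n) * cmod (z ^ h n - 1)" if n: "n \<ge> N" for n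
  proof -
    let ?i = "idx (x n)"
    have off: "off n ?i (ebit (x n)) = h n * ?i"
      using N[OF n] E_D(2)[OF pathsD(1)[OF x, of n]] by (simp add: off_def)
    have "?F (Suc n) - ?F n = ?F n * ((z ^ h n) ^ ?i - 1)"
      unfolding P_Suc off by (simp only: power_add power_mult right_diff_distrib mult_1_right)
    then have "norm (?F (Suc n) - ?F n) = cmod ((z ^ h n) ^ ?i - 1 ^ ?i)"
      using z by (simp add: norm_mult norm_power)
    also have "\<dots> \<le> ?i * cmod (z ^ h n - 1)"
      using z by (intro norm_power_diff) (simp_all add: norm_power)
    also have "\<dots> \<le> real (a n + k n) * cmod (z ^ h n - 1)"
      using N[OF n] by (intro mult_right_mono) simp_all
    finally show ?thesis .
  qed
  have "summable (\<lambda>n. ?F (Suc n) - ?F n)"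
    by (rule summable_comparison_test[OF _ sum]) (use bound in blast)
  then have "convergent (\<lambda>n. ?F n - ?F 0)"
    unfolding summable_iff_convergent sum_lessThan_telescope[of ?F] .
  then show ?thesis by (simp only: convergent_diff_const_right_iff)
qed

lemma eigenvalue_path_measure:
  fixes z :: complex
  assumes small: "summable (\<lambda>n. (real (k n) + 1) / real (a n + k n))"
    and z: "cmod z = 1" and sum: "summable (\<lambda>n. real (a n + k n) * cmod (z ^ h n - 1))"
  shows "z \<in> eigenvalues path_measure T"
proof -
  interpret prob_space path_measure using tower_path_measure unfolding tower_measure_def by blast
  have sp: "space path_measure = X" "sets path_measure = sigma_sets X cyls"
    using tower_path_measure unfolding tower_measure_def by blast+
  \<comment> \<open>Shifted by one level, since the estimate for late digits starts at level 1;
    Borel-Cantelli then leaves almost surely only finitely many late digits.\<close>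
  define A where "A n = {x \<in> X. a (Suc n) - 1 \<le> idx (x (Suc n))}" for n
  have "AE x in path_measure. eventually (\<lambda>n. x \<in> space path_measure - A n) sequentially"
  proof (rule borel_cantelli_AE1)
    show "A n \<in> sets path_measure" for n unfolding A_def by (rule measure_late_digit(1)) simp
    show "emeasure path_measure (A n) < \<infinity>" for n by (simp add: less_top[symmetric])
    show "summable (\<lambda>n. measure path_measure (A n))"
    proof (rule summable_comparison_test)
      show "\<exists>N. \<forall>n\<ge>N. norm (measure path_measure (A n)) \<le> 2 * ((real (k (Suc n)) + 1) / real (a (Suc n) + k (Suc n)))"
        unfolding A_def using measure_late_digit(2)[of "Suc _"] by (simp add: add.commute)
      show "summable (\<lambda>n. 2 * ((real (k (Suc n)) + 1) / real (a (Suc n) + k (Suc n))))"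
        using small summable_Suc_iff[of "\<lambda>n. (real (k n) + 1) / real (a n + k n)"]
        by (intro summable_mult) blast
    qed
  qed
  then have good: "AE x in path_measure. x \<in> X \<and> (\<forall>\<^sub>F n in sequentially. idx (x n) < a n - 1)"
  proof eventually_elim
    case (elim x)
    then have ev: "\<forall>\<^sub>F n in sequentially. x \<in> X \<and> idx (x (Suc n)) < a (Suc n) - 1"
      unfolding sp(1) A_def by (rule eventually_mono) auto
    then have "x \<in> X" unfolding eventually_sequentially by blast
    moreover have "\<forall>\<^sub>F n in sequentially. idx (x (Suc n)) < a (Suc n) - 1"
      using ev by (rule eventually_mono) simp
    ultimately show ?case using eventually_sequentially_Suc[of "\<lambda>n. idx (x n) < a n - 1"] by blast
  qed
  define f where "f x = lim (\<lambda>n. z ^ P n x)" for x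
  have F: "(\<lambda>x. z ^ P n x) \<in> borel_measurable path_measure" for n
  proof (rule measurableI)
    fix S :: "complex set" assume "S \<in> sets borel"
    \<comment> \<open>The position depends on n coordinates only, so the preimage of any set is
      open.\<close>
    have "openin (path_topology B) {x \<in> X. z ^ P n x \<in> S}"
      unfolding openin_path_topology
    proof (intro conjI ballI)
      fix x assume x: "x \<in> {x \<in> X. z ^ P n x \<in> S}"
      have "cyl n x \<subseteq> {x \<in> X. z ^ P n x \<in> S}"
      proof
        fix y assume y: "y \<in> cyl n x"
        then have "P n y = P n x" by (intro P_cong) (simp add: mem_cyl)
        then show "y \<in> {x \<in> X. z ^ P n x \<in> S}" using x y unfolding mem_cyl by simp
      qed
      then show "\<exists>m. cyl m x \<subseteq> {x \<in> X. z ^ P n x \<in> S}" by blast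
    qed auto
    then have "{x \<in> X. z ^ P n x \<in> S} \<in> sets path_measure"
      unfolding sp(2) borel_eq[symmetric] by (intro sigma_sets.Basic) simp
    moreover have "(\<lambda>x. z ^ P n x) -` S \<inter> space path_measure = {x \<in> X. z ^ P n x \<in> S}"
      unfolding sp(1) by auto
    ultimately show "(\<lambda>x. z ^ P n x) -` S \<inter> space path_measure \<in> sets path_measure" by simp
  qed simp
  have fm: "f \<in> borel_measurable path_measure"
    unfolding f_def[abs_def] using F by (rule borel_measurable_lim_metric)
  have eig: "cmod (f x) = 1 \<and> f (T x) = z * f x"
    if x: "x \<in> X" and ev: "\<forall>\<^sub>F n in sequentially. idx (x n) < a n - 1" for x
  proof
    have lim: "(\<lambda>n. z ^ P n x) \<longlonglongrightarrow> f x"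
      unfolding f_def using convergent_tower_powers[OF z sum x ev] by (simp only: convergent_LIMSEQ_iff)
    have "(\<lambda>n. cmod (z ^ P n x)) \<longlonglongrightarrow> cmod (f x)" using lim by (rule tendsto_norm)
    then show "cmod (f x) = 1" using z by (simp add: norm_power LIMSEQ_const_iff)
    \<comment> \<open>\<open>x_max\<close> has late digits at all levels from 1 on. Any other point
      is below the top floor from some level on, and there T raises its position by one, which
      multiplies the power by z.\<close>
    have "x \<noteq> x_max"
    proof
      assume "x = x_max"
      then have "idx (x n) = Q n 1 - 1" for n by (simp add: x_max_def)
      then have "\<forall>\<^sub>F n in sequentially. Q n 1 - 1 < a n - 1" using ev by simp
      then obtain N where N: "\<And>n. n \<ge> N \<Longrightarrow> Q n 1 - 1 < a n - 1"
        unfolding eventually_sequentially by blast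
      show False using N[of "Suc N"] k_ge[of "Suc N"] by (simp add: Q_def)
    qed
    then obtain n where n: "Suc (P n x) < h n + V n x" using nonmax_tower[OF x] by blast
    have "z ^ P m (T x) = z * z ^ P m x" if "m \<ge> n" for m
      using T_tower(2)[OF x tower_mono[OF x n that]] by simp
    then have "\<forall>m\<ge>n. z * z ^ P m x = z ^ P m (T x)" by simp
    then have ev': "\<forall>\<^sub>F m in sequentially. z * z ^ P m x = z ^ P m (T x)"
      unfolding eventually_sequentially by blast
    have "(\<lambda>m. z * z ^ P m x) \<longlonglongrightarrow> z * f x" by (intro tendsto_intros lim)
    from Lim_transform_eventually[OF this ev'] have "(\<lambda>m. z ^ P m (T x)) \<longlonglongrightarrow> z * f x" .
    then show "f (T x) = z * f x" unfolding f_def by (rule limI)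
  qed
  have ae: "AE x in path_measure. cmod (f x) = 1 \<and> f (T x) = z * f x"
    using good by eventually_elim (use eig in blast)
  have "integrable path_measure (\<lambda>x. (cmod (f x))\<^sup>2) \<longleftrightarrow> integrable path_measure (\<lambda>_. 1 :: real)"
  proof (rule integrable_cong_AE)
    show "(\<lambda>x. (cmod (f x))\<^sup>2) \<in> borel_measurable path_measure" using fm by measurable
    show "AE x in path_measure. (cmod (f x))\<^sup>2 = 1" using ae by eventually_elim simp
  qed simp
  then have "integrable path_measure (\<lambda>x. (cmod (f x))\<^sup>2)" by simp
  moreover have "\<not> (AE x in path_measure. f x = 0)"
  proof
    assume "AE x in path_measure. f x = 0"
    with ae have "AE x in path_measure. False" by eventually_elim simp
    then show False by simp
  qed
  moreover have "AE x in path_measure. f (T x) = z * f x" using ae by eventually_elim simp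
  ultimately show ?thesis unfolding eigenvalues_def using fm by blast
qed

end

section \<open>The copy of the rationals among the eigenvalues\<close>

lemma rat_copy_of_eigenvalues:
  assumes irr: "\<beta> \<notin> \<rat>"
    and eig: "\<And>r. r \<in> \<rat> \<Longrightarrow> cis (2 * pi * (r * \<beta>)) \<in> eigenvalues \<mu> T"
  shows "\<exists>H. subgroup H (eigenvalue_group \<mu> T) \<and>
    rat_additive_group \<cong> (eigenvalue_group \<mu> T)\<lparr>carrier := H\<rparr>"
proof -
  let ?G = "eigenvalue_group \<mu> T"
  define e where "e r = cis (2 * pi * (of_rat r * \<beta>))" for r :: rat
  have e_add: "e (r + s) = e r * e s" for r s
    unfolding e_def cis_mult by (simp add: of_rat_add algebra_simps)
  have e_0: "e 0 = 1" by (simp add: e_def)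
  have e_carrier: "e r \<in> carrier ?G" for r
    using eig[OF Rats_of_rat] by (simp add: e_def eigenvalue_group_def)
  have e_inj: "inj e"
  proof (rule injI)
    fix r s assume "e r = e s"
    then have "e (r - s) * e s = e s" unfolding e_add[symmetric] by simp
    \<comment> \<open>An angle (r - s) \<beta> that is an integer with r - s nonzero would make
      \<beta> rational.\<close>
    then have "e (r - s) = 1" by (simp add: e_def)
    then have "cos (2 * pi * (of_rat (r - s) * \<beta>)) = 1" unfolding e_def by (simp add: complex_eq_iff)
    then obtain j :: int where "2 * pi * (of_rat (r - s) * \<beta>) = of_int j * 2 * pi"
      unfolding cos_one_2pi_int by blast
    then have j: "of_rat (r - s) * \<beta> = of_int j" by simp
    show "r = s"
    proof (rule ccontr)
      assume "r \<noteq> s"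
      then have "of_rat (r - s) \<noteq> (0 :: real)" by simp
      then have "\<beta> = of_int j / of_rat (r - s)" using j by (simp add: field_simps)
      then have "\<beta> \<in> \<rat>" by (metis Rats_divide Rats_of_int Rats_of_rat)
      then show False using irr by blast
    qed
  qed
  \<comment> \<open>The inverse is computed from its definition by cancelling complex numbers, which
    presupposes no group axioms for the set of eigenvalues.\<close>
  have inv: "inv\<^bsub>?G\<^esub> (e r) = e (- r)" for r
    unfolding m_inv_def
  proof (rule the_equality)
    show "e (- r) \<in> carrier ?G \<and> e r \<otimes>\<^bsub>?G\<^esub> e (- r) = \<one>\<^bsub>?G\<^esub> \<and> e (- r) \<otimes>\<^bsub>?G\<^esub> e r = \<one>\<^bsub>?G\<^esub>"
      using e_carrier e_add[of r "- r"] e_add[of "- r" r] e_0 by (simp add: eigenvalue_group_def)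
    fix y assume "y \<in> carrier ?G \<and> e r \<otimes>\<^bsub>?G\<^esub> y = \<one>\<^bsub>?G\<^esub> \<and> y \<otimes>\<^bsub>?G\<^esub> e r = \<one>\<^bsub>?G\<^esub>"
    then have "e r * y = 1" by (simp add: eigenvalue_group_def)
    moreover have "e (- r) * e r = 1" using e_add[of "- r" r] e_0 by simp
    ultimately show "y = e (- r)" by (metis mult.assoc mult_1 mult.right_neutral)
  qed
  have "subgroup (range e) ?G"
  proof
    show "range e \<subseteq> carrier ?G" using e_carrier by blast
    show "x \<otimes>\<^bsub>?G\<^esub> y \<in> range e" if xy: "x \<in> range e" "y \<in> range e" for x y
    proof -
      from xy obtain r s where "x = e r" "y = e s" by blast
      then have "x \<otimes>\<^bsub>?G\<^esub> y = e (r + s)" by (simp add: e_add eigenvalue_group_def)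
      then show ?thesis by simp
    qed
    have "\<one>\<^bsub>?G\<^esub> = e 0" using e_0 by (simp add: eigenvalue_group_def)
    then show "\<one>\<^bsub>?G\<^esub> \<in> range e" by simp
    show "inv\<^bsub>?G\<^esub> x \<in> range e" if "x \<in> range e" for x using that inv by auto
  qed
  moreover have "e \<in> iso rat_additive_group (?G\<lparr>carrier := range e\<rparr>)"
    unfolding iso_def hom_def bij_betw_def using e_inj e_add
    by (auto simp: rat_additive_group_def eigenvalue_group_def)
  then have "rat_additive_group \<cong> ?G\<lparr>carrier := range e\<rparr>" unfolding is_iso_def by blast
  ultimately show ?thesis by blast
qed

section \<open>The parameters and the final system\<close>

definition cf_k :: "nat \<Rightarrow> nat" where "cf_k n = n * (n + 1) * cf_den (n - 1)"
text \<open>With a + k = \<open>cf_quot\<close> and k_{n+1} = (n+1) (n+2) \<open>cf_den n\<close>,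
  the additive term of the height recursion becomes the second term of the continued fraction
  recursion, so the heights are the denominators.\<close>

definition cf_a :: "nat \<Rightarrow> nat" where "cf_a n = (if n = 0 then 3 else cf_quot n - cf_k n)"

text \<open>The summand 2 secures 2 <= a, and the power of 2 makes (k + 1) / (a + k)
  summable.\<close>

lemma cf_k_less: "2 ^ n * (cf_k n + 2) \<le> cf_quot n"
proof -
  have "n * (n + 1) * cf_den (n - 1) + 2 \<le> (n + 1) * (n + 2) * cf_den (n - 1)"
    using cf_den_pos[of "n - 1"] mult_le_mono2[of 1 "cf_den (n - 1)" "2 * (n + 1)"]
    by (simp add: algebra_simps)
  then have "2 ^ n * (cf_k n + 2) \<le> 2 ^ n * ((n + 1) * (n + 2) * cf_den (n - 1))"
    unfolding cf_k_def by (rule mult_le_mono2)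
  also have "\<dots> \<le> 2 ^ (n + 1) * (n + 1) * (n + 2) * cf_den (n - 1)" by (simp add: algebra_simps)
  also have "\<dots> \<le> cf_quot n" by (rule cf_quot_lower(1))
  finally show ?thesis .
qed

interpretation cf: two_towers cf_a cf_k
proof
  show "cf_a 0 = 3" by (simp add: cf_a_def)
  fix n :: nat assume n: "1 \<le> n"
  have "1 * (cf_k n + 2) \<le> 2 ^ n * (cf_k n + 2)" by (intro mult_le_mono1) simp
  then show "2 \<le> cf_a n" using cf_k_less[of n] n by (simp add: cf_a_def)
  have "1 * 2 * 1 \<le> n * (n + 1) * cf_den (n - 1)"
    using n cf_den_pos[of "n - 1"] by (intro mult_le_mono) auto
  then show "2 \<le> cf_k n" by (simp add: cf_k_def)
qed

lemma cf_a_plus_k: "n \<ge> 1 \<Longrightarrow> cf_a n + cf_k n = cf_quot n"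
proof -
  assume n: "n \<ge> 1"
  have "1 * (cf_k n + 2) \<le> 2 ^ n * (cf_k n + 2)" by (intro mult_le_mono1) simp
  then show ?thesis using cf_k_less[of n] n by (simp add: cf_a_def)
qed

lemma tower_height_cf: "tower_height cf_a cf_k n = cf_den n"
proof (induction n rule: cf_den.induct)
  case (3 n)
  have "tower_height cf_a cf_k (Suc (Suc n)) = cf_quot (Suc n) * cf_den (Suc n) + cf_k (Suc n)"
    using 3 cf_a_plus_k[of "Suc n"] by simp
  also have "cf_k (Suc n) = (n + 1) * (n + 2) * cf_den n" by (simp add: cf_k_def)
  finally show ?case unfolding cf_den_Suc_Suc .
qed simp_all

lemma summable_cf_ratio: "summable (\<lambda>n. (real (cf_k n) + 1) / real (cf_a n + cf_k n))"
proof (rule summable_comparison_test)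
  have "norm ((real (cf_k n) + 1) / real (cf_a n + cf_k n)) \<le> (1/2) ^ n" if n: "n \<ge> 1" for n
  proof -
    have "2 ^ n * (cf_k n + 1) \<le> cf_quot n"
      using cf_k_less[of n] mult_le_mono2[of "cf_k n + 1" "cf_k n + 2" "2 ^ n"] by simp
    then have "real (2 ^ n * (cf_k n + 1)) \<le> cf_quot n" by (rule of_nat_mono)
    moreover have "cf_quot n > 0" using cf_k_less[of n] by (cases "cf_quot n = 0") auto
    ultimately show ?thesis unfolding cf_a_plus_k[OF n] by (simp add: field_simps power_divide)
  qed
  then show "\<exists>N. \<forall>n\<ge>N. norm ((real (cf_k n) + 1) / real (cf_a n + cf_k n)) \<le> (1/2) ^ n" by blast
qed (simp add: summable_geometric)

theorem corollary29:
  shows "\<exists>(X :: (nat \<Rightarrow> nat) topology) T \<mu>.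
           minimal_cantor_system X T \<and>
           topologically_weakly_mixing X T \<and>
           finite_topological_rank X T \<and>
           uniquely_ergodic X T \<and>
           invariant_borel_prob X T \<mu> \<and>
           (\<exists>H. subgroup H (eigenvalue_group \<mu> T) \<and>
                rat_additive_group \<cong> (eigenvalue_group \<mu> T)\<lparr>carrier := H\<rparr>)"
proof (rule cf_limit)
  fix \<beta> :: real
  assume irr: "\<beta> \<notin> \<rat>"
    and sum: "\<And>r. r \<in> \<rat> \<Longrightarrow> summable (\<lambda>n. real (cf_quot n) * cmod (cis (2 * pi * (r * \<beta>)) ^ cf_den n - 1))"
  have "cis (2 * pi * (r * \<beta>)) \<in> eigenvalues cf.path_measure cf.T" if r: "r \<in> \<rat>" for r
  proof (rule cf.eigenvalue_path_measure[OF summable_cf_ratio norm_cis])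
    let ?z = "cis (2 * pi * (r * \<beta>))"
    \<comment> \<open>The sums a + k and \<open>cf_quot\<close> agree only from level 1 on, because
      \<open>cf_a 0\<close> has the fixed value 3; hence the detour through shifted series.\<close>
    have "summable (\<lambda>n. real (cf_a (Suc n) + cf_k (Suc n)) * cmod (?z ^ cf_den (Suc n) - 1))"
      using sum[OF r] summable_Suc_iff[of "\<lambda>n. real (cf_quot n) * cmod (?z ^ cf_den n - 1)"]
      by (simp only: cf_a_plus_k[of "Suc _"] Suc_le_eq One_nat_def zero_less_Suc)
    then show "summable (\<lambda>n. real (cf_a n + cf_k n) * cmod (?z ^ tower_height cf_a cf_k n - 1))"
      unfolding tower_height_cf
      using summable_Suc_iff[of "\<lambda>n. real (cf_a n + cf_k n) * cmod (?z ^ cf_den n - 1)"] by blast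
  qed
  then have "\<exists>H. subgroup H (eigenvalue_group cf.path_measure cf.T) \<and>
      rat_additive_group \<cong> (eigenvalue_group cf.path_measure cf.T)\<lparr>carrier := H\<rparr>"
    by (rule rat_copy_of_eigenvalues[OF irr])
  moreover have "invariant_borel_prob (path_topology cf.B) cf.T cf.path_measure"
    unfolding cf.invariant_iff_tower_measure by (rule cf.tower_path_measure)
  ultimately show ?thesis
    using cf.minimal_B cf.weakly_mixing_B cf.finite_rank_B cf.uniquely_ergodic_B by blast
qed

end
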